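(* Let $\mathcal{T}$ be a singular triangulation of a connected, closed, oriented 3-dimensional pseudo-manifold $P$, with set of tetrahedra $T$ and set of edges $E$. Let $\mathcal{L}$ be the set of longitudes on the vertex links, let $G\colon\mathbb{H}^T\to\mathbb{C}^E$ be the log-curvature map and $H_{\mathcal{L}}\colon\mathbb{H}^T\to\mathbb{C}^{\mathcal{L}}$ the boundary map. Then the derivative $d(G,H_{\mathcal{L}})\colon T_z(\mathbb{H}^T)\to\mathbb{C}^E\times\mathbb{C}^{\mathcal{L}}$ of the map $z\mapsto (G(z),H_{\mathcal{L}}(z))$ is injective for any $z\in\mathbb{H}^T$.
   Context: Triangulation. Let $\widetilde{\Delta}$ be a finite disjoint union of oriented Euclidean 3-simplices and $\Phi$ a family of orientation-reversing affine isomorphisms pairing the 2-dimensional faces of $\widetilde\Delta$, closed under inverses and such that every face is the domain of a unique element of $\Phi$. The quotient $P=\widetilde\Delta/\Phi$, assumed connected, is a closed orientable 3-dimensional pseudo-manifold with quotient map $p\colon\widetilde\Delta\to P$, and $\mathcal{T}=(\widetilde\Delta,\Phi,p)$ is a (singular) triangulation of $P$. $T$ is the set of 3-simplices of $\widetilde\Delta$; $E$ and $V=\{v_i\}$ are the sets of edges and vertices of $P$, i.e. the equivalence classes of 1- and 0-simplices of $\widetilde\Delta$. For $v\in V$, $\mathrm{Lk}(v)$ denotes the vertex link, a closed orientable surface, oriented by the orientation of $P$, with triangulation induced from $\mathcal{T}$ (its triangles are normal triangles cutting off corners of the tetrahedra; each vertex of such a triangle in $\sigma$ lies on an edge of $\sigma$).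 The genus of $\mathrm{Lk}(v_i)$ is $g_i\ge0$. Quadrilateral types. A quadrilateral type $q$ in a 3-simplex $\sigma$ is a pair $q=\{e_0,e_1\}$ of opposite edges of $\sigma$ (we write $q<\sigma$); each $\sigma$ has three. The orientation of $\sigma$ gives a cyclic order $q\to q'\to q''\to q$ on them: if the vertices of $\sigma$ are labelled $0,1,2,3$ compatibly with the orientation, it is (type containing edge $01$) $\to$ (type containing $02$) $\to$ (type containing $03$) $\to$ (type containing $01$). $\Box$ is the set of all quadrilateral types of all $\sigma\in T$. For $q\in\Box$, $e\in E$, $i(q,e)\in\{0,1,2\}$ is the number of the two edges in $q$ that are mapped by $p$ to $e$. Log-curvature map. Let $\mathbb{H}\subset\mathbb{C}$ be the open upper half plane and $Z=\{z\in\mathbb{H}^{\Box} : z(q')=\tfrac{1}{1-z(q)}\ \text{for all } q\in\Box\}$. Fixing a preferred quadrilateral type $q_\sigma<\sigma$ for each $\sigma\in T$, $Z$ is identified with $\mathbb{H}^T$ via $z\mapsto (z(q_\sigma))_{\sigma\in T}$. The log-curvature map $G\colon Z=\mathbb{H}^T\to\mathbb{C}^E$ is $G(z)(e)=\sum_{q\in\Box} i(q,e)\log z(q)$, where $\log$ is the standard branch on $\mathbb{C}\setminus(-\infty,0]$. Normal curves and log holonomy. A closed normal curve on $\mathrm{Lk}(v)$ avoids the vertices of the induced triangulation, is transverse to its edges, and meets each triangle in arcs (segments) joining distinct sides. For an oriented closed normal curve $\alpha$, let $S_\alpha$ be its set of oriented segments. A segment $s$ in a triangle $t$ contained in a tetrahedron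 $\sigma$ isolates one vertex $x_s$ of $t$ from the other two; $q_s<\sigma$ is the quadrilateral type containing the edge of $\sigma$ through $x_s$. Set $\eta(s)=+1$ if $x_s$ lies on the right side of $s$ and $\eta(s)=-1$ if on the left side, as viewed from the vertex $v$ (the cusp). Put $\eta(q,s)=\eta(s)$ if $q=q_s$ and $0$ otherwise, and $\eta(q,\alpha)=\sum_{s\in S_\alpha}\eta(q,s)$. The log holonomy of $\alpha$ is $h_\alpha\colon Z\to\mathbb{C}$, $h_\alpha(z)=\sum_{q\in\Box}\eta(q,\alpha)\log z(q)$. Boundary map. For each $v_i\in V$ choose a canonical generating set $\mathcal{L}_i\cup\mathcal{M}_i$ of the fundamental group of $\mathrm{Lk}(v_i)$, with longitudes $\mathcal{L}_i=\{\lambda^i_1,\dots,\lambda^i_{g_i}\}$ and meridians $\mathcal{M}_i=\{\mu^i_1,\dots,\mu^i_{g_i}\}$, all oriented closed normal curves, such that the algebraic intersection number satisfies $\iota(\lambda^i_j,\mu^i_j)=1$ for all $j$ and is $0$ for all other pairs of elements of $\mathcal{L}_i\cup\mathcal{M}_i$ (up to the antisymmetry of $\iota$). Let $\mathcal{L}=\bigcup_i\mathcal{L}_i$. The boundary map $H_{\mathcal{L}}\colon Z=\mathbb{H}^T\to\mathbb{C}^{\mathcal{L}}$ is $H_{\mathcal{L}}(z)(\lambda)=h_\lambda(z)$ for $\lambda\in\mathcal{L}$. *)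

theory Defs
  imports "HOL-Analysis.Analysis"
begin

section \<open>Singular triangulations\<close>

text \<open>
  The set of tetrahedra is a finite type \<open>'t\<close>. The vertices of each tetrahedron are labelled by
  \<open>0, 1, 2, 3 :: 4\<close> compatibly with its orientation; by convention this means that, seen from
  the vertex 0, the vertices 1, 2, 3 appear in counterclockwise order. Hence \<open>b, c, d\<close> appear in
  counterclockwise order seen from \<open>a\<close> iff \<open>(a, b, c, d)\<close> is an even permutation of
  \<open>(0, 1, 2, 3)\<close>.

  A face is a pair \<open>(\<sigma>, i)\<close>, meaning the face of \<open>\<sigma>\<close> opposite to the vertex \<open>i\<close>. An affine
  isomorphism between faces is determined by its action on vertices: \<open>\<Phi> \<sigma> i = (\<tau>, \<pi>)\<close> means that
  the face \<open>(\<sigma>, i)\<close> is paired with the face \<open>(\<tau>, \<pi> i)\<close> by the vertex map \<open>\<pi>\<close> restricted to the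
  labels different from \<open>i\<close>. The pairing reverses the orientations of the two faces iff the
  permutation \<open>\<pi>\<close> is odd. That every face is the domain of exactly one pairing is built into the
  functional form of \<open>\<Phi>\<close>.
\<close>

type_synonym 't face_pairing = "'t \<Rightarrow> 4 \<Rightarrow> 't \<times> (4 \<Rightarrow> 4)"

definition oriented_triangulation :: "'t::finite face_pairing \<Rightarrow> bool" where
  "oriented_triangulation \<Phi> \<longleftrightarrow>
     (\<forall>\<sigma> i \<tau> \<pi>. \<Phi> \<sigma> i = (\<tau>, \<pi>) \<longrightarrow>
        bij \<pi> \<and> sign \<pi> = -1 \<and> (\<tau>, \<pi> i) \<noteq> (\<sigma>, i) \<and> \<Phi> \<tau> (\<pi> i) = (\<sigma>, inv \<pi>)) \<and>
     (\<forall>\<sigma> \<tau>. (\<sigma>, \<tau>) \<in> {(\<sigma>, fst (\<Phi> \<sigma> i)) | \<sigma> i. True}\<^sup>*)"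

text \<open>
  A simplex of the disjoint union of the tetrahedra is a pair of a tetrahedron and a set of labels.
  The relation below is symmetric for a triangulation, so its reflexive transitive closure
  identifies exactly the simplices with the same image in the quotient.
\<close>

definition simplex_glue :: "'t face_pairing \<Rightarrow> (('t \<times> 4 set) \<times> ('t \<times> 4 set)) set" where
  "simplex_glue \<Phi> = {((\<sigma>, X), (\<tau>, \<pi> ` X)) | \<sigma> X i \<tau> \<pi>. i \<notin> X \<and> \<Phi> \<sigma> i = (\<tau>, \<pi>)}"

type_synonym 't simplex_class = "('t \<times> 4 set) set"

definition edges :: "'t face_pairing \<Rightarrow> 't simplex_class set" where
  "edges \<Phi> = {(\<sigma>, X). card X = 2} // (simplex_glue \<Phi>)\<^sup>*"

definition vertices :: "'t face_pairing \<Rightarrow> 't simplex_class set" where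
  "vertices \<Phi> = {(\<sigma>, X). card X = 1} // (simplex_glue \<Phi>)\<^sup>*"


section \<open>Quadrilateral types and the log-curvature map\<close>

text \<open>A quadrilateral type is a tetrahedron with a pair \<open>{X, - X}\<close> of opposite edges.\<close>

type_synonym 't quad = "'t \<times> 4 set set"

definition quads_in :: "'t \<Rightarrow> 't quad set" where
  "quads_in \<sigma> = {(\<sigma>, {X, - X}) | X. card X = 2}"

definition quads :: "'t quad set" where
  "quads = (\<Union>\<sigma>. quads_in \<sigma>)"

definition next_quad :: "'t quad \<Rightarrow> 't quad" where
  "next_quad q = (fst q,
     if {0, 1} \<in> snd q then {{0, 2}, {1, 3}}
     else if {0, 2} \<in> snd q then {{0, 3}, {1, 2}}
     else {{0, 1}, {2, 3}})"

definition quad_edge_index :: "'t quad \<Rightarrow> 't simplex_class \<Rightarrow> nat" where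
  "quad_edge_index q e = card {X \<in> snd q. (fst q, X) \<in> e}"

definition shape_space :: "('t quad \<Rightarrow> complex) set" where
  "shape_space = {z \<in> quads \<rightarrow>\<^sub>E {w. Im w > 0}. \<forall>q\<in>quads. z (next_quad q) = 1 / (1 - z q)}"

definition upper_half_space :: "(complex ^ 't::finite) set" where
  "upper_half_space = {w. \<forall>\<sigma>. Im (w $ \<sigma>) > 0}"

definition shape_coords :: "('t \<Rightarrow> 't quad) \<Rightarrow> ('t quad \<Rightarrow> complex) \<Rightarrow> complex ^ 't::finite" where
  "shape_coords pref z = (\<chi> \<sigma>. z (pref \<sigma>))"

definition shape_of :: "('t \<Rightarrow> 't quad) \<Rightarrow> complex ^ 't::finite \<Rightarrow> ('t quad \<Rightarrow> complex)" where
  "shape_of pref = inv_into shape_space (shape_coords pref)"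

lemma card_2_labels:
  fixes X :: "4 set"
  assumes "card X = 2"
  shows "X \<in> {{0,1},{2,3},{0,2},{1,3},{0,3},{1,2}}"
proof -
  obtain a b where X: "X = {a, b}" "a \<noteq> b" using assms by (auto simp: card_2_iff)
  have ab: "x \<in> {0,1,2,3}" for x :: 4 using exhaust_4[of x] by auto
  from ab[of a] ab[of b] X(2) show ?thesis unfolding X(1)
    by (elim insertE emptyE) (simp_all add: doubleton_eq_iff)
qed

lemma compl_labels:
  "- {0,1} = {2,3::4}" "- {2,3::4} = {0,1}" "- {0,2} = {1,3::4}"
  "- {1,3::4} = {0,2}" "- {0,3} = {1,2::4}" "- {1,2::4} = {0,3}"
proof -
  have "x \<in> {0,1,2,3}" for x :: 4 using exhaust_4[of x] by auto
  then have U: "(UNIV::4 set) = {0,1,2,3}" by blast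
  show "- {0,1} = {2,3::4}" "- {2,3::4} = {0,1}" "- {0,2} = {1,3::4}"
    "- {1,3::4} = {0,2}" "- {0,3} = {1,2::4}" "- {1,2::4} = {0,3}"
    unfolding Compl_eq_Diff_UNIV U by auto
qed

lemma quads_in_eq:
  "quads_in \<sigma> = {(\<sigma>, {{0,1},{2,3}}), (\<sigma>, {{0,2},{1,3}}), (\<sigma>, {{0,3},{1,2}})}" (is "_ = ?R")
proof (intro equalityI subsetI)
  fix q assume "q \<in> quads_in \<sigma>"
  then obtain X where q: "q = (\<sigma>, {X, - X})" and X: "card X = 2" by (auto simp: quads_in_def)
  have q': "q = (\<sigma>, {- X, X})" using q by blast
  have "X = {0,1} \<or> X = {2,3} \<or> X = {0,2} \<or> X = {1,3} \<or> X = {0,3} \<or> X = {1,2}"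
    using card_2_labels[OF X] unfolding insert_iff empty_iff simp_thms .
  then have "q = (\<sigma>, {{0,1},{2,3}}) \<or> q = (\<sigma>, {{0,2},{1,3}}) \<or> q = (\<sigma>, {{0,3},{1,2}})"
    using q q' compl_labels by metis
  then show "q \<in> ?R" unfolding insert_iff empty_iff simp_thms .
next
  have mem: "(\<sigma>, {X, - X}) \<in> quads_in \<sigma>" if "card X = 2" for X
    using that by (auto simp: quads_in_def)
  fix q assume "q \<in> ?R"
  then show "q \<in> quads_in \<sigma>"
    using mem[of "{0,1}"] mem[of "{0,2}"] mem[of "{0,3}"]
    unfolding compl_labels by (elim insertE emptyE) simp_all
qed

lemma next_quad_simps:
  "next_quad (\<sigma>, {{0,1},{2,3}}) = (\<sigma>, {{0,2},{1,3}})"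
  "next_quad (\<sigma>, {{0,2},{1,3}}) = (\<sigma>, {{0,3},{1,2}})"
  "next_quad (\<sigma>, {{0,3},{1,2}}) = (\<sigma>, {{0,1},{2,3}})"
  by (simp_all add: next_quad_def doubleton_eq_iff)

lemma quads_in_pref:
  assumes "q \<in> quads_in \<sigma>"
  shows "quads_in \<sigma> = {q, next_quad q, next_quad (next_quad q)}"
    and "next_quad (next_quad (next_quad q)) = q"
    and "next_quad q \<noteq> q" "next_quad (next_quad q) \<noteq> q" "next_quad (next_quad q) \<noteq> next_quad q"
proof -
  have ne: "{{0,1},{2,3::4}} \<noteq> {{0,2},{1,3}}" "{{0,2},{1,3::4}} \<noteq> {{0,3},{1,2}}"
    "{{0,3},{1,2::4}} \<noteq> {{0,1},{2,3}}"
    by (simp_all add: doubleton_eq_iff)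
  define A B C where "A = (\<sigma>, {{0,1},{2,3::4}})" "B = (\<sigma>, {{0,2},{1,3::4}})"
    "C = (\<sigma>, {{0,3},{1,2::4}})"
  note ABC = A_B_C_def
  have distinct: "A \<noteq> B" "B \<noteq> C" "C \<noteq> A"
    unfolding ABC prod.inject using ne by fast+
  have set: "quads_in \<sigma> = {A, B, C}" and nxt: "next_quad A = B" "next_quad B = C" "next_quad C = A"
    unfolding ABC by (rule quads_in_eq next_quad_simps)+
  have "q = A \<or> q = B \<or> q = C" using assms unfolding set by simp
  then have "quads_in \<sigma> = {q, next_quad q, next_quad (next_quad q)} \<and>
    next_quad (next_quad (next_quad q)) = q \<and>
    next_quad q \<noteq> q \<and> next_quad (next_quad q) \<noteq> q \<and> next_quad (next_quad q) \<noteq> next_quad q"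
    unfolding set using distinct by (elim disjE) (auto simp: nxt)
  then show "quads_in \<sigma> = {q, next_quad q, next_quad (next_quad q)}"
    "next_quad (next_quad (next_quad q)) = q"
    "next_quad q \<noteq> q" "next_quad (next_quad q) \<noteq> q" "next_quad (next_quad q) \<noteq> next_quad q"
    by simp_all
qed

lemma fst_quads_in: "q \<in> quads_in \<sigma> \<Longrightarrow> fst q = \<sigma>"
  by (auto simp: quads_in_def)

lemma quads_iff: "q \<in> quads \<longleftrightarrow> q \<in> quads_in (fst q)"
  by (auto simp: quads_def quads_in_def)

lemma Im_shape_step:
  assumes "Im w > 0"
  shows "Im (1 / (1 - w)) > 0" and "1 / (1 - 1 / (1 - 1 / (1 - w))) = w"
proof -
  have nz: "1 - w \<noteq> 0" "w \<noteq> 0" using assms by auto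
  have "Im (1 / (1 - w)) = Im w / (cmod (1 - w))\<^sup>2"
    by (simp add: Im_divide cmod_power2)
  moreover have "(cmod (1 - w))\<^sup>2 > 0" using nz by simp
  ultimately show "Im (1 / (1 - w)) > 0" using assms divide_pos_pos by metis
  have 1: "1 - 1 / (1 - w) = - w / (1 - w)" using nz by (simp add: field_simps)
  have "1 / (1 - 1 / (1 - w)) = (w - 1) / w" unfolding 1 using nz by (simp add: field_simps)
  moreover have "1 - (w - 1) / w = 1 / w" using nz by (simp add: field_simps)
  ultimately show "1 / (1 - 1 / (1 - 1 / (1 - w))) = w" by simp
qed

text \<open>The coordinates given by preferred quadrilateral types identify the two shape spaces.\<close>

lemma bij_betw_shape_coords:
  fixes pref :: "'t::finite \<Rightarrow> 't quad"
  assumes pref: "\<And>\<sigma>. pref \<sigma> \<in> quads_in \<sigma>"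
  shows "bij_betw (shape_coords pref) shape_space upper_half_space"
proof (rule bij_betw_imageI)
  have pq: "pref \<sigma> \<in> quads" "next_quad (pref \<sigma>) \<in> quads" "next_quad (next_quad (pref \<sigma>)) \<in> quads" for \<sigma>
    using pref[of \<sigma>] quads_in_pref(1)[OF pref[of \<sigma>]] by (auto simp: quads_def)
  have cases: "q = pref (fst q) \<or> q = next_quad (pref (fst q)) \<or> q = next_quad (next_quad (pref (fst q)))"
    if "q \<in> quads" for q
    using that quads_in_pref(1)[OF pref[of "fst q"]] by (auto simp: quads_iff)
  show "inj_on (shape_coords pref) shape_space"
  proof (rule inj_onI)
    fix y z :: "'t quad \<Rightarrow> complex"
    assume y: "y \<in> shape_space" and z: "z \<in> shape_space" and eq: "shape_coords pref y = shape_coords pref z"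
    have 0: "y (pref \<sigma>) = z (pref \<sigma>)" for \<sigma>
      using eq by (simp add: shape_coords_def vec_eq_iff)
    have step: "y (next_quad q) = z (next_quad q)" if "q \<in> quads" "y q = z q" for q
      using y z that by (simp add: shape_space_def)
    have "y q = z q" if "q \<in> quads" for q
      using cases[OF that] 0 step pq by metis
    moreover have "y \<in> extensional quads" "z \<in> extensional quads"
      using y z by (auto simp: shape_space_def PiE_def)
    ultimately show "y = z" by (auto intro: extensionalityI)
  qed
  show "shape_coords pref ` shape_space = upper_half_space"
  proof (intro equalityI subsetI)
    fix w assume "w \<in> shape_coords pref ` shape_space"
    then show "w \<in> upper_half_space"
      using pq by (auto simp: shape_coords_def shape_space_def upper_half_space_def)
  next
    fix w :: "complex ^ 't" assume "w \<in> upper_half_space"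
    then have w: "Im (w $ \<sigma>) > 0" for \<sigma> by (simp add: upper_half_space_def)
    define z where "z = (\<lambda>q. if q \<in> quads then
        (if q = pref (fst q) then w $ fst q
         else if q = next_quad (pref (fst q)) then 1 / (1 - w $ fst q)
         else 1 / (1 - 1 / (1 - w $ fst q))) else undefined)"
    have f: "fst (pref \<sigma>) = \<sigma>" "fst (next_quad q) = fst q" for \<sigma> q
      using fst_quads_in[OF pref] by (auto simp: next_quad_def)
    have z0: "z (pref \<sigma>) = w $ \<sigma>" for \<sigma> by (simp add: z_def pq f)
    have z1: "z (next_quad (pref \<sigma>)) = 1 / (1 - w $ \<sigma>)" for \<sigma>
      using quads_in_pref(3)[OF pref[of \<sigma>]] by (simp add: z_def pq f)
    have z2: "z (next_quad (next_quad (pref \<sigma>))) = 1 / (1 - 1 / (1 - w $ \<sigma>))" for \<sigma>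
      using quads_in_pref(4,5)[OF pref[of \<sigma>]] by (simp add: z_def pq f)
    have "Im (z q) > 0 \<and> z (next_quad q) = 1 / (1 - z q)" if "q \<in> quads" for q
      using cases[OF that]
    proof (elim disjE)
      assume q: "q = pref (fst q)"
      show ?thesis using w z0[of "fst q"] z1[of "fst q"] q by metis
    next
      assume q: "q = next_quad (pref (fst q))"
      show ?thesis using Im_shape_step(1)[OF w] z1[of "fst q"] z2[of "fst q"] q by metis
    next
      assume q: "q = next_quad (next_quad (pref (fst q)))"
      have "next_quad q = pref (fst q)" using q quads_in_pref(2)[OF pref] by metis
      then show ?thesis
        using Im_shape_step(1)[OF Im_shape_step(1)[OF w]] Im_shape_step(2)[OF w] z0[of "fst q"] z2[of "fst q"] q by metis
    qed
    moreover have "z \<in> extensional quads" by (simp add: z_def extensional_def)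
    ultimately have "z \<in> shape_space" by (auto simp: shape_space_def PiE_def)
    moreover have "shape_coords pref z = w" by (simp add: shape_coords_def vec_eq_iff z0)
    ultimately show "w \<in> shape_coords pref ` shape_space" by blast
  qed
qed

definition log_curvature ::
  "'t::finite face_pairing \<Rightarrow> ('t quad \<Rightarrow> complex) \<Rightarrow> 't simplex_class \<Rightarrow> complex" where
  "log_curvature \<Phi> z e = (\<Sum>q\<in>quads. of_nat (quad_edge_index q e) * Ln (z q))"


section \<open>Vertex links\<close>

text \<open>
  \<open>(\<sigma>, a)\<close> is the normal triangle of \<open>\<sigma>\<close> cutting off the vertex \<open>a\<close>. Its corner on the edge
  \<open>{a, b}\<close> of \<open>\<sigma>\<close> is \<open>(\<sigma>, a, b)\<close>; its side in the face opposite to \<open>i\<close> is \<open>(\<sigma>, a, i)\<close>, which is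
  the side opposite to the corner \<open>(\<sigma>, a, i)\<close>.
\<close>

definition link_triangles :: "'t simplex_class \<Rightarrow> ('t \<times> 4) set" where
  "link_triangles v = {(\<sigma>, a). (\<sigma>, {a}) \<in> v}"

definition across :: "'t face_pairing \<Rightarrow> 't \<times> 4 \<times> 4 \<Rightarrow> 't \<times> 4 \<times> 4" where
  "across \<Phi> = (\<lambda>(\<sigma>, a, i). case \<Phi> \<sigma> i of (\<tau>, \<pi>) \<Rightarrow> (\<tau>, \<pi> a, \<pi> i))"

definition corner_glue :: "'t face_pairing \<Rightarrow> (('t \<times> 4 \<times> 4) \<times> ('t \<times> 4 \<times> 4)) set" where
  "corner_glue \<Phi> = {((\<sigma>, a, b), (\<tau>, \<pi> a, \<pi> b)) | \<sigma> a b i \<tau> \<pi>. i \<notin> {a, b} \<and> \<Phi> \<sigma> i = (\<tau>, \<pi>)}"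

definition link_flags :: "'t simplex_class \<Rightarrow> ('t \<times> 4 \<times> 4) set" where
  "link_flags v = {(\<sigma>, a, b). (\<sigma>, a) \<in> link_triangles v \<and> b \<noteq> a}"

definition link_euler_char :: "'t::finite face_pairing \<Rightarrow> 't simplex_class \<Rightarrow> int" where
  "link_euler_char \<Phi> v =
     int (card (link_flags v // (corner_glue \<Phi>)\<^sup>*))
     - int (card {{s, across \<Phi> s} | s. s \<in> link_flags v})
     + int (card (link_triangles v))"


section \<open>Normal curves and log holonomy\<close>

text \<open>
  \<open>Seg \<sigma> a i j\<close> is an oriented normal arc in the triangle \<open>(\<sigma>, a)\<close> from the side \<open>(\<sigma>, a, i)\<close> to the
  side \<open>(\<sigma>, a, j)\<close>. A closed normal curve is recorded, up to normal isotopy, by the cyclic sequence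
  of its segments.
\<close>

datatype 't segment = Seg (seg_tet: 't) (seg_vertex: 4) (seg_in: 4) (seg_out: 4)

type_synonym 't curve = "'t segment list"

definition closed_normal_curve ::
  "'t face_pairing \<Rightarrow> 't simplex_class \<Rightarrow> 't curve \<Rightarrow> bool" where
  "closed_normal_curve \<Phi> v \<alpha> \<longleftrightarrow> \<alpha> \<noteq> [] \<and>
     (\<forall>s\<in>set \<alpha>. (seg_tet s, seg_vertex s) \<in> link_triangles v \<and>
        distinct [seg_vertex s, seg_in s, seg_out s]) \<and>
     (\<forall>k<length \<alpha>. let s = \<alpha> ! k; s' = \<alpha> ! (Suc k mod length \<alpha>) in
        across \<Phi> (seg_tet s, seg_vertex s, seg_out s) = (seg_tet s', seg_vertex s', seg_in s'))"

definition tuple4 :: "'a \<Rightarrow> 'a \<Rightarrow> 'a \<Rightarrow> 'a \<Rightarrow> 4 \<Rightarrow> 'a" where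
  "tuple4 a b c d = (\<lambda>r. if r = 0 then a else if r = 1 then b else if r = 2 then c else d)"

text \<open>
  The sides \<open>i\<close> and \<open>j\<close> of \<open>(\<sigma>, a)\<close> meet at the corner labelled by the remaining label, which is the
  corner isolated by the segment. It lies to the right of the segment iff the corners
  \<open>i\<close>, \<open>j\<close> and this one are in counterclockwise order seen from \<open>a\<close>.
\<close>

definition isolated :: "'t segment \<Rightarrow> 4" where
  "isolated s = (THE x. x \<notin> {seg_vertex s, seg_in s, seg_out s})"

definition seg_quad :: "'t segment \<Rightarrow> 't quad" where
  "seg_quad s = (seg_tet s, let X = {seg_vertex s, isolated s} in {X, - X})"

definition seg_sign :: "'t segment \<Rightarrow> int" where
  "seg_sign s = sign (tuple4 (seg_vertex s) (seg_in s) (seg_out s) (isolated s))"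

definition quad_curve_index :: "'t quad \<Rightarrow> 't curve \<Rightarrow> int" where
  "quad_curve_index q \<alpha> = (\<Sum>s\<leftarrow>\<alpha>. if q = seg_quad s then seg_sign s else 0)"

definition log_holonomy :: "'t::finite curve \<Rightarrow> ('t quad \<Rightarrow> complex) \<Rightarrow> complex" where
  "log_holonomy \<alpha> z = (\<Sum>q\<in>quads. of_int (quad_curve_index q \<alpha>) * Ln (z q))"


section \<open>Algebraic intersection numbers\<close>

text \<open>
  A realization of a closed normal curve by straight segments: \<open>x k\<close> is the starting point of the
  \<open>k\<close>-th segment, a point in the interior of a side, in barycentric coordinates with respect to the
  corners of the triangle containing that segment (the coordinate of the label cut off by the
  triangle is 0).
\<close>

definition realization :: "'t curve \<Rightarrow> (nat \<Rightarrow> real ^ 4) \<Rightarrow> bool" where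
  "realization \<alpha> x \<longleftrightarrow> (\<forall>k<length \<alpha>.
     (\<Sum>b\<in>UNIV. x k $ b) = 1 \<and>
     (\<forall>b. if b \<in> {seg_vertex (\<alpha> ! k), seg_in (\<alpha> ! k)} then x k $ b = 0 else x k $ b > 0))"

definition endpoint ::
  "'t face_pairing \<Rightarrow> 't curve \<Rightarrow> (nat \<Rightarrow> real ^ 4) \<Rightarrow> nat \<Rightarrow> real ^ 4" where
  "endpoint \<Phi> \<alpha> x k =
     (\<chi> b. x (Suc k mod length \<alpha>) $ (snd (\<Phi> (seg_tet (\<alpha> ! k)) (seg_out (\<alpha> ! k))) b))"

definition same_triangle :: "'t segment \<Rightarrow> 't segment \<Rightarrow> bool" where
  "same_triangle s s' \<longleftrightarrow> seg_tet s = seg_tet s' \<and> seg_vertex s = seg_vertex s'"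

text \<open>
  Positive iff \<open>x, y, z\<close> are in counterclockwise order in a triangle \<open>(\<sigma>, a)\<close>, seen from \<open>a\<close>.
\<close>

definition orient :: "4 \<Rightarrow> real ^ 4 \<Rightarrow> real ^ 4 \<Rightarrow> real ^ 4 \<Rightarrow> real" where
  "orient a x y z = det (\<chi> r. tuple4 (axis a 1) x y z r)"

text \<open>
  The sign of the intersection of the segments from \<open>x\<close> to \<open>y\<close> and from \<open>x'\<close> to \<open>y'\<close>: it is 1 if
  the second one crosses the first one from right to left, that is, if the two directions form a
  positive basis, and 0 if the segments are disjoint. (Endpoints are boundary points of the
  triangle, so the segments meet iff \<open>x'\<close> and \<open>y'\<close> are on different sides of the first one.)
\<close>

definition crossing_sign ::
  "4 \<Rightarrow> real ^ 4 \<Rightarrow> real ^ 4 \<Rightarrow> real ^ 4 \<Rightarrow> real ^ 4 \<Rightarrow> int" where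
  "crossing_sign a x y x' y' =
     (if orient a x y x' < 0 \<and> orient a x y y' > 0 then 1
      else if orient a x y x' > 0 \<and> orient a x y y' < 0 then -1
      else 0)"

definition general_position ::
  "'t face_pairing \<Rightarrow> 't curve \<Rightarrow> (nat \<Rightarrow> real ^ 4) \<Rightarrow> 't curve \<Rightarrow> (nat \<Rightarrow> real ^ 4) \<Rightarrow> bool" where
  "general_position \<Phi> \<alpha> x \<beta> y \<longleftrightarrow>
     (\<forall>k<length \<alpha>. \<forall>l<length \<beta>. same_triangle (\<alpha> ! k) (\<beta> ! l) \<longrightarrow>
        {x k, endpoint \<Phi> \<alpha> x k} \<inter> {y l, endpoint \<Phi> \<beta> y l} = {})"

definition crossing_count ::
  "'t face_pairing \<Rightarrow> 't curve \<Rightarrow> (nat \<Rightarrow> real ^ 4) \<Rightarrow> 't curve \<Rightarrow> (nat \<Rightarrow> real ^ 4) \<Rightarrow> int" where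
  "crossing_count \<Phi> \<alpha> x \<beta> y =
     (\<Sum>k<length \<alpha>. \<Sum>l<length \<beta>.
        if same_triangle (\<alpha> ! k) (\<beta> ! l)
        then crossing_sign (seg_vertex (\<alpha> ! k))
               (x k) (endpoint \<Phi> \<alpha> x k) (y l) (endpoint \<Phi> \<beta> y l)
        else 0)"

text \<open>
  The algebraic intersection number: the signed count of intersection points of transverse
  representatives, which does not depend on the representatives.
\<close>

definition has_intersection_number ::
  "'t face_pairing \<Rightarrow> 't curve \<Rightarrow> 't curve \<Rightarrow> int \<Rightarrow> bool" where
  "has_intersection_number \<Phi> \<alpha> \<beta> n \<longleftrightarrow>
     (\<exists>x y. realization \<alpha> x \<and> realization \<beta> y \<and> general_position \<Phi> \<alpha> x \<beta> y \<and>
            crossing_count \<Phi> \<alpha> x \<beta> y = n)"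


section \<open>The fundamental group of a vertex link\<close>

text \<open>
  Based loops are represented by paths in the dual graph of the link: the step \<open>(\<sigma>, a, i)\<close> leaves
  the triangle \<open>(\<sigma>, a)\<close> through its side \<open>(\<sigma>, a, i)\<close>. The dual graph is the 1-skeleton of the dual
  cell structure of the link, whose 2-cells correspond to the vertices of the link. Hence homotopy of
  such paths relative to their ends is generated by the insertion and deletion of backtracks and of
  loops (once or several times) around a vertex of the link.
\<close>

type_synonym 't step = "'t \<times> 4 \<times> 4"

fun link_path :: "'t face_pairing \<Rightarrow> 't \<times> 4 \<Rightarrow> 't step list \<Rightarrow> 't \<times> 4 \<Rightarrow> bool" where
  "link_path \<Phi> t [] t' \<longleftrightarrow> t = t'"
| "link_path \<Phi> t ((\<sigma>, a, i) # p) t' \<longleftrightarrow> t = (\<sigma>, a) \<and> i \<noteq> a \<and>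
     (case across \<Phi> (\<sigma>, a, i) of (\<tau>, b, j) \<Rightarrow> link_path \<Phi> (\<tau>, b) p t')"

definition reverse_path :: "'t face_pairing \<Rightarrow> 't step list \<Rightarrow> 't step list" where
  "reverse_path \<Phi> p = rev (map (across \<Phi>) p)"

text \<open>
  \<open>(\<sigma>, a, b, c, d)\<close>, with \<open>a, b, c, d\<close> distinct, is the corner \<open>(\<sigma>, a, b)\<close> together with an ordering
  of the two sides \<open>c, d\<close> at this corner; \<open>turn\<close> crosses the side \<open>c\<close>, keeping the corner.
\<close>

definition turn :: "'t face_pairing \<Rightarrow> 't \<times> 4 \<times> 4 \<times> 4 \<times> 4 \<Rightarrow> 't \<times> 4 \<times> 4 \<times> 4 \<times> 4" where
  "turn \<Phi> = (\<lambda>(\<sigma>, a, b, c, d). case \<Phi> \<sigma> c of (\<tau>, \<pi>) \<Rightarrow> (\<tau>, \<pi> a, \<pi> b, \<pi> d, \<pi> c))"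

definition vertex_loop :: "'t face_pairing \<Rightarrow> 't step list \<Rightarrow> bool" where
  "vertex_loop \<Phi> p \<longleftrightarrow>
     (\<exists>\<sigma> a b c d n. distinct [a, b, c, d] \<and> (turn \<Phi> ^^ n) (\<sigma>, a, b, c, d) = (\<sigma>, a, b, c, d) \<and>
        p = map (\<lambda>k. case (turn \<Phi> ^^ k) (\<sigma>, a, b, c, d) of (\<tau>, a', b', c', d') \<Rightarrow> (\<tau>, a', c'))
              [0..<n])"

definition elementary_homotopy ::
  "'t face_pairing \<Rightarrow> 't \<times> 4 \<Rightarrow> 't \<times> 4 \<Rightarrow> 't step list \<Rightarrow> 't step list \<Rightarrow> bool" where
  "elementary_homotopy \<Phi> t t' p p' \<longleftrightarrow>
     link_path \<Phi> t p t' \<and> link_path \<Phi> t p' t' \<and>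
     (\<exists>u c w. ((\<exists>s. c = [s, across \<Phi> s]) \<or> vertex_loop \<Phi> c) \<and> p = u @ c @ w \<and> p' = u @ w)"

definition homotopic_paths ::
  "'t face_pairing \<Rightarrow> 't \<times> 4 \<Rightarrow> 't \<times> 4 \<Rightarrow> 't step list \<Rightarrow> 't step list \<Rightarrow> bool" where
  "homotopic_paths \<Phi> t t' = equivclp (elementary_homotopy \<Phi> t t')"

definition curve_path :: "'t curve \<Rightarrow> 't step list" where
  "curve_path \<alpha> = map (\<lambda>s. (seg_tet s, seg_vertex s, seg_out s)) \<alpha>"

text \<open>
  Free closed curves generate the fundamental group if they do so after being joined to a base point
  by suitable paths.
\<close>

definition generates_fundamental_group ::
  "'t face_pairing \<Rightarrow> 't simplex_class \<Rightarrow> 't curve set \<Rightarrow> bool" where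
  "generates_fundamental_group \<Phi> v S \<longleftrightarrow>
     (\<exists>t\<in>link_triangles v. \<exists>\<theta>.
        (\<forall>\<alpha>\<in>S. link_path \<Phi> t (\<theta> \<alpha>) (seg_tet (hd \<alpha>), seg_vertex (hd \<alpha>))) \<and>
        (let L = (\<lambda>\<alpha>. \<theta> \<alpha> @ curve_path \<alpha> @ reverse_path \<Phi> (\<theta> \<alpha>)) ` S in
         \<forall>p. link_path \<Phi> t p t \<longrightarrow>
           (\<exists>ps. set ps \<subseteq> L \<union> reverse_path \<Phi> ` L \<and> homotopic_paths \<Phi> t t p (concat ps))))"


section \<open>Canonical generating sets\<close>

text \<open>
  The first conjunct says that the genus of the link, a closed connected orientable surface, is \<open>g\<close>.
\<close>

definition canonical_generators ::
  "'t::finite face_pairing \<Rightarrow> 't simplex_class \<Rightarrow> nat \<Rightarrow> (nat \<Rightarrow> 't curve) \<Rightarrow> (nat \<Rightarrow> 't curve) \<Rightarrow> bool"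
  where
  "canonical_generators \<Phi> v g lon mer \<longleftrightarrow>
     link_euler_char \<Phi> v = 2 - 2 * int g \<and>
     (\<forall>j<g. closed_normal_curve \<Phi> v (lon j) \<and> closed_normal_curve \<Phi> v (mer j)) \<and>
     (\<forall>j<g. \<forall>k<g.
        has_intersection_number \<Phi> (lon j) (mer k) (if j = k then 1 else 0) \<and>
        has_intersection_number \<Phi> (lon j) (lon k) 0 \<and>
        has_intersection_number \<Phi> (mer j) (mer k) 0) \<and>
     generates_fundamental_group \<Phi> v (lon ` {..<g} \<union> mer ` {..<g})"

definition longitudes ::
  "'t face_pairing \<Rightarrow> ('t simplex_class \<Rightarrow> nat) \<Rightarrow> ('t simplex_class \<Rightarrow> nat \<Rightarrow> 't curve) \<Rightarrow> 't curve set"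
  where
  "longitudes \<Phi> g lon = (\<Union>v\<in>vertices \<Phi>. lon v ` {..<g v})"


section \<open>Derivatives of maps into a finite product\<close>

text \<open>
  \<open>D\<close> is the derivative at \<open>x\<close> of \<open>f\<close>, regarded as a map into the product of copies of \<open>'b\<close> indexed by
  the finite set \<open>I\<close>; elements of this product are functions that are \<open>undefined\<close> outside \<open>I\<close>.
\<close>

definition has_product_derivative ::
  "('a::real_normed_vector \<Rightarrow> 'i \<Rightarrow> 'b::real_normed_vector) \<Rightarrow> ('a \<Rightarrow> 'i \<Rightarrow> 'b) \<Rightarrow> 'i set \<Rightarrow> 'a \<Rightarrow> bool"
  where
  "has_product_derivative f D I x \<longleftrightarrow>
     (\<forall>w. D w \<in> extensional I) \<and> (\<forall>i\<in>I. ((\<lambda>y. f y i) has_derivative (\<lambda>w. D w i)) (at x))"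

lemma has_product_derivative_unique:
  assumes "has_product_derivative f D I x" and "has_product_derivative f D' I x"
  shows "D = D'"
proof
  fix w
  have "D w i = D' w i" if "i \<in> I" for i
  proof -
    have "(\<lambda>w. D w i) = (\<lambda>w. D' w i)"
      using assms that unfolding has_product_derivative_def by (intro has_derivative_unique) auto
    then show ?thesis by (rule fun_cong)
  qed
  then show "D w = D' w"
    using assms by (intro extensionalityI[of "D w" I "D' w"]) (simp_all add: has_product_derivative_def)
qed

end

theory Submission
  imports Defs "HOL-Combinatorics.Cycles"
begin

text \<open>
  A tangent vector \<open>h\<close> at \<open>z\<close> gives \<open>\<zeta> = d log z (h)\<close> on the quadrilateral types, with
  \<open>\<zeta> q + \<zeta> q' + \<zeta> q'' = 0\<close> in each tetrahedron. For the symplectic form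
  \<open>\<omega> (\<zeta>, \<xi>) = \<Sum>\<sigma>. \<zeta> q * \<xi> q' - \<zeta> q' * \<xi> q\<close>, the number \<open>\<omega> (\<zeta>, cnj \<zeta>)\<close> is
  \<open>- 2 * \<i>\<close> times a positive definite quadratic form in \<open>h\<close>, because all \<open>Im z\<close> are positive. So it
  suffices that \<open>\<omega>\<close> vanishes on the kernel, which is closed under conjugation.

  An element of the kernel is a closed form on the link of each vertex: it assigns numbers to the
  corners of the triangles, with sum zero in each triangle and around each vertex of the link.
  The sum over the links of the cup products of two such forms is a multiple of \<open>\<omega> (\<zeta>, \<xi>)\<close>: the
  triangles contribute \<open>\<omega>\<close>, and the contributions of the vertices of the links cancel, since each edge
  of the triangulation has two ends, seen from which its tetrahedra are in opposite cyclic orders.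
  Finally, the cup product vanishes on each link: as the meridians are dual to the longitudes and the
  periods of \<open>\<zeta>\<close> over the longitudes are zero, \<open>\<zeta>\<close> is cohomologous to a combination of the Poincare
  duals of the longitudes, and the cup product with these is the period of \<open>\<xi>\<close> over the longitudes.
\<close>

section \<open>Labels\<close>

text \<open>A closed form on the corners of a link has two kinds of local primitives. Its values sum
  to zero in each triangle, so it has a primitive on the three sides of every triangle
  (\<open>tri_potential\<close>). They also sum to zero around each vertex of the link, so it has a
  primitive on the sides at every vertex (\<open>side_potential\<close>). Comparing the first
  primitive across a side gives a cochain on the dual edges (\<open>jump\<close>); comparing the
  second between the two ends of a side gives a simplicial cochain (\<open>side_form\<close>).
  Pairing the dual cochain of one form with the simplicial cochain of the other makes the cup
  product a plain sum over sides, without any ordering of the vertices of the link, and both Stokes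
  and Poincare duality become regroupings of finite sums. The freedom in the primitives has to be
  used with care: those at the vertices are chosen opposite at the two ends of every edge, so that
  their contributions cancel already inside each tetrahedron. They are defined by averages over
  \<open>period\<close> turns, which requires no base point and no knowledge of how an orbit of
  \<open>turn\<close> covers an edge class.\<close>

abbreviation label_sign :: "4 \<Rightarrow> 4 \<Rightarrow> 4 \<Rightarrow> 4 \<Rightarrow> int" where
  "label_sign a b c d \<equiv> sign (tuple4 a b c d)"

lemma UNIV_labels: "(UNIV :: 4 set) = {0, 1, 2, 3}"
proof -
  have "x \<in> {0,1,2,3}" for x :: 4 using exhaust_4[of x] by auto
  then show ?thesis by blast
qed

lemma label_cases: "x = 0 \<or> x = 1 \<or> x = 2 \<or> x = 3" for x :: 4
proof -
  have "x \<in> {0, 1, 2, 3}" by (simp flip: UNIV_labels)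
  then show ?thesis by simp
qed

lemma distinct_labels_UNIV:
  fixes a b c d :: 4
  assumes "distinct [a, b, c, d]"
  shows "UNIV = {a, b, c, d}"
proof -
  have "card {a, b, c, d} = card (UNIV :: 4 set)" using assms by (simp add: card_insert_if)
  then show ?thesis by (metis card_subset_eq finite subset_UNIV)
qed

lemma label_exhaust:
  fixes a b c d x :: 4
  assumes "distinct [a, b, c, d]"
  obtains "x = a" | "x = b" | "x = c" | "x = d"
  using distinct_labels_UNIV[OF assms] by blast

lemma sum_labels:
  fixes a b c d :: 4
  assumes "distinct [a, b, c, d]"
  shows "sum f UNIV = f a + f b + f c + (f d :: 'a::comm_monoid_add)"
  unfolding distinct_labels_UNIV[OF assms] using assms by (simp add: add.assoc)

lemma tuple4_simps [simp]:
  "tuple4 a b c d 0 = a" "tuple4 a b c d 1 = b" "tuple4 a b c d 2 = c" "tuple4 a b c d 3 = d"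
  by (simp_all add: tuple4_def)

lemma all_labels: "(\<forall>r::4. P r) \<longleftrightarrow> P 0 \<and> P 1 \<and> P 2 \<and> P 3"
proof -
  have "(\<forall>r::4. P r) \<longleftrightarrow> (\<forall>r\<in>{0,1,2,3}. P r)" by (simp flip: UNIV_labels)
  then show ?thesis by simp
qed

lemma comp_tuple4: "f \<circ> tuple4 a b c d = tuple4 (f a) (f b) (f c) (f d)"
  by (simp add: fun_eq_iff all_labels)

lemma bij_tuple4:
  assumes "distinct [a, b, c, d]"
  shows "bij (tuple4 a b c d :: 4 \<Rightarrow> 4)"
proof -
  have "{a, b, c, d} \<subseteq> range (tuple4 a b c d)"
    by (metis empty_subsetI insert_subset rangeI tuple4_simps)
  then have "surj (tuple4 a b c d)"
    using distinct_labels_UNIV[OF assms] by auto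
  then show ?thesis by (simp add: bij_def finite_UNIV_surj_inj)
qed

lemma permutation_bij: "bij (f :: 4 \<Rightarrow> 4) \<Longrightarrow> permutation f"
  by (simp add: permutation)

lemma label_sign_image:
  assumes "bij \<pi>" "distinct [a, b, c, d]"
  shows "label_sign (\<pi> a) (\<pi> b) (\<pi> c) (\<pi> d) = sign \<pi> * label_sign a b c d"
  using sign_compose[of \<pi> "tuple4 a b c d"] assms
  by (simp add: comp_tuple4 permutation_bij bij_tuple4)

lemma label_sign_transpose:
  assumes "distinct [a, b, c, d]"
  shows "label_sign b a c d = - label_sign a b c d"
    and "label_sign a c b d = - label_sign a b c d"
    and "label_sign a b d c = - label_sign a b c d"
proof -
  have *: "sign (tuple4 a b c d \<circ> Transposition.transpose r s) = - label_sign a b c d" if "r \<noteq> s" for r s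
    using assms that
    by (subst sign_compose) (simp_all add: permutation_bij bij_tuple4 permutation_swap_id sign_swap_id)
  have "tuple4 b a c d = tuple4 a b c d \<circ> Transposition.transpose 0 1"
    "tuple4 a c b d = tuple4 a b c d \<circ> Transposition.transpose 1 2"
    "tuple4 a b d c = tuple4 a b c d \<circ> Transposition.transpose 2 3"
    by (simp_all add: fun_eq_iff all_labels Transposition.transpose_def)
  then show "label_sign b a c d = - label_sign a b c d"
    "label_sign a c b d = - label_sign a b c d"
    "label_sign a b d c = - label_sign a b c d"
    using * by simp_all
qed

lemma label_sign_square [simp]: "label_sign a b c d * label_sign a b c d = 1"
  by (simp add: sign_def)

lemma label_sign_cases: "label_sign a b c d = 1 \<or> label_sign a b c d = - 1"
  by (simp add: sign_def)

lemma label_sign_0123: "label_sign 0 1 2 3 = 1"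
proof -
  have "tuple4 0 1 2 3 = (id :: 4 \<Rightarrow> 4)" by (simp add: fun_eq_iff all_labels)
  then show ?thesis by simp
qed

lemma obtain_labels2:
  fixes a b :: 4
  assumes "a \<noteq> b"
  obtains c d where "distinct [a, b, c, d]"
proof -
  have "card (UNIV - {a, b}) = 2" using assms by (simp add: card_Diff_subset)
  then obtain c d where "UNIV - {a, b} = {c, d}" "c \<noteq> d" by (auto simp: card_2_iff)
  then have "distinct [a, b, c, d]" using assms by auto
  then show ?thesis by (rule that)
qed

lemma obtain_label3:
  fixes a b c :: 4
  assumes "distinct [a, b, c]"
  obtains d where "distinct [a, b, c, d]"
proof -
  have "card (UNIV - {a, b, c}) = 1" using assms by (simp add: card_Diff_subset)
  then obtain d where "UNIV - {a, b, c} = {d}" by (auto simp: card_1_singleton_iff)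
  then have "distinct [a, b, c, d]" using assms by auto
  then show ?thesis by (rule that)
qed

lemma complement_pair:
  fixes a b c d :: 4
  assumes "distinct [a, b, c, d]"
  shows "- {a, b} = {c, d}"
proof -
  have "x \<in> - {a, b} \<longleftrightarrow> x \<in> {c, d}" for x
    by (rule label_exhaust[OF assms, of x]) (use assms in auto)
  then show ?thesis by blast
qed

lemma remaining_pairs:
  fixes a b c d :: 4
  assumes "distinct [a, b, c, d]"
  shows "{(x, y). distinct [a, x, y, d]} = {(b, c), (c, b)}"
    and "{(x, y). distinct [a, d, x, y]} = {(b, c), (c, b)}"
proof -
  have "distinct [a, x, y, d] \<longleftrightarrow> x = b \<and> y = c \<or> x = c \<and> y = b"
    "distinct [a, d, x, y] \<longleftrightarrow> x = b \<and> y = c \<or> x = c \<and> y = b" for x y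
    by (rule label_exhaust[OF assms, of x]; rule label_exhaust[OF assms, of y]; use assms in auto)+
  then show "{(x, y). distinct [a, x, y, d]} = {(b, c), (c, b)}"
    "{(x, y). distinct [a, d, x, y]} = {(b, c), (c, b)}"
    by auto
qed

lemma label_sign_rotate:
  assumes "distinct [a, b, c, d]"
  shows "label_sign a c d b = label_sign a b c d" "label_sign a d b c = label_sign a b c d"
  using label_sign_transpose(2)[of a c b d] label_sign_transpose(3)[of a c b d]
    label_sign_transpose(3)[of a b d c] label_sign_transpose(2)[of a b d c] assms
  by (auto simp: label_sign_transpose(2)[OF assms])

lemma of_int_label_sign_square: "(of_int (label_sign a b c d) :: complex) * of_int (label_sign a b c d) = 1"
  by (simp flip: of_int_mult)

lemma sum_complement_label:
  fixes a b c d :: 4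
  assumes "distinct [a, b, c, d]"
  shows "(\<Sum>i\<in>- {a}. h i) = h b + h c + (h d :: 'b::comm_monoid_add)"
proof -
  have "x \<in> - {a} \<longleftrightarrow> x \<in> {b, c, d}" for x
    by (rule label_exhaust[OF assms, of x]) (use assms in auto)
  then have "- {a} = {b, c, d}" by blast
  then show ?thesis using assms by (simp add: add.assoc)
qed

lemma obtain_labels3:
  obtains b c d :: 4 where "distinct [a, b, c, d]"
proof -
  obtain b where "a \<noteq> (b :: 4)" by (metis zero_neq_one)
  then show ?thesis using that obtain_labels2 by metis
qed

section \<open>Sums along the orbits of a periodic map\<close>

lemma sum_funpow_shift:
  fixes g :: "'a \<Rightarrow> 'b::ab_group_add"
  assumes "(f ^^ n) x = x"
  shows "(\<Sum>k<n. g ((f ^^ Suc k) x)) = (\<Sum>k<n. g ((f ^^ k) x))"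
proof -
  have "(\<Sum>k<n. h k) + h n = h 0 + (\<Sum>k<n. h (Suc k))" for h :: "nat \<Rightarrow> 'b"
    using sum.lessThan_Suc_shift[of h n] by simp
  from this[of "\<lambda>k. g ((f ^^ k) x)"] show ?thesis using assms by (simp add: add.commute)
qed

text \<open>This compares an arbitrary return time with the common \<open>period\<close> of all
  frames.\<close>

lemma sum_funpow_multiple:
  fixes g :: "'a \<Rightarrow> 'b::comm_semiring_1"
  assumes "(f ^^ n) x = x"
  shows "(\<Sum>k<m * n. g ((f ^^ k) x)) = of_nat m * (\<Sum>k<n. g ((f ^^ k) x))"
proof (induction m)
  case (Suc m)
  have split: "(\<Sum>k<M + n. h k) = (\<Sum>k<M. h k) + (\<Sum>k<n. h (k + M))" for M and h :: "nat \<Rightarrow> 'b"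
    by (induction n) (simp_all add: ac_simps)
  have it: "(f ^^ (m * n)) x = x"
    by (induction m) (simp_all add: funpow_add assms)
  have "(\<Sum>k<Suc m * n. g ((f ^^ k) x)) = (\<Sum>k<m * n + n. g ((f ^^ k) x))"
    by (simp add: add.commute)
  also have "\<dots> = (\<Sum>k<m * n. g ((f ^^ k) x)) + (\<Sum>k<n. g ((f ^^ (k + m * n)) x))"
    by (rule split)
  also have "\<dots> = (\<Sum>k<m * n. g ((f ^^ k) x)) + (\<Sum>k<n. g ((f ^^ k) x))"
    by (simp add: funpow_add it)
  also have "\<dots> = of_nat (Suc m) * (\<Sum>k<n. g ((f ^^ k) x))"
    by (simp add: Suc.IH algebra_simps)
  finally show ?case .
qed simp

section \<open>Gluing\<close>

locale triangulation =
  fixes \<Phi> :: "'t::finite face_pairing"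
  assumes oriented: "oriented_triangulation \<Phi>"
begin

lemma pairing:
  assumes "\<Phi> \<sigma> i = (\<tau>, \<pi>)"
  shows "bij \<pi>" "sign \<pi> = - 1" "\<Phi> \<tau> (\<pi> i) = (\<sigma>, inv \<pi>)"
  using assms oriented unfolding oriented_triangulation_def by blast+

lemma pairing_eq_iff: "\<Phi> \<sigma> i = (\<tau>, \<pi>) \<Longrightarrow> \<pi> a = \<pi> b \<longleftrightarrow> a = b"
  using pairing(1) by (metis bij_def injD)

lemma pairing_inv: "\<Phi> \<sigma> i = (\<tau>, \<pi>) \<Longrightarrow> inv \<pi> (\<pi> a) = a"
  using pairing(1) by (simp add: bij_is_inj)

lemma pairing_label_sign:
  assumes "\<Phi> \<sigma> i = (\<tau>, \<pi>)" "distinct [a, b, c, d]"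
  shows "label_sign (\<pi> a) (\<pi> b) (\<pi> c) (\<pi> d) = - label_sign a b c d"
  using label_sign_image[OF pairing(1)[OF assms(1)] assms(2)] pairing(2)[OF assms(1)] by simp

lemma across_eq: "\<Phi> \<sigma> i = (\<tau>, \<pi>) \<Longrightarrow> across \<Phi> (\<sigma>, a, i) = (\<tau>, \<pi> a, \<pi> i)"
  by (simp add: across_def)

lemma across_across [simp]: "across \<Phi> (across \<Phi> s) = s"
proof -
  obtain \<sigma> a i where s: "s = (\<sigma>, a, i)" by (cases s)
  obtain \<tau> \<pi> where p: "\<Phi> \<sigma> i = (\<tau>, \<pi>)" by fastforce
  show ?thesis unfolding s across_eq[OF p] across_eq[OF pairing(3)[OF p]]
    by (simp add: pairing_inv[OF p])
qed

lemma inj_across: "inj (across \<Phi>)"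
  by (metis across_across injI)

end

section \<open>Frames: edges of tetrahedra with ordered ends and ordered adjacent faces\<close>

fun swap_ends :: "'t \<times> 4 \<times> 4 \<times> 4 \<times> 4 \<Rightarrow> 't \<times> 4 \<times> 4 \<times> 4 \<times> 4" where
  "swap_ends (\<sigma>, a, b, c, d) = (\<sigma>, b, a, c, d)"

fun swap_sides :: "'t \<times> 4 \<times> 4 \<times> 4 \<times> 4 \<Rightarrow> 't \<times> 4 \<times> 4 \<times> 4 \<times> 4" where
  "swap_sides (\<sigma>, a, b, c, d) = (\<sigma>, a, b, d, c)"

fun frame_sign :: "'t \<times> 4 \<times> 4 \<times> 4 \<times> 4 \<Rightarrow> int" where
  "frame_sign (\<sigma>, a, b, c, d) = label_sign a b c d"

fun frame_edge :: "'t \<times> 4 \<times> 4 \<times> 4 \<times> 4 \<Rightarrow> 't \<times> 4 set" where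
  "frame_edge (\<sigma>, a, b, c, d) = (\<sigma>, {a, b})"

fun first_side :: "'t \<times> 4 \<times> 4 \<times> 4 \<times> 4 \<Rightarrow> 't \<times> 4 \<times> 4" where
  "first_side (\<sigma>, a, b, c, d) = (\<sigma>, a, c)"

fun second_side :: "'t \<times> 4 \<times> 4 \<times> 4 \<times> 4 \<Rightarrow> 't \<times> 4 \<times> 4" where
  "second_side (\<sigma>, a, b, c, d) = (\<sigma>, a, d)"

text \<open>These are the states on which \<open>turn\<close> acts: the edge \<open>{a, b}\<close>,
  the end \<open>a\<close> from which it is seen, and the faces \<open>c\<close> and
  \<open>d\<close> that contain it, the next one to be crossed first. In the link this is a corner
  with an order of its two sides.\<close>

definition frames :: "('t \<times> 4 \<times> 4 \<times> 4 \<times> 4) set" where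
  "frames = {(\<sigma>, a, b, c, d). distinct [a, b, c, d]}"

lemma mem_frames [simp]: "(\<sigma>, a, b, c, d) \<in> frames \<longleftrightarrow> distinct [a, b, c, d]"
  by (simp add: frames_def)

lemma swap_in_frames [simp]:
  "swap_ends x \<in> frames \<longleftrightarrow> x \<in> frames" "swap_sides x \<in> frames \<longleftrightarrow> x \<in> frames"
  by (cases x; auto)+

lemma swap_swap [simp]: "swap_ends (swap_ends x) = x" "swap_sides (swap_sides x) = x"
  by (cases x; simp)+

lemma swap_ends_sides: "swap_ends (swap_sides x) = swap_sides (swap_ends x)"
  by (cases x) simp

lemma frame_edge_swap [simp]:
  "frame_edge (swap_ends x) = frame_edge x" "frame_edge (swap_sides x) = frame_edge x"
  by (cases x; auto)+

lemma frame_sign_swap [simp]: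
  assumes "x \<in> frames"
  shows "frame_sign (swap_ends x) = - frame_sign x" "frame_sign (swap_sides x) = - frame_sign x"
proof -
  obtain \<sigma> a b c d where x: "x = (\<sigma>, a, b, c, d)" by (cases x)
  have d: "distinct [a, b, c, d]" using assms x by simp
  show "frame_sign (swap_ends x) = - frame_sign x" "frame_sign (swap_sides x) = - frame_sign x"
    unfolding x swap_ends.simps swap_sides.simps frame_sign.simps
    by (rule label_sign_transpose[OF d])+
qed

lemma frame_edge_eqD:
  assumes "x \<in> frames" "y \<in> frames" "frame_edge x = frame_edge y"
  shows "y \<in> {x, swap_ends x, swap_sides x, swap_ends (swap_sides x)}"
proof -
  obtain \<sigma> a b c d where x: "x = (\<sigma>, a, b, c, d)" by (cases x)
  obtain \<tau> a' b' c' d' where y: "y = (\<tau>, a', b', c', d')" by (cases y)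
  have d: "distinct [a, b, c, d]" "distinct [a', b', c', d']" using assms x y by simp_all
  have e: "\<tau> = \<sigma>" "{a', b'} = {a, b}" using assms x y by auto
  then have "{c', d'} = {c, d}" using complement_pair[OF d(1)] complement_pair[OF d(2)] by metis
  then show ?thesis using e unfolding x y by (auto simp: doubleton_eq_iff)
qed

context triangulation
begin

lemma turn_eq: "\<Phi> \<sigma> c = (\<tau>, \<pi>) \<Longrightarrow> turn \<Phi> (\<sigma>, a, b, c, d) = (\<tau>, \<pi> a, \<pi> b, \<pi> d, \<pi> c)"
  by (simp add: turn_def)

lemma turn_in_frames: "x \<in> frames \<Longrightarrow> turn \<Phi> x \<in> frames"
proof -
  assume "x \<in> frames"
  obtain \<sigma> a b c d where x: "x = (\<sigma>, a, b, c, d)" by (cases x)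
  obtain \<tau> \<pi> where p: "\<Phi> \<sigma> c = (\<tau>, \<pi>)" by fastforce
  show ?thesis using \<open>x \<in> frames\<close> unfolding x turn_eq[OF p] by (auto simp: pairing_eq_iff[OF p])
qed

text \<open>Two sign changes cancel: the gluing permutation is odd, and \<open>turn\<close>
  exchanges the last two labels. The sense of rotation around the edge is thus preserved.\<close>

lemma frame_sign_turn: "x \<in> frames \<Longrightarrow> frame_sign (turn \<Phi> x) = frame_sign x"
proof -
  assume "x \<in> frames"
  obtain \<sigma> a b c d where x: "x = (\<sigma>, a, b, c, d)" by (cases x)
  obtain \<tau> \<pi> where p: "\<Phi> \<sigma> c = (\<tau>, \<pi>)" by fastforce
  have d: "distinct [a, b, c, d]" "distinct [a, b, d, c]" using \<open>x \<in> frames\<close> x by auto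
  then show ?thesis unfolding x turn_eq[OF p] frame_sign.simps
    using pairing_label_sign[OF p d(2)] label_sign_transpose(3)[OF d(1)] by simp
qed

lemma turn_swap_ends: "turn \<Phi> (swap_ends x) = swap_ends (turn \<Phi> x)"
  by (cases x) (simp add: turn_def split: prod.splits)

text \<open>\<open>turn\<close> lists the face just crossed last. After swapping the sides, the next
  turn crosses it back, so \<open>swap_sides\<close> conjugates \<open>turn\<close> to its
  inverse.\<close>

lemma turn_swap_sides_turn: "turn \<Phi> (swap_sides (turn \<Phi> x)) = swap_sides x"
proof -
  obtain \<sigma> a b c d where x: "x = (\<sigma>, a, b, c, d)" by (cases x)
  obtain \<tau> \<pi> where p: "\<Phi> \<sigma> c = (\<tau>, \<pi>)" by fastforce
  show ?thesis unfolding x turn_eq[OF p] swap_sides.simps turn_eq[OF pairing(3)[OF p]]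
    by (simp add: pairing_inv[OF p])
qed

text \<open>A turn leaves a link triangle through its first side and enters the next one through the
  second side.\<close>

lemma across_first_side: "across \<Phi> (first_side x) = second_side (turn \<Phi> x)"
  by (cases x) (simp add: across_def turn_def split: prod.splits)

lemma inj_turn: "inj (turn \<Phi>)"
  by (metis injI swap_swap(2) turn_swap_sides_turn)

lemma turn_periodic: "\<exists>n>0. turn \<Phi> ^^ n = id"
proof -
  have "bij (turn \<Phi>)" using inj_turn by (simp add: bij_def finite_UNIV_inj_surj)
  then have "permutation (turn \<Phi>)" by (simp add: permutation)
  then show ?thesis by (metis permutation_is_nilpotent)
qed

text \<open>One period for all frames at once, so that orbit sums of different frames have the same
  length.\<close>

definition period :: nat where
  "period = (SOME n. n > 0 \<and> turn \<Phi> ^^ n = id)"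

lemma period: "period > 0" "(turn \<Phi> ^^ period) x = x"
  using someI_ex[OF turn_periodic] by (simp_all add: period_def)

lemma funpow_turn_in_frames: "x \<in> frames \<Longrightarrow> (turn \<Phi> ^^ k) x \<in> frames"
  by (induction k) (simp_all add: turn_in_frames)

lemma frame_sign_funpow_turn: "x \<in> frames \<Longrightarrow> frame_sign ((turn \<Phi> ^^ k) x) = frame_sign x"
  by (induction k) (simp_all add: frame_sign_turn funpow_turn_in_frames)

lemma funpow_turn_swap_ends: "(turn \<Phi> ^^ k) (swap_ends x) = swap_ends ((turn \<Phi> ^^ k) x)"
  by (induction k) (simp_all add: turn_swap_ends)

lemma funpow_turn_swap_sides: "(turn \<Phi> ^^ k) (swap_sides ((turn \<Phi> ^^ k) x)) = swap_sides x"
proof (induction k arbitrary: x)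
  case (Suc k)
  have "(turn \<Phi> ^^ Suc k) (swap_sides ((turn \<Phi> ^^ Suc k) x))
      = turn \<Phi> ((turn \<Phi> ^^ k) (swap_sides ((turn \<Phi> ^^ k) (turn \<Phi> x))))"
    by (simp add: funpow_swap1)
  then show ?case by (simp add: Suc.IH turn_swap_sides_turn)
qed simp

lemma frame_edge_turn: "x \<in> frames \<Longrightarrow> (frame_edge x, frame_edge (turn \<Phi> x)) \<in> simplex_glue \<Phi>"
proof -
  assume "x \<in> frames"
  obtain \<sigma> a b c d where x: "x = (\<sigma>, a, b, c, d)" by (cases x)
  obtain \<tau> \<pi> where p: "\<Phi> \<sigma> c = (\<tau>, \<pi>)" by fastforce
  have "c \<notin> {a, b}" using \<open>x \<in> frames\<close> x by auto
  then have "((\<sigma>, {a, b}), (\<tau>, \<pi> ` {a, b})) \<in> simplex_glue \<Phi>"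
    using p unfolding simplex_glue_def by blast
  then show ?thesis unfolding x turn_eq[OF p] by simp
qed

text \<open>An edge is glued across a face that contains it; taking this face as the first one of a
  frame turns the gluing into a \<open>turn\<close>.\<close>

lemma simplex_glue_frame:
  assumes "(X, Y) \<in> simplex_glue \<Phi>" "x \<in> frames" "frame_edge x = X"
  obtains y where "y \<in> frames" "frame_edge y = X" "frame_edge (turn \<Phi> y) = Y"
proof -
  obtain \<sigma> a b c d where x: "x = (\<sigma>, a, b, c, d)" by (cases x)
  have X: "X = (\<sigma>, {a, b})" using assms x by simp
  from assms(1) X obtain i \<tau> \<pi> where i: "i \<notin> {a, b}" and p: "\<Phi> \<sigma> i = (\<tau>, \<pi>)" and Y: "Y = (\<tau>, \<pi> ` {a, b})"
    unfolding simplex_glue_def by auto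
  have "distinct [a, b, i]" using assms(2) i x by auto
  then obtain j where j: "distinct [a, b, i, j]" by (rule obtain_label3)
  show ?thesis
  proof (rule that[of "(\<sigma>, a, b, i, j)"])
    show "frame_edge (turn \<Phi> (\<sigma>, a, b, i, j)) = Y" using Y by (simp add: turn_eq[OF p])
  qed (use j X in simp_all)
qed

lemma card_simplex_glue: "(X, Y) \<in> (simplex_glue \<Phi>)\<^sup>* \<Longrightarrow> card (snd Y) = card (snd X)"
proof (induction rule: rtrancl_induct)
  case (step Y Z)
  then obtain \<sigma> V i \<tau> \<pi> where p: "\<Phi> \<sigma> i = (\<tau>, \<pi>)" and YZ: "Y = (\<sigma>, V)" "Z = (\<tau>, \<pi> ` V)"
    unfolding simplex_glue_def by blast
  have "inj_on \<pi> V" using pairing(1)[OF p] by (meson bij_is_inj inj_on_subset subset_UNIV)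
  then show ?case using step.IH YZ by (simp add: card_image)
qed simp

end

lemma card_frames_over_edge:
  assumes "card X = 2"
  shows "card {x \<in> frames. frame_edge x = (\<sigma>, X)} = 4"
proof -
  obtain a b where X: "X = {a, b}" "a \<noteq> b" using assms by (auto simp: card_2_iff)
  obtain c d where d: "distinct [a, b, c, d]" using obtain_labels2[OF X(2)] .
  define x where "x = (\<sigma>, a, b, c, d)"
  have x: "x \<in> frames" "frame_edge x = (\<sigma>, X)" using d X by (simp_all add: x_def)
  have "{y \<in> frames. frame_edge y = (\<sigma>, X)} = {x, swap_ends x, swap_sides x, swap_ends (swap_sides x)}"
  proof (intro equalityI subsetI)
    fix y assume "y \<in> {y \<in> frames. frame_edge y = (\<sigma>, X)}"
    then show "y \<in> {x, swap_ends x, swap_sides x, swap_ends (swap_sides x)}"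
      using frame_edge_eqD[OF x(1), of y] x(2) by simp
  next
    fix y assume "y \<in> {x, swap_ends x, swap_sides x, swap_ends (swap_sides x)}"
    then show "y \<in> {y \<in> frames. frame_edge y = (\<sigma>, X)}" using x by auto
  qed
  also have "card \<dots> = 4" using d by (simp add: x_def)
  finally show ?thesis .
qed

context triangulation
begin

text \<open>Swapping the sides traverses the orbit backwards, which does not change a sum over a
  full period.\<close>

lemma sum_period_swap_sides:
  fixes g :: "'t \<times> 4 set \<Rightarrow> complex"
  shows "(\<Sum>k<period. g (frame_edge ((turn \<Phi> ^^ k) (swap_sides x)))) =
    (\<Sum>k<period. g (frame_edge ((turn \<Phi> ^^ k) x)))"
proof -
  \<comment> \<open>The exponent is \<open>period - k\<close>, running over
    \<open>1..period\<close>. Written as a successor it fits the reversal of the summation index,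
    and one cyclic shift remains.\<close>
  have "(turn \<Phi> ^^ k) (swap_sides x) = swap_sides ((turn \<Phi> ^^ Suc (period - Suc k)) x)" if "k < period" for k
  proof -
    have "(turn \<Phi> ^^ k) ((turn \<Phi> ^^ Suc (period - Suc k)) x) = (turn \<Phi> ^^ (k + Suc (period - Suc k))) x"
      by (simp only: funpow_add comp_apply)
    also have "\<dots> = x" using that period by simp
    finally show ?thesis using funpow_turn_swap_sides by metis
  qed
  then have "(\<Sum>k<period. g (frame_edge ((turn \<Phi> ^^ k) (swap_sides x)))) =
      (\<Sum>k<period. g (frame_edge ((turn \<Phi> ^^ Suc (period - Suc k)) x)))"
    by (intro sum.cong) simp_all
  also have "\<dots> = (\<Sum>k<period. g (frame_edge ((turn \<Phi> ^^ Suc k) x)))"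
    by (rule sum.nat_diff_reindex)
  also have "\<dots> = (\<Sum>k<period. g (frame_edge ((turn \<Phi> ^^ k) x)))"
    using sum_funpow_shift[OF period(2), of "\<lambda>y. g (frame_edge y)"] .
  finally show ?thesis .
qed

text \<open>The turns around a corner run over the simplices of an edge class, with constant multiplicity.\<close>

lemma sum_turn_eq_0:
  fixes g :: "'t \<times> 4 set \<Rightarrow> complex"
  assumes g: "\<And>e. e \<in> edges \<Phi> \<Longrightarrow> (\<Sum>X\<in>e. g X) = 0"
    and x: "x \<in> frames" and n: "(turn \<Phi> ^^ n) x = x"
  shows "(\<Sum>k<n. g (frame_edge ((turn \<Phi> ^^ k) x))) = 0"
proof -
  \<comment> \<open>\<open>S\<close> is invariant under both swaps and under \<open>turn\<close>,
    hence constant on all frames over one edge class.\<close>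
  define S where "S y = (\<Sum>k<period. g (frame_edge ((turn \<Phi> ^^ k) y)))" for y
  have S_swap: "S (swap_ends y) = S y" "S (swap_sides y) = S y" for y
    unfolding S_def funpow_turn_swap_ends frame_edge_swap by (rule refl sum_period_swap_sides)+
  have S_turn: "S (turn \<Phi> y) = S y" for y
    unfolding S_def
    using sum_funpow_shift[OF period(2), of "\<lambda>y. g (frame_edge y)"]
    by (simp only: funpow_Suc_right comp_apply)
  have S_edge: "S y = S y'" if "y \<in> frames" "y' \<in> frames" "frame_edge y = frame_edge y'" for y y'
    using frame_edge_eqD[OF that] by (elim insertE emptyE) (simp_all only: S_swap)
  define e where "e = (simplex_glue \<Phi>)\<^sup>* `` {frame_edge x}"
  have S_const: "S y = S x" if "(frame_edge x, Y) \<in> (simplex_glue \<Phi>)\<^sup>*" "y \<in> frames" "frame_edge y = Y" for y Y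
    using that
  proof (induction arbitrary: y rule: rtrancl_induct)
    case base
    then show ?case using S_edge x by blast
  next
    case (step Y Z)
    from step.hyps(1) have "card (snd Y) = 2"
      using card_simplex_glue[OF step.hyps(1)] x by (cases x) simp
    then have "{x \<in> frames. frame_edge x = Y} \<noteq> {}"
      using card_frames_over_edge[of "snd Y" "fst Y"] by fastforce
    then obtain w where "w \<in> frames" "frame_edge w = Y" by blast
    with step.hyps(2) obtain v where v: "v \<in> frames" "frame_edge v = Y" "frame_edge (turn \<Phi> v) = Z"
      using simplex_glue_frame by metis
    have "S y = S (turn \<Phi> v)" using S_edge turn_in_frames v step.prems by metis
    then show ?case using S_turn step.IH v by simp
  qed
  \<comment> \<open>Summing \<open>S\<close> over all frames above the class avoids following a
    single orbit: \<open>turn\<close> permutes \<open>B\<close>, and each simplex of the class has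
    exactly four frames.\<close>
  define B where "B = {y \<in> frames. frame_edge y \<in> e}"
  have fin: "finite B" "finite e" by simp_all
  have e2: "card (snd Y) = 2" if "Y \<in> e" for Y
    using card_simplex_glue[of "frame_edge x" Y] that x by (cases x) (simp add: e_def)
  have "e \<in> edges \<Phi>"
    unfolding edges_def e_def by (rule quotientI) (use x in \<open>cases x; simp\<close>)
  have "(\<Sum>y\<in>B. g (frame_edge y)) = (\<Sum>Y\<in>e. \<Sum>y | y \<in> B \<and> frame_edge y = Y. g (frame_edge y))"
    by (rule sum.group[symmetric, OF fin]) (simp add: B_def image_subset_iff)
  also have "\<dots> = (\<Sum>Y\<in>e. 4 * g Y)"
  proof (rule sum.cong[OF refl])
    fix Y assume Y: "Y \<in> e"
    have "{y \<in> B. frame_edge y = Y} = {y \<in> frames. frame_edge y = (fst Y, snd Y)}"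
      using Y by (cases Y) (auto simp: B_def)
    then have "card {y \<in> B. frame_edge y = Y} = 4"
      using card_frames_over_edge[OF e2[OF Y], of "fst Y"] by simp
    then show "(\<Sum>y | y \<in> B \<and> frame_edge y = Y. g (frame_edge y)) = 4 * g Y" by simp
  qed
  also have "\<dots> = 0" using g[OF \<open>e \<in> edges \<Phi>\<close>] by (simp flip: sum_distrib_left)
  finally have B0: "(\<Sum>y\<in>B. g (frame_edge y)) = 0" .
  have turn_B: "turn \<Phi> y \<in> B" if "y \<in> B" for y
  proof -
    have "y \<in> frames" "(frame_edge x, frame_edge y) \<in> (simplex_glue \<Phi>)\<^sup>*"
      using that by (simp_all add: B_def e_def)
    then show ?thesis
      using rtrancl_into_rtrancl[OF _ frame_edge_turn] by (simp add: B_def e_def turn_in_frames)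
  qed
  have bij: "bij_betw (turn \<Phi> ^^ k) B B" for k
  proof (induction k)
    case (Suc k)
    have "bij_betw (turn \<Phi>) B B"
      using endo_inj_surj[OF fin(1), of "turn \<Phi>"] turn_B inj_on_subset[OF inj_turn subset_UNIV]
      by (simp add: bij_betw_def image_subset_iff)
    then show ?case using bij_betw_trans[OF Suc] by (simp add: o_def)
  qed (simp add: bij_betw_def)
  have "of_nat (card B) * S x = (\<Sum>y\<in>B. S x)"
    by simp
  also have "\<dots> = (\<Sum>y\<in>B. S y)"
    by (rule sum.cong[OF refl], rule S_const[OF _ _ refl, symmetric]) (simp_all add: B_def e_def)
  also have "\<dots> = (\<Sum>k<period. \<Sum>y\<in>B. g (frame_edge ((turn \<Phi> ^^ k) y)))"
    unfolding S_def by (rule sum.swap)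
  also have "\<dots> = (\<Sum>k<period. \<Sum>y\<in>B. g (frame_edge y))"
    by (intro sum.cong refl sum.reindex_bij_betw bij)
  finally have "of_nat (card B) * S x = 0" using B0 by simp
  moreover have "x \<in> B" using x by (simp add: B_def e_def)
  ultimately have "S x = 0" using fin(1) by auto
  \<comment> \<open>Both sides are the sum over \<open>period * n\<close> turns, grouped by returns
    after \<open>n\<close> or after \<open>period\<close> turns.\<close>
  have "of_nat period * (\<Sum>k<n. g (frame_edge ((turn \<Phi> ^^ k) x))) = of_nat n * S x"
    using sum_funpow_multiple[OF n, of "\<lambda>y. g (frame_edge y)" period]
      sum_funpow_multiple[OF period(2)[of x], of "\<lambda>y. g (frame_edge y)" n]
    by (simp add: S_def mult.commute)
  then show ?thesis using \<open>S x = 0\<close> period(1) by simp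
qed

end

section \<open>Potentials around the corners\<close>

text \<open>The sign makes the form odd when the rotation is reversed and when the edge is seen from
  its other end.\<close>

definition turn_form :: "('t \<times> 4 set \<Rightarrow> complex) \<Rightarrow> 't \<times> 4 \<times> 4 \<times> 4 \<times> 4 \<Rightarrow> complex" where
  "turn_form g x = of_int (frame_sign x) * g (frame_edge x)"

context triangulation
begin

text \<open>For a form with total zero over a period, this is the average over \<open>j\<close> of
  its partial sums along \<open>j\<close> turns, that is, of the primitives that vanish
  \<open>j\<close> turns after \<open>x\<close>.\<close>

definition turn_potential :: "('t \<times> 4 set \<Rightarrow> complex) \<Rightarrow> 't \<times> 4 \<times> 4 \<times> 4 \<times> 4 \<Rightarrow> complex" where
  "turn_potential g x = - (\<Sum>k<period. of_nat k * turn_form g ((turn \<Phi> ^^ k) x)) / of_nat period"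

lemma turn_potential_turn:
  assumes g: "\<And>e. e \<in> edges \<Phi> \<Longrightarrow> (\<Sum>X\<in>e. g X) = 0" and x: "x \<in> frames"
  shows "turn_potential g (turn \<Phi> x) = turn_potential g x - turn_form g x"
proof -
  let ?f = "\<lambda>k. turn_form g ((turn \<Phi> ^^ k) x)"
  let ?N = "period"
  have 0: "(\<Sum>k<?N. ?f k) = 0"
    using sum_turn_eq_0[OF g x period(2)]
    by (simp add: turn_form_def frame_sign_funpow_turn[OF x] flip: sum_distrib_left)
  have shift: "(\<Sum>k<?N. ?f (Suc k)) = (\<Sum>k<?N. ?f k)"
    by (rule sum_funpow_shift[OF period(2)])
  \<comment> \<open>Summation by parts: the same sum is split at its first and at its last
    term.\<close>
  have "(\<Sum>k<Suc ?N. of_nat k * ?f k) = 0 * ?f 0 + (\<Sum>k<?N. of_nat (Suc k) * ?f (Suc k))"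
    by (subst sum.lessThan_Suc_shift) simp
  also have "\<dots> = (\<Sum>k<?N. of_nat k * ?f (Suc k)) + (\<Sum>k<?N. ?f (Suc k))"
    by (simp add: algebra_simps sum.distrib)
  finally have "(\<Sum>k<?N. of_nat k * ?f (Suc k)) = (\<Sum>k<?N. of_nat k * ?f k) + of_nat ?N * ?f ?N"
    using 0 shift by simp
  moreover have "?f ?N = turn_form g x" by (simp add: period)
  moreover have "(\<Sum>k<?N. of_nat k * ?f (Suc k)) = (\<Sum>k<?N. of_nat k * turn_form g ((turn \<Phi> ^^ k) (turn \<Phi> x)))"
    by (simp add: funpow_swap1)
  ultimately show ?thesis using period(1) unfolding turn_potential_def
    by (simp add: field_simps)
qed

text \<open>
  The potential at the corner \<open>b\<close> of the side \<open>d\<close>. Symmetrizing makes the frames \<open>(a, b, c, d)\<close> and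
  \<open>(a, b, d, c)\<close> agree, and antisymmetrizing the two ends of the edge \<open>{a, b}\<close> makes their
  contributions to the cup product cancel.
\<close>

definition side_potential :: "('t \<times> 4 set \<Rightarrow> complex) \<Rightarrow> 't \<times> 4 \<times> 4 \<times> 4 \<times> 4 \<Rightarrow> complex" where
  "side_potential g x =
     (turn_potential g x + (turn_potential g (swap_sides x) - turn_form g (swap_sides x))
      - turn_potential g (swap_ends x)
      - (turn_potential g (swap_sides (swap_ends x)) - turn_form g (swap_sides (swap_ends x)))) / 4"

lemma turn_form_swap:
  assumes "x \<in> frames"
  shows "turn_form g (swap_ends x) = - turn_form g x" "turn_form g (swap_sides x) = - turn_form g x"
  using assms by (simp_all add: turn_form_def)

lemma side_potential_swap_ends: "side_potential g (swap_ends x) = - side_potential g x"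
  unfolding side_potential_def swap_swap by (simp add: field_simps)

text \<open>The potentials cancel, and by the parity of \<open>turn_form\<close> its four remaining
  values all equal the one at \<open>x\<close>; this is what the division by 4 compensates.\<close>

lemma side_potential_swap_sides:
  assumes x: "x \<in> frames"
  shows "side_potential g x - side_potential g (swap_sides x) = turn_form g x"
proof -
  have "turn_form g (swap_sides (swap_ends x)) = turn_form g x"
    "turn_form g (swap_ends x) = - turn_form g x" "turn_form g (swap_sides x) = - turn_form g x"
    using x by (simp_all only: turn_form_swap swap_in_frames minus_minus)
  then show ?thesis unfolding side_potential_def swap_ends_sides swap_swap
    by (simp add: field_simps)
qed

text \<open>\<open>turn x\<close> and \<open>swap_sides x\<close> show the same side of the link
  from its two triangles. The potential therefore depends only on the side and on its end.\<close>

lemma side_potential_turn: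
  assumes g: "\<And>e. e \<in> edges \<Phi> \<Longrightarrow> (\<Sum>X\<in>e. g X) = 0" and x: "x \<in> frames"
  shows "side_potential g (turn \<Phi> x) = side_potential g (swap_sides x)"
proof -
  have 1: "turn_potential g (turn \<Phi> y) = turn_potential g y - turn_form g y" if "y \<in> frames" for y
    using turn_potential_turn[OF g that] .
  have 2: "turn_potential g (swap_sides (turn \<Phi> y)) - turn_form g (swap_sides (turn \<Phi> y)) =
      turn_potential g (swap_sides y)" if "y \<in> frames" for y
    using 1[of "swap_sides (turn \<Phi> y)"] that
    by (simp only: turn_swap_sides_turn turn_in_frames swap_in_frames)
  have x': "swap_ends x \<in> frames" using x by simp
  show ?thesis
    unfolding side_potential_def turn_swap_ends[symmetric] 1[OF x] 2[OF x] 1[OF x'] 2[OF x']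
      swap_ends_sides swap_swap
    by (simp only: add.commute diff_diff_eq diff_add_eq)
qed

end

section \<open>Cochains on the vertex links\<close>

lemma sum_link_flags:
  fixes h :: "'t::finite \<times> 4 \<times> 4 \<Rightarrow> 'b::comm_monoid_add"
  shows "(\<Sum>s\<in>link_flags v. h s) = (\<Sum>(\<sigma>, a)\<in>link_triangles v. \<Sum>i\<in>- {a}. h (\<sigma>, a, i))"
proof -
  have "(\<Sum>(\<sigma>, a)\<in>link_triangles v. \<Sum>i\<in>- {a}. h (\<sigma>, a, i)) =
      (\<Sum>t\<in>link_triangles v. \<Sum>i\<in>- {snd t}. h (fst t, snd t, i))"
    by (simp add: case_prod_beta)
  also have "\<dots> = (\<Sum>(t, i)\<in>(SIGMA t:link_triangles v. - {snd t}). h (fst t, snd t, i))"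
    by (rule sum.Sigma) simp_all
  also have "\<dots> = (\<Sum>s\<in>link_flags v. h s)"
    by (rule sum.reindex_bij_witness[of _ "\<lambda>(\<sigma>, a, i). ((\<sigma>, a), i)" "\<lambda>(t, i). (fst t, snd t, i)"])
      (auto simp: link_flags_def)
  finally show ?thesis ..
qed

text \<open>These are the properties of a kernel element pulled back to the edges of the tetrahedra:
  the edge equations, the relation between the three quadrilateral types of a tetrahedron, and equal
  values on opposite edges.\<close>

definition balanced :: "'t face_pairing \<Rightarrow> ('t \<times> 4 set \<Rightarrow> complex) \<Rightarrow> bool" where
  "balanced \<Phi> g \<longleftrightarrow> (\<forall>e\<in>edges \<Phi>. (\<Sum>X\<in>e. g X) = 0) \<and>
     (\<forall>\<sigma> a b c d. distinct [a, b, c, d] \<longrightarrow> g (\<sigma>, {a, b}) + g (\<sigma>, {a, c}) + g (\<sigma>, {a, d}) = 0) \<and>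
     (\<forall>\<sigma> X. g (\<sigma>, - X) = g (\<sigma>, X))"

text \<open>The potential of the form on the sides of a triangle, normalized to have sum zero.\<close>

definition tri_potential :: "('t \<times> 4 set \<Rightarrow> complex) \<Rightarrow> 't \<times> 4 \<times> 4 \<Rightarrow> complex" where
  "tri_potential g = (\<lambda>(\<sigma>, a, i).
     \<Sum>(j, x) | distinct [a, i, j, x]. of_int (label_sign a i j x) * g (\<sigma>, {a, j}) / 3)"

lemma tri_potential_eq:
  assumes "distinct [a, i, j, x]"
  shows "tri_potential g (\<sigma>, a, i) =
    of_int (label_sign a i j x) * (g (\<sigma>, {a, j}) - g (\<sigma>, {a, x})) / 3"
proof -
  have "distinct [a, j, x, i]" "(j, x) \<noteq> (x, j)" using assms by auto
  then show ?thesis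
    unfolding tri_potential_def
    by (simp add: remaining_pairs(2) label_sign_transpose(3)[OF assms] diff_divide_distrib right_diff_distrib
        del: distinct.simps)
qed

text \<open>The sides \<open>i\<close> and \<open>j\<close> meet at the corner \<open>x\<close>. As
  the three values sum to zero, twice the value at \<open>x\<close> minus the other two is three
  times it, which explains the division by 3.\<close>

lemma tri_potential_diff:
  assumes g: "balanced \<Phi> g" and d: "distinct [a, i, j, x]"
  shows "tri_potential g (\<sigma>, a, j) - tri_potential g (\<sigma>, a, i) =
    of_int (label_sign a i j x) * g (\<sigma>, {a, x})"
proof -
  have d': "distinct [a, j, x, i]" using d by auto
  have "g (\<sigma>, {a, i}) + g (\<sigma>, {a, j}) + g (\<sigma>, {a, x}) = 0"
    using g d unfolding balanced_def by blast
  then have 0: "g (\<sigma>, {a, i}) = - g (\<sigma>, {a, j}) - g (\<sigma>, {a, x})" by algebra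
  show ?thesis
    unfolding tri_potential_eq[OF d] tri_potential_eq[OF d'] label_sign_rotate(1)[OF d] 0
    by (simp add: field_simps)
qed

context triangulation
begin

text \<open>Around a vertex of the link the differences at the corners are the values of the form
  with one constant sign; the edge equation makes their sum vanish.\<close>

lemma sum_turn_tri_potential:
  assumes g: "balanced \<Phi> g" and x: "x \<in> frames" and n: "(turn \<Phi> ^^ n) x = x"
  shows "(\<Sum>k<n. tri_potential g (first_side ((turn \<Phi> ^^ k) x)) -
    tri_potential g (second_side ((turn \<Phi> ^^ k) x))) = 0"
proof -
  have "tri_potential g (first_side y) - tri_potential g (second_side y) =
      - (of_int (frame_sign y) * g (frame_edge y))" if y_frame: "y \<in> frames" for y
  proof -
    obtain \<sigma> a b c d where y: "y = (\<sigma>, a, b, c, d)" by (cases y)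
    have d: "distinct [a, b, c, d]" "distinct [a, d, c, b]" "distinct [a, b, d, c]" using y_frame y by auto
    have "label_sign a d c b = - label_sign a b c d"
      using label_sign_rotate(1)[OF d(3)] label_sign_transpose(3)[OF d(1)] by simp
    then show ?thesis using tri_potential_diff[OF g d(2)] by (simp add: y)
  qed
  then have "(\<Sum>k<n. tri_potential g (first_side ((turn \<Phi> ^^ k) x)) -
      tri_potential g (second_side ((turn \<Phi> ^^ k) x))) =
      (\<Sum>k<n. - of_int (frame_sign x) * g (frame_edge ((turn \<Phi> ^^ k) x)))"
    by (intro sum.cong refl) (simp add: funpow_turn_in_frames[OF x] frame_sign_funpow_turn[OF x])
  also have "\<dots> = 0"
    using g sum_turn_eq_0[OF _ x n, of g]
    by (simp add: balanced_def sum_negf flip: sum_distrib_left)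
  finally show ?thesis .
qed

text \<open>The integral along the dual edge through \<open>s\<close>, from triangle to triangle,
  when \<open>q\<close> measures each side from the centre of its triangle.\<close>

definition jump :: "('t \<times> 4 \<times> 4 \<Rightarrow> complex) \<Rightarrow> 't \<times> 4 \<times> 4 \<Rightarrow> complex" where
  "jump q s = q s - q (across \<Phi> s)"

lemma jump_across: "jump q (across \<Phi> s) = - jump q s"
  by (simp add: jump_def)

text \<open>
  The value of a side is the difference of the potentials at its two ends; the side is directed
  counterclockwise around the triangle.
\<close>

definition side_form :: "('t \<times> 4 set \<Rightarrow> complex) \<Rightarrow> 't \<times> 4 \<times> 4 \<Rightarrow> complex" where
  "side_form g = (\<lambda>(\<sigma>, a, i).
     - (\<Sum>(b, c) | distinct [a, b, c, i]. of_int (label_sign a b c i) * side_potential g (\<sigma>, a, b, c, i)))"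

lemma side_form_eq:
  assumes "distinct [a, b, c, i]"
  shows "side_form g (\<sigma>, a, i) = of_int (label_sign a b c i) *
    (side_potential g (\<sigma>, a, c, b, i) - side_potential g (\<sigma>, a, b, c, i))"
proof -
  have "(b, c) \<noteq> (c, b)" using assms by auto
  then show ?thesis
    unfolding side_form_def
    by (simp add: remaining_pairs(1)[OF assms] label_sign_transpose(2)[OF assms] algebra_simps
        del: distinct.simps)
qed

lemma side_potential_across:
  assumes "balanced \<Phi> g" "distinct [a, b, c, i]" "\<Phi> \<sigma> i = (\<tau>, \<pi>)"
  shows "side_potential g (\<tau>, \<pi> a, \<pi> b, \<pi> c, \<pi> i) = side_potential g (\<sigma>, a, b, c, i)"
  using side_potential_turn[of g "(\<sigma>, a, b, i, c)"] assms
  by (auto simp: turn_eq balanced_def)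

lemma side_form_across:
  assumes g: "balanced \<Phi> g" and "i \<noteq> a"
  shows "side_form g (across \<Phi> (\<sigma>, a, i)) = - side_form g (\<sigma>, a, i)"
proof -
  obtain \<tau> \<pi> where p: "\<Phi> \<sigma> i = (\<tau>, \<pi>)" by fastforce
  obtain b c where "distinct [a, i, b, c]" using obtain_labels2[of a i] assms by auto
  then have d: "distinct [a, b, c, i]" "distinct [a, c, b, i]" by auto
  then have d': "distinct [\<pi> a, \<pi> b, \<pi> c, \<pi> i]" by (auto simp: pairing_eq_iff[OF p])
  show ?thesis
    unfolding across_eq[OF p] side_form_eq[OF d(1)] side_form_eq[OF d'] pairing_label_sign[OF p d(1)]
      side_potential_across[OF g d(1) p] side_potential_across[OF g d(2) p]
    by simp
qed

lemma side_potential_diff: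
  assumes "distinct [a, b, c, d]"
  shows "side_potential g (\<sigma>, a, b, c, d) - side_potential g (\<sigma>, a, b, d, c) =
    of_int (label_sign a b c d) * g (\<sigma>, {a, b})"
  using side_potential_swap_sides[of "(\<sigma>, a, b, c, d)" g] assms by (simp add: turn_form_def)

text \<open>The relations at the three sides and the three corners of a triangle with a common sign,
  as input for the ring computations below.\<close>

lemma side_form_triangle:
  assumes d: "distinct [a, b, c, d]"
  shows "side_form g (\<sigma>, a, b) = of_int (label_sign a b c d) *
      (side_potential g (\<sigma>, a, d, c, b) - side_potential g (\<sigma>, a, c, d, b))"
    "side_form g (\<sigma>, a, c) = of_int (label_sign a b c d) *
      (side_potential g (\<sigma>, a, b, d, c) - side_potential g (\<sigma>, a, d, b, c))"
    "side_form g (\<sigma>, a, d) = of_int (label_sign a b c d) *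
      (side_potential g (\<sigma>, a, c, b, d) - side_potential g (\<sigma>, a, b, c, d))"
    "side_potential g (\<sigma>, a, b, c, d) - side_potential g (\<sigma>, a, b, d, c) =
      of_int (label_sign a b c d) * g (\<sigma>, {a, b})"
    "side_potential g (\<sigma>, a, c, d, b) - side_potential g (\<sigma>, a, c, b, d) =
      of_int (label_sign a b c d) * g (\<sigma>, {a, c})"
    "side_potential g (\<sigma>, a, d, b, c) - side_potential g (\<sigma>, a, d, c, b) =
      of_int (label_sign a b c d) * g (\<sigma>, {a, d})"
proof -
  have d1: "distinct [a, c, d, b]" and d2: "distinct [a, d, b, c]" using d by auto
  note r = label_sign_rotate[OF d]
  show "side_form g (\<sigma>, a, b) = of_int (label_sign a b c d) *
      (side_potential g (\<sigma>, a, d, c, b) - side_potential g (\<sigma>, a, c, d, b))"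
    "side_form g (\<sigma>, a, c) = of_int (label_sign a b c d) *
      (side_potential g (\<sigma>, a, b, d, c) - side_potential g (\<sigma>, a, d, b, c))"
    "side_form g (\<sigma>, a, d) = of_int (label_sign a b c d) *
      (side_potential g (\<sigma>, a, c, b, d) - side_potential g (\<sigma>, a, b, c, d))"
    using side_form_eq[OF d1, of g \<sigma>] side_form_eq[OF d2, of g \<sigma>] side_form_eq[OF d, of g \<sigma>]
    unfolding r by this+
  show "side_potential g (\<sigma>, a, b, c, d) - side_potential g (\<sigma>, a, b, d, c) =
      of_int (label_sign a b c d) * g (\<sigma>, {a, b})"
    "side_potential g (\<sigma>, a, c, d, b) - side_potential g (\<sigma>, a, c, b, d) =
      of_int (label_sign a b c d) * g (\<sigma>, {a, c})"
    "side_potential g (\<sigma>, a, d, b, c) - side_potential g (\<sigma>, a, d, c, b) =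
      of_int (label_sign a b c d) * g (\<sigma>, {a, d})"
    using side_potential_diff[OF d, of g \<sigma>] side_potential_diff[OF d1, of g \<sigma>]
      side_potential_diff[OF d2, of g \<sigma>]
    unfolding r by this+
qed

text \<open>Around the triangle the potentials cancel up to their changes at the three corners,
  which are the values of \<open>g\<close> and sum to zero.\<close>

lemma sum_side_form:
  assumes g: "balanced \<Phi> g"
  shows "(\<Sum>i\<in>- {a}. side_form g (\<sigma>, a, i)) = 0"
proof -
  obtain b c d where d: "distinct [a, b, c, d]" using obtain_labels3 .
  have 0: "g (\<sigma>, {a, b}) + g (\<sigma>, {a, c}) + g (\<sigma>, {a, d}) = 0"
    using g d unfolding balanced_def by blast
  define e :: complex where "e = of_int (label_sign a b c d)"
  show ?thesis
    using side_form_triangle[OF d, of g \<sigma>] 0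
    unfolding sum_complement_label[OF d] e_def[symmetric]
    by algebra
qed

text \<open>The first term is half of the symplectic form of the tetrahedron. The others are
  attached to the corners of the triangle, where they can cancel against the other end of the same
  edge.\<close>

lemma sum_triangle_cup:
  assumes f: "balanced \<Phi> f" and g: "balanced \<Phi> g" and d: "distinct [a, b, c, d]"
  shows "(\<Sum>i\<in>- {a}. tri_potential f (\<sigma>, a, i) * side_form g (\<sigma>, a, i)) =
    of_int (label_sign a b c d) * (f (\<sigma>, {a, c}) * g (\<sigma>, {a, b}) - f (\<sigma>, {a, b}) * g (\<sigma>, {a, c})) / 2
    - (f (\<sigma>, {a, b}) * (side_potential g (\<sigma>, a, b, c, d) + side_potential g (\<sigma>, a, b, d, c))
     + f (\<sigma>, {a, c}) * (side_potential g (\<sigma>, a, c, d, b) + side_potential g (\<sigma>, a, c, b, d))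
     + f (\<sigma>, {a, d}) * (side_potential g (\<sigma>, a, d, b, c) + side_potential g (\<sigma>, a, d, c, b))) / 2"
proof -
  define e :: complex where "e = of_int (label_sign a b c d)"
  have ee: "e * e = 1" unfolding e_def by (rule of_int_label_sign_square)
  have d1: "distinct [a, c, d, b]" and d2: "distinct [a, d, b, c]" using d by auto
  have p: "tri_potential f (\<sigma>, a, b) * 3 = e * (f (\<sigma>, {a, c}) - f (\<sigma>, {a, d}))"
    "tri_potential f (\<sigma>, a, c) * 3 = e * (f (\<sigma>, {a, d}) - f (\<sigma>, {a, b}))"
    "tri_potential f (\<sigma>, a, d) * 3 = e * (f (\<sigma>, {a, b}) - f (\<sigma>, {a, c}))"
    using tri_potential_eq[OF d, of f \<sigma>] tri_potential_eq[OF d1, of f \<sigma>] tri_potential_eq[OF d2, of f \<sigma>]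
    unfolding label_sign_rotate[OF d] e_def by simp_all
  have F: "f (\<sigma>, {a, b}) + f (\<sigma>, {a, c}) + f (\<sigma>, {a, d}) = 0"
    and G: "g (\<sigma>, {a, b}) + g (\<sigma>, {a, c}) + g (\<sigma>, {a, d}) = 0"
    using f g d unfolding balanced_def by blast+
  \<comment> \<open>The factor 2 here and the factor 3 in \<open>p\<close> clear the denominators,
    leaving an identity in a commutative ring with \<open>e * e = 1\<close>.\<close>
  have "2 * (\<Sum>i\<in>- {a}. tri_potential f (\<sigma>, a, i) * side_form g (\<sigma>, a, i)) =
      e * (f (\<sigma>, {a, c}) * g (\<sigma>, {a, b}) - f (\<sigma>, {a, b}) * g (\<sigma>, {a, c}))
      - (f (\<sigma>, {a, b}) * (side_potential g (\<sigma>, a, b, c, d) + side_potential g (\<sigma>, a, b, d, c))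
     + f (\<sigma>, {a, c}) * (side_potential g (\<sigma>, a, c, d, b) + side_potential g (\<sigma>, a, c, b, d))
     + f (\<sigma>, {a, d}) * (side_potential g (\<sigma>, a, d, b, c) + side_potential g (\<sigma>, a, d, c, b)))"
    using p F G ee side_form_triangle[OF d, of g \<sigma>]
    unfolding sum_complement_label[OF d] e_def[symmetric]
    by algebra
  moreover have "x = y / 2 - w / 2" if "2 * x = y - w" for x y w :: complex
    using that by (simp add: field_simps)
  ultimately show ?thesis unfolding e_def by blast
qed

lemma sum_tetrahedron_cup:
  assumes f: "balanced \<Phi> f" and g: "balanced \<Phi> g"
  shows "(\<Sum>a\<in>UNIV. \<Sum>i\<in>- {a}. tri_potential f (\<sigma>, a, i) * side_form g (\<sigma>, a, i)) =
    2 * (f (\<sigma>, {0, 2}) * g (\<sigma>, {0, 1}) - f (\<sigma>, {0, 1}) * g (\<sigma>, {0, 2}))"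
proof -
  \<comment> \<open>Four even frames, one at each vertex, related by double transpositions. These
    preserve each pair of opposite edges, so every vertex contributes the same half of the
    form.\<close>
  have d: "distinct [0, 1, 2, 3 :: 4]" "distinct [1, 0, 3, 2 :: 4]" "distinct [2, 3, 0, 1 :: 4]"
    "distinct [3, 2, 1, 0 :: 4]" by auto
  have d': "distinct [1, 0, 2, 3 :: 4]" "distinct [2, 0, 3, 1 :: 4]" "distinct [2, 0, 1, 3 :: 4]"
     "distinct [0, 2, 1, 3 :: 4]"  "distinct [3, 0, 1, 2 :: 4]"  "distinct [0, 3, 1, 2 :: 4]"
     "distinct [0, 1, 3, 2 :: 4]" "distinct [2, 3, 1, 0 :: 4]" "distinct [3, 2, 0, 1 :: 4]"
    by auto
  have s: "label_sign 1 0 3 2 = 1" "label_sign 2 3 0 1 = 1" "label_sign 3 2 1 0 = 1"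
  proof -
    have 1: "label_sign 1 0 2 3 = -1" "label_sign 0 1 3 2 = -1" "label_sign 0 2 1 3 = -1"
      using label_sign_0123 label_sign_transpose[OF d(1)] by simp_all
    show "label_sign 1 0 3 2 = 1" using 1 label_sign_transpose(3)[OF d'(1)] by simp
    have 2: "label_sign 2 0 1 3 = 1" using 1 label_sign_transpose(1)[OF d'(4)] by simp
    then have 3: "label_sign 2 0 3 1 = -1" using label_sign_transpose(3)[OF d'(3)] by simp
    then show 4: "label_sign 2 3 0 1 = 1" using label_sign_transpose(2)[OF d'(2)] by simp
    then have 5: "label_sign 2 3 1 0 = - 1" using label_sign_transpose(3)[OF d(3)] by simp
    then show "label_sign 3 2 1 0 = 1" using label_sign_transpose(1)[OF d'(8)] by simp
  qed
  have opp: "h (\<sigma>, {2, 3}) = h (\<sigma>, {0, 1})" "h (\<sigma>, {1, 3}) = h (\<sigma>, {0, 2})"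
    "h (\<sigma>, {1, 2}) = h (\<sigma>, {0, 3})" if "balanced \<Phi> h" for h
    using that compl_labels unfolding balanced_def by metis+
  have comm: "{1, 0} = {0, 1 :: 4}" "{2, 0} = {0, 2 :: 4}" "{3, 0} = {0, 3 :: 4}"
    "{3, 1} = {1, 3 :: 4}" "{2, 1} = {1, 2 :: 4}" "{3, 2} = {2, 3 :: 4}" by auto
  \<comment> \<open>This cancels the corner terms at the two ends of each edge.\<close>
  have anti: "side_potential g (\<sigma>, b, a, c, d) = - side_potential g (\<sigma>, a, b, c, d)" for a b c d
    using side_potential_swap_ends[of g "(\<sigma>, a, b, c, d)"] by simp
  note anti = anti[of 0 1] anti[of 0 2] anti[of 0 3] anti[of 1 2] anti[of 1 3] anti[of 2 3]
  show ?thesis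
    unfolding sum_labels[OF d(1)] sum_triangle_cup[OF f g d(1)] sum_triangle_cup[OF f g d(2)]
      sum_triangle_cup[OF f g d(3)] sum_triangle_cup[OF f g d(4)] s label_sign_0123 comm anti
      opp[OF f] opp[OF g]
    by (simp add: field_simps)
qed

subsection \<open>Decomposition into the vertex links\<close>

lemma equiv_simplex_glue: "equiv UNIV ((simplex_glue \<Phi>)\<^sup>*)"
proof (rule equivI)
  have "sym (simplex_glue \<Phi>)"
  proof (rule symI)
    fix X Y assume "(X, Y) \<in> simplex_glue \<Phi>"
    then obtain \<sigma> V i \<tau> \<pi> where p: "\<Phi> \<sigma> i = (\<tau>, \<pi>)" and i: "i \<notin> V"
      and XY: "X = (\<sigma>, V)" "Y = (\<tau>, \<pi> ` V)"
      unfolding simplex_glue_def by blast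
    have "\<pi> i \<notin> \<pi> ` V" using i by (auto simp: pairing_eq_iff[OF p])
    then have "((\<tau>, \<pi> ` V), (\<sigma>, inv \<pi> ` \<pi> ` V)) \<in> simplex_glue \<Phi>"
      using pairing(3)[OF p] unfolding simplex_glue_def by blast
    moreover have "inv \<pi> ` \<pi> ` V = V" by (simp add: image_comp pairing_inv[OF p])
    ultimately show "(Y, X) \<in> simplex_glue \<Phi>" unfolding XY by simp
  qed
  then show "sym ((simplex_glue \<Phi>)\<^sup>*)" by (rule sym_rtrancl)
qed (auto simp: refl_rtrancl trans_rtrancl)

lemma vertices_quotient: "v \<in> vertices \<Phi> \<Longrightarrow> v \<in> UNIV // (simplex_glue \<Phi>)\<^sup>*"
  by (auto simp: vertices_def quotient_def)

lemma link_triangle_glue: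
  assumes v: "v \<in> vertices \<Phi>" and "(\<sigma>, a) \<in> link_triangles v" "i \<noteq> a" "\<Phi> \<sigma> i = (\<tau>, \<pi>)"
  shows "(\<tau>, \<pi> a) \<in> link_triangles v"
proof -
  have "((\<sigma>, {a}), (\<tau>, \<pi> ` {a})) \<in> (simplex_glue \<Phi>)\<^sup>*"
    using assms unfolding simplex_glue_def by blast
  then show ?thesis
    using assms(2) in_quotient_imp_closed[OF equiv_simplex_glue vertices_quotient[OF v]]
    by (auto simp: link_triangles_def)
qed

lemma across_link_flags:
  assumes v: "v \<in> vertices \<Phi>" and s: "s \<in> link_flags v"
  shows "across \<Phi> s \<in> link_flags v"
proof -
  obtain \<sigma> a i where s': "s = (\<sigma>, a, i)" by (cases s)
  obtain \<tau> \<pi> where p: "\<Phi> \<sigma> i = (\<tau>, \<pi>)" by fastforce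
  show ?thesis using s link_triangle_glue[OF v _ _ p, of a] unfolding s' across_eq[OF p]
    by (auto simp: link_flags_def pairing_eq_iff[OF p])
qed

lemma sum_across:
  fixes h :: "'t \<times> 4 \<times> 4 \<Rightarrow> 'b::comm_monoid_add"
  assumes v: "v \<in> vertices \<Phi>"
  shows "(\<Sum>s\<in>link_flags v. h (across \<Phi> s)) = (\<Sum>s\<in>link_flags v. h s)"
  by (rule sum.reindex_bij_witness[of _ "across \<Phi>" "across \<Phi>"]) (simp_all add: across_link_flags[OF v])

lemma side_form_across_flag:
  assumes "balanced \<Phi> g" "s \<in> link_flags v"
  shows "side_form g (across \<Phi> s) = - side_form g s"
  using assms side_form_across by (cases s) (auto simp: link_flags_def)

text \<open>Every side occurs twice in \<open>link_flags\<close>, and \<open>side_form\<close>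
  changes sign between the two occurrences, as \<open>jump\<close> does.\<close>

lemma sum_jump_side_form:
  assumes v: "v \<in> vertices \<Phi>" and g: "balanced \<Phi> g"
  shows "(\<Sum>s\<in>link_flags v. jump q s * side_form g s) = 2 * (\<Sum>s\<in>link_flags v. q s * side_form g s)"
proof -
  have "(\<Sum>s\<in>link_flags v. q (across \<Phi> s) * side_form g s) =
      (\<Sum>s\<in>link_flags v. - (q (across \<Phi> s) * side_form g (across \<Phi> s)))"
    by (intro sum.cong refl) (simp add: side_form_across_flag[OF g])
  also have "\<dots> = - (\<Sum>s\<in>link_flags v. q s * side_form g s)"
    using sum_across[OF v, of "\<lambda>s. q s * side_form g s"] by (simp add: sum_negf)
  finally show ?thesis
    by (simp add: jump_def left_diff_distrib sum_subtractf)
qed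

text \<open>Stokes: the sum regroups by triangles, and \<open>side_form\<close> is closed on each of
  them.\<close>

lemma sum_coboundary_side_form:
  assumes v: "v \<in> vertices \<Phi>" and g: "balanced \<Phi> g"
  shows "(\<Sum>s\<in>link_flags v. jump (\<lambda>(\<sigma>, a, i). f (\<sigma>, a)) s * side_form g s) = 0"
proof -
  have "(\<Sum>s\<in>link_flags v. (case s of (\<sigma>, a, i) \<Rightarrow> f (\<sigma>, a)) * side_form g s) =
      (\<Sum>(\<sigma>, a)\<in>link_triangles v. f (\<sigma>, a) * (\<Sum>i\<in>- {a}. side_form g (\<sigma>, a, i)))"
    unfolding sum_link_flags by (intro sum.cong refl) (auto simp: sum_distrib_left)
  also have "\<dots> = 0" by (simp add: sum_side_form[OF g] case_prod_beta)
  finally show ?thesis by (simp add: sum_jump_side_form[OF v g])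
qed

lemma sum_over_links:
  fixes h :: "'t \<times> 4 \<times> 4 \<Rightarrow> complex"
  shows "(\<Sum>v\<in>vertices \<Phi>. \<Sum>s\<in>link_flags v. h s) = (\<Sum>\<sigma>\<in>UNIV. \<Sum>a\<in>UNIV. \<Sum>i\<in>- {a}. h (\<sigma>, a, i))"
proof -
  have disj: "link_flags v \<inter> link_flags w = {}" if "v \<in> vertices \<Phi>" "w \<in> vertices \<Phi>" "v \<noteq> w" for v w
    using quotient_disj[OF equiv_simplex_glue vertices_quotient vertices_quotient] that
    by (fastforce simp: link_flags_def link_triangles_def)
  have "(\<sigma>, a, i) \<in> \<Union> (link_flags ` vertices \<Phi>)" if "i \<noteq> a" for \<sigma> a i
  proof -
    have "(simplex_glue \<Phi>)\<^sup>* `` {(\<sigma>, {a})} \<in> vertices \<Phi>"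
      unfolding vertices_def by (rule quotientI) simp
    moreover have "(\<sigma>, a, i) \<in> link_flags ((simplex_glue \<Phi>)\<^sup>* `` {(\<sigma>, {a})})"
      using that by (simp add: link_flags_def link_triangles_def)
    ultimately show ?thesis by blast
  qed
  then have U: "\<Union> (link_flags ` vertices \<Phi>) = {(\<sigma>, a, i). i \<noteq> a}"
    by (auto simp: link_flags_def)
  have "(\<Sum>v\<in>vertices \<Phi>. \<Sum>s\<in>link_flags v. h s) = (\<Sum>s\<in>{(\<sigma>, a, i). i \<noteq> a}. h s)"
    unfolding U[symmetric] by (rule sum.UNION_disjoint[symmetric]) (use disj in auto)
  also have "{(\<sigma> :: 't, a, i). i \<noteq> a} = link_flags UNIV"
    by (auto simp: link_flags_def link_triangles_def)
  also have "(\<Sum>s\<in>link_flags UNIV. h s) = (\<Sum>(\<sigma>, a)\<in>UNIV \<times> UNIV. \<Sum>i\<in>- {a}. h (\<sigma>, a, i))"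
    by (simp add: sum_link_flags link_triangles_def)
  also have "\<dots> = (\<Sum>\<sigma>\<in>UNIV. \<Sum>a\<in>UNIV. \<Sum>i\<in>- {a}. h (\<sigma>, a, i))"
    by (simp add: sum.cartesian_product)
  finally show ?thesis .
qed

text \<open>The constant 4 is 2 for counting each side from both of its triangles, times 2 for the
  four halves in each tetrahedron.\<close>

lemma sum_cup_product:
  assumes "balanced \<Phi> f" "balanced \<Phi> g"
  shows "(\<Sum>v\<in>vertices \<Phi>. \<Sum>s\<in>link_flags v. jump (tri_potential f) s * side_form g s) =
    4 * (\<Sum>\<sigma>\<in>UNIV. f (\<sigma>, {0, 2}) * g (\<sigma>, {0, 1}) - f (\<sigma>, {0, 1}) * g (\<sigma>, {0, 2}))"
proof -
  have "(\<Sum>v\<in>vertices \<Phi>. \<Sum>s\<in>link_flags v. jump (tri_potential f) s * side_form g s) =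
      2 * (\<Sum>v\<in>vertices \<Phi>. \<Sum>s\<in>link_flags v. tri_potential f s * side_form g s)"
    by (simp add: sum_jump_side_form assms(2) sum_distrib_left)
  also have "\<dots> = 2 * (\<Sum>\<sigma>\<in>UNIV. 2 * (f (\<sigma>, {0, 2}) * g (\<sigma>, {0, 1}) - f (\<sigma>, {0, 1}) * g (\<sigma>, {0, 2})))"
    by (simp add: sum_over_links sum_tetrahedron_cup assms)
  finally show ?thesis by (simp add: sum_distrib_left)
qed

end

section \<open>Closed normal curves\<close>

lemma sum_cyclic:
  fixes f :: "nat \<Rightarrow> 'a::comm_monoid_add"
  shows "(\<Sum>k<n. f (Suc k mod n)) = (\<Sum>k<n. f k)"
proof (cases n)
  case (Suc m)
  have "(\<Sum>k<Suc m. f (Suc k mod Suc m)) = (\<Sum>k<m. f (Suc k mod Suc m)) + f 0" by simp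
  also have "(\<Sum>k<m. f (Suc k mod Suc m)) = (\<Sum>k<m. f (Suc k))"
    by (intro sum.cong refl) simp
  also have "(\<Sum>k<m. f (Suc k)) + f 0 = (\<Sum>k<Suc m. f k)"
    using sum.lessThan_Suc_shift[of f m] by (simp add: add.commute)
  finally show ?thesis using Suc by simp
qed simp

definition in_side :: "'t segment \<Rightarrow> 't \<times> 4 \<times> 4" where
  "in_side s = (seg_tet s, seg_vertex s, seg_in s)"

definition out_side :: "'t segment \<Rightarrow> 't \<times> 4 \<times> 4" where
  "out_side s = (seg_tet s, seg_vertex s, seg_out s)"

text \<open>A side carries the label of the opposite corner, so this is the side that the segment
  does not meet.\<close>

definition far_side :: "'t segment \<Rightarrow> 't \<times> 4 \<times> 4" where
  "far_side s = (seg_tet s, seg_vertex s, isolated s)"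

lemma isolated_eq:
  assumes "distinct [seg_vertex s, seg_in s, seg_out s, x]"
  shows "isolated s = x"
  unfolding isolated_def
proof (rule the_equality)
  show "x \<notin> {seg_vertex s, seg_in s, seg_out s}" using assms by auto
  show "y = x" if "y \<notin> {seg_vertex s, seg_in s, seg_out s}" for y
    by (rule label_exhaust[OF assms, of y]) (use that in auto)
qed

lemma segment_frame:
  assumes "distinct [seg_vertex s, seg_in s, seg_out s]"
  shows "distinct [seg_vertex s, seg_in s, seg_out s, isolated s]"
  using obtain_label3[OF assms] isolated_eq by metis

lemma closed_normal_curve_segment:
  assumes "closed_normal_curve \<Phi> v \<alpha>" "s \<in> set \<alpha>"
  shows "distinct [seg_vertex s, seg_in s, seg_out s, isolated s]"
    "(seg_tet s, seg_vertex s) \<in> link_triangles v"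
  using assms segment_frame unfolding closed_normal_curve_def by blast+

lemma closed_normal_curve_across:
  assumes "closed_normal_curve \<Phi> v \<alpha>" "k < length \<alpha>"
  shows "across \<Phi> (out_side (\<alpha> ! k)) = in_side (\<alpha> ! (Suc k mod length \<alpha>))"
  using assms unfolding closed_normal_curve_def Let_def out_side_def in_side_def by blast

text \<open>Twice a potential for crossing the curve: passing from a side where a segment ends to
  its \<open>far_side\<close> counts as half a crossing, as the position on the former side is left
  open. Doubling keeps the weights integral.\<close>

definition curve_weight :: "'t curve \<Rightarrow> 't \<times> 4 \<times> 4 \<Rightarrow> int" where
  "curve_weight \<alpha> t = (\<Sum>k<length \<alpha>. if far_side (\<alpha> ! k) = t then seg_sign (\<alpha> ! k) else 0)"

definition in_count :: "'t curve \<Rightarrow> 't \<times> 4 \<times> 4 \<Rightarrow> int" where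
  "in_count \<alpha> t = (\<Sum>k<length \<alpha>. if in_side (\<alpha> ! k) = t then 1 else 0)"

definition out_count :: "'t curve \<Rightarrow> 't \<times> 4 \<times> 4 \<Rightarrow> int" where
  "out_count \<alpha> t = (\<Sum>k<length \<alpha>. if out_side (\<alpha> ! k) = t then 1 else 0)"

context triangulation
begin

text \<open>The dual edge \<open>t\<close> has the value of its intersection number with the curve.\<close>

definition curve_form :: "'t curve \<Rightarrow> 't \<times> 4 \<times> 4 \<Rightarrow> complex" where
  "curve_form \<alpha> = jump (\<lambda>t. of_int (curve_weight \<alpha> t) / 2)"

lemma sum_cyclic_curve:
  assumes \<alpha>: "closed_normal_curve \<Phi> v \<alpha>"
  shows "(\<Sum>k<length \<alpha>. q (across \<Phi> (out_side (\<alpha> ! k)))) = (\<Sum>k<length \<alpha>. q (in_side (\<alpha> ! k)))"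
proof -
  have "(\<Sum>k<length \<alpha>. q (across \<Phi> (out_side (\<alpha> ! k)))) =
      (\<Sum>k<length \<alpha>. q (in_side (\<alpha> ! (Suc k mod length \<alpha>))))"
    by (intro sum.cong refl) (simp add: closed_normal_curve_across[OF \<alpha>])
  then show ?thesis by (simp only: sum_cyclic[of "\<lambda>k. q (in_side (\<alpha> ! k))"])
qed

text \<open>What is subtracted behind an exit side belongs to the entry side of the next segment.
  Regrouping turns the jumps into differences inside the triangles.\<close>

lemma sum_curve_jump:
  assumes \<alpha>: "closed_normal_curve \<Phi> v \<alpha>"
  shows "(\<Sum>t\<leftarrow>curve_path \<alpha>. jump q t) =
    (\<Sum>k<length \<alpha>. q (out_side (\<alpha> ! k)) - q (in_side (\<alpha> ! k)))"
proof -
  have "(\<Sum>t\<leftarrow>curve_path \<alpha>. jump q t) = (\<Sum>k<length \<alpha>. jump q (out_side (\<alpha> ! k)))"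
    by (simp add: curve_path_def sum_list_sum_nth out_side_def atLeast0LessThan)
  also have "\<dots> = (\<Sum>k<length \<alpha>. q (out_side (\<alpha> ! k)) - q (in_side (\<alpha> ! k)))"
    by (simp add: jump_def sum_subtractf sum_cyclic_curve[OF \<alpha>])
  finally show ?thesis .
qed

text \<open>The potential changes along a segment by the signed value at the isolated corner, as in
  the definition of the log holonomy.\<close>

lemma sum_curve_tri_potential:
  assumes \<alpha>: "closed_normal_curve \<Phi> v \<alpha>" and g: "balanced \<Phi> g"
  shows "(\<Sum>t\<leftarrow>curve_path \<alpha>. jump (tri_potential g) t) =
    (\<Sum>s\<leftarrow>\<alpha>. of_int (seg_sign s) * g (seg_tet s, {seg_vertex s, isolated s}))"
proof -
  have "tri_potential g (out_side s) - tri_potential g (in_side s) =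
      of_int (seg_sign s) * g (seg_tet s, {seg_vertex s, isolated s})" if "s \<in> set \<alpha>" for s
    using tri_potential_diff[OF g closed_normal_curve_segment(1)[OF \<alpha> that]]
    by (simp add: out_side_def in_side_def seg_sign_def)
  then show ?thesis
    unfolding sum_curve_jump[OF \<alpha>] by (simp add: sum_list_sum_nth atLeast0LessThan)
qed

text \<open>The sum of the potentials at the two ends of a side. It is the same from both triangles
  at the side and thus telescopes along closed curves.\<close>

definition side_total :: "('t \<times> 4 set \<Rightarrow> complex) \<Rightarrow> 't \<times> 4 \<times> 4 \<Rightarrow> complex" where
  "side_total g = (\<lambda>(\<sigma>, a, i). \<Sum>(b, c) | distinct [a, b, c, i]. side_potential g (\<sigma>, a, b, c, i))"

lemma side_total_eq:
  assumes "distinct [a, b, c, i]"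
  shows "side_total g (\<sigma>, a, i) = side_potential g (\<sigma>, a, b, c, i) + side_potential g (\<sigma>, a, c, b, i)"
proof -
  have "(b, c) \<noteq> (c, b)" using assms by auto
  then show ?thesis unfolding side_total_def by (simp add: remaining_pairs(1)[OF assms] del: distinct.simps)
qed

lemma side_total_across:
  assumes g: "balanced \<Phi> g" and "i \<noteq> a"
  shows "side_total g (across \<Phi> (\<sigma>, a, i)) = side_total g (\<sigma>, a, i)"
proof -
  obtain \<tau> \<pi> where p: "\<Phi> \<sigma> i = (\<tau>, \<pi>)" by fastforce
  obtain b c where "distinct [a, i, b, c]" using obtain_labels2[of a i] assms by auto
  then have d: "distinct [a, b, c, i]" "distinct [a, c, b, i]" by auto
  then have d': "distinct [\<pi> a, \<pi> b, \<pi> c, \<pi> i]" by (auto simp: pairing_eq_iff[OF p])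
  show ?thesis
    unfolding across_eq[OF p] side_total_eq[OF d(1)] side_total_eq[OF d']
      side_potential_across[OF g d(1) p] side_potential_across[OF g d(2) p] ..
qed

text \<open>Poincare duality: the curve is homotopic to a cycle of sides, the dual of its form.\<close>

lemma sum_curve_form_side_form:
  assumes v: "v \<in> vertices \<Phi>" and \<alpha>: "closed_normal_curve \<Phi> v \<alpha>" and g: "balanced \<Phi> g"
  shows "(\<Sum>t\<in>link_flags v. curve_form \<alpha> t * side_form g t) =
    2 * (\<Sum>t\<leftarrow>curve_path \<alpha>. jump (tri_potential g) t)"
proof -
  have far: "far_side s \<in> link_flags v" if "s \<in> set \<alpha>" for s
    using closed_normal_curve_segment[OF \<alpha> that] by (auto simp: far_side_def link_flags_def)
  \<comment> \<open>The local homotopy: on one triangle, pushing the segment to its far side costs a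
    difference of \<open>side_total\<close>, besides the change of
    \<open>tri_potential\<close>.\<close>
  have seg: "of_int (seg_sign s) * side_form g (far_side s) =
      side_total g (in_side s) - side_total g (out_side s)
      + 2 * (tri_potential g (out_side s) - tri_potential g (in_side s))" if "s \<in> set \<alpha>" for s
  proof -
    define \<sigma> a i j x where defs: "\<sigma> = seg_tet s" "a = seg_vertex s" "i = seg_in s" "j = seg_out s" "x = isolated s"
    have d: "distinct [a, i, j, x]" unfolding defs by (rule closed_normal_curve_segment(1)[OF \<alpha> that])
    then have d1: "distinct [a, j, x, i]" and d2: "distinct [a, x, i, j]" by auto
    define e :: complex where "e = of_int (label_sign a i j x)"
    have ee: "e * e = 1" unfolding e_def by (rule of_int_label_sign_square)
    have "e * side_form g (\<sigma>, a, x) = side_total g (\<sigma>, a, i) - side_total g (\<sigma>, a, j)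
      + 2 * (tri_potential g (\<sigma>, a, j) - tri_potential g (\<sigma>, a, i))"
      using side_form_triangle[OF d, of g \<sigma>] side_total_eq[OF d1, of g \<sigma>] side_total_eq[OF d2, of g \<sigma>]
        tri_potential_diff[OF g d, of \<sigma>] ee sum_side_form[OF g, of \<sigma> a]
      unfolding e_def[symmetric] sum_complement_label[OF d]
      by algebra
    then show ?thesis
      by (simp add: e_def defs in_side_def out_side_def far_side_def seg_sign_def)
  qed
  \<comment> \<open>The half in \<open>curve_form\<close> cancels the doubling of sides in
    \<open>link_flags\<close>.\<close>
  have "(\<Sum>t\<in>link_flags v. curve_form \<alpha> t * side_form g t) =
      (\<Sum>t\<in>link_flags v. of_int (curve_weight \<alpha> t) * side_form g t)"
    unfolding curve_form_def sum_jump_side_form[OF v g] by (simp add: sum_distrib_left)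
  also have "\<dots> = (\<Sum>t\<in>link_flags v. \<Sum>k<length \<alpha>.
      if t = far_side (\<alpha> ! k) then of_int (seg_sign (\<alpha> ! k)) * side_form g t else 0)"
    unfolding curve_weight_def of_int_sum sum_distrib_right by (intro sum.cong refl) auto
  also have "\<dots> = (\<Sum>k<length \<alpha>. of_int (seg_sign (\<alpha> ! k)) * side_form g (far_side (\<alpha> ! k)))"
    by (subst sum.swap) (simp add: far)
  also have "\<dots> = (\<Sum>k<length \<alpha>. side_total g (in_side (\<alpha> ! k)) - side_total g (out_side (\<alpha> ! k))
      + 2 * (tri_potential g (out_side (\<alpha> ! k)) - tri_potential g (in_side (\<alpha> ! k))))"
    by (intro sum.cong refl seg) simp
  also have "\<dots> = (\<Sum>k<length \<alpha>. side_total g (in_side (\<alpha> ! k))) - (\<Sum>k<length \<alpha>. side_total g (out_side (\<alpha> ! k)))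
      + 2 * (\<Sum>t\<leftarrow>curve_path \<alpha>. jump (tri_potential g) t)"
    by (simp add: sum_curve_jump[OF \<alpha>] sum.distrib sum_subtractf sum_distrib_left)
  also have "(\<Sum>k<length \<alpha>. side_total g (out_side (\<alpha> ! k))) =
      (\<Sum>k<length \<alpha>. side_total g (across \<Phi> (out_side (\<alpha> ! k))))"
  proof (intro sum.cong refl)
    fix k assume "k \<in> {..<length \<alpha>}"
    then have "seg_out (\<alpha> ! k) \<noteq> seg_vertex (\<alpha> ! k)"
      using closed_normal_curve_segment(1)[OF \<alpha>, of "\<alpha> ! k"] by auto
    then show "side_total g (out_side (\<alpha> ! k)) = side_total g (across \<Phi> (out_side (\<alpha> ! k)))"
      by (simp add: out_side_def side_total_across[OF g])
  qed
  also have "\<dots> = (\<Sum>k<length \<alpha>. side_total g (in_side (\<alpha> ! k)))" by (rule sum_cyclic_curve[OF \<alpha>])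
  finally show ?thesis by simp
qed

subsection \<open>Turning around a corner\<close>

lemma in_count_across:
  assumes \<alpha>: "closed_normal_curve \<Phi> v \<alpha>"
  shows "in_count \<alpha> (across \<Phi> t) = out_count \<alpha> t" "out_count \<alpha> (across \<Phi> t) = in_count \<alpha> t"
proof -
  show *: "in_count \<alpha> (across \<Phi> t) = out_count \<alpha> t" for t
    using sum_cyclic_curve[OF \<alpha>, of "\<lambda>t'. if t' = across \<Phi> t then 1 else 0 :: int"] inj_across
    by (simp add: in_count_def out_count_def inj_eq)
  show "out_count \<alpha> (across \<Phi> t) = in_count \<alpha> t" using *[of "across \<Phi> t"] by simp
qed

text \<open>A check of the six kinds of segments in a triangle. Expressing the change at a corner by
  entries and exits on its two sides prepares the cancellation around a vertex.\<close>

lemma curve_weight_turn: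
  assumes \<alpha>: "closed_normal_curve \<Phi> v \<alpha>" and x: "x \<in> frames"
  shows "curve_weight \<alpha> (first_side x) - curve_weight \<alpha> (second_side x) =
    frame_sign x * (in_count \<alpha> (first_side x) + in_count \<alpha> (second_side x)
      - out_count \<alpha> (first_side x) - out_count \<alpha> (second_side x))"
proof -
  obtain \<sigma> a b c d where xeq: "x = (\<sigma>, a, b, c, d)" by (cases x)
  have dx: "distinct [a, b, c, d]" using x xeq by simp
  let ?e = "\<lambda>P. if P then 1 else 0 :: int"
  have seg: "seg_sign s * ?e (far_side s = (\<sigma>, a, c)) - seg_sign s * ?e (far_side s = (\<sigma>, a, d)) =
      label_sign a b c d * (?e (in_side s = (\<sigma>, a, c)) + ?e (in_side s = (\<sigma>, a, d))
      - ?e (out_side s = (\<sigma>, a, c)) - ?e (out_side s = (\<sigma>, a, d)))" if s: "s \<in> set \<alpha>" for s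
  proof (cases "seg_tet s = \<sigma> \<and> seg_vertex s = a")
    case True
    define i j y where defs: "i = seg_in s" "j = seg_out s" "y = isolated s"
    have d: "distinct [a, i, j, y]" unfolding defs using closed_normal_curve_segment(1)[OF \<alpha> s] True by simp
    have dp: "distinct [a, b, d, c]" "distinct [a, c, b, d]" "distinct [a, c, d, b]" using dx by auto
    note signs = label_sign_transpose[OF dx] label_sign_rotate[OF dx] label_sign_rotate[OF dp(1)]
    have ne: "b \<noteq> c" "c \<noteq> b" "b \<noteq> d" "d \<noteq> b" "c \<noteq> d" "d \<noteq> c" using dx by auto
    have "i = b \<and> j = c \<and> y = d \<or> i = b \<and> j = d \<and> y = c \<or> i = c \<and> j = b \<and> y = d \<or>
      i = c \<and> j = d \<and> y = b \<or> i = d \<and> j = b \<and> y = c \<or> i = d \<and> j = c \<and> y = b"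
      by (rule label_exhaust[OF dx, of i]; rule label_exhaust[OF dx, of j]; rule label_exhaust[OF dx, of y])
        (use d in auto)
    then have "label_sign a i j y * ?e (y = c) - label_sign a i j y * ?e (y = d) =
      label_sign a b c d * (?e (i = c) + ?e (i = d) - ?e (j = c) - ?e (j = d))"
      using ne by (elim disjE conjE) (simp_all add: signs)
    then show ?thesis using True by (simp add: far_side_def in_side_def out_side_def seg_sign_def defs)
  next
    case False
    then show ?thesis by (auto simp: far_side_def in_side_def out_side_def)
  qed
  have "(\<Sum>k<length \<alpha>. seg_sign (\<alpha> ! k) * ?e (far_side (\<alpha> ! k) = (\<sigma>, a, c)) -
        seg_sign (\<alpha> ! k) * ?e (far_side (\<alpha> ! k) = (\<sigma>, a, d))) =
      (\<Sum>k<length \<alpha>. label_sign a b c d * (?e (in_side (\<alpha> ! k) = (\<sigma>, a, c)) + ?e (in_side (\<alpha> ! k) = (\<sigma>, a, d))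
      - ?e (out_side (\<alpha> ! k) = (\<sigma>, a, c)) - ?e (out_side (\<alpha> ! k) = (\<sigma>, a, d))))"
    by (intro sum.cong refl seg) simp
  then show ?thesis
    unfolding xeq curve_weight_def in_count_def out_count_def
    by (simp add: sum.distrib sum_subtractf flip: sum_distrib_left) (simp add: if_distrib cong: if_cong)
qed

text \<open>The excess \<open>N\<close> of entries over exits changes sign across a side, and a turn
  carries the first side to the second one of the next frame; so the contributions cancel in
  pairs.\<close>

lemma sum_turn_curve_weight:
  assumes \<alpha>: "closed_normal_curve \<Phi> v \<alpha>" and x: "x \<in> frames" and n: "(turn \<Phi> ^^ n) x = x"
  shows "(\<Sum>k<n. curve_weight \<alpha> (first_side ((turn \<Phi> ^^ k) x)) -
    curve_weight \<alpha> (second_side ((turn \<Phi> ^^ k) x))) = 0"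
proof -
  define N where "N t = in_count \<alpha> t - out_count \<alpha> t" for t
  have "(\<Sum>k<n. N (second_side ((turn \<Phi> ^^ k) x))) = (\<Sum>k<n. N (second_side ((turn \<Phi> ^^ Suc k) x)))"
    by (rule sum_funpow_shift[OF n, of "\<lambda>y. N (second_side y)", symmetric])
  also have "\<dots> = (\<Sum>k<n. - N (first_side ((turn \<Phi> ^^ k) x)))"
    by (intro sum.cong refl) (simp add: N_def in_count_across[OF \<alpha>] flip: across_first_side)
  finally have "(\<Sum>k<n. N (first_side ((turn \<Phi> ^^ k) x)) + N (second_side ((turn \<Phi> ^^ k) x))) = 0"
    by (simp add: sum.distrib sum_negf)
  then have "(\<Sum>k<n. frame_sign x * (N (first_side ((turn \<Phi> ^^ k) x)) + N (second_side ((turn \<Phi> ^^ k) x)))) = 0"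
    by (simp flip: sum_distrib_left)
  moreover have "curve_weight \<alpha> (first_side ((turn \<Phi> ^^ k) x)) - curve_weight \<alpha> (second_side ((turn \<Phi> ^^ k) x)) =
      frame_sign x * (N (first_side ((turn \<Phi> ^^ k) x)) + N (second_side ((turn \<Phi> ^^ k) x)))" for k
    unfolding curve_weight_turn[OF \<alpha> funpow_turn_in_frames[OF x]] frame_sign_funpow_turn[OF x] N_def
    by (simp add: algebra_simps)
  ultimately show ?thesis by simp
qed

end

section \<open>Intersection numbers\<close>

text \<open>Row \<open>0\<close> is a unit vector, so only permutations fixing \<open>0\<close>
  contribute.\<close>

lemma det_row_axis:
  fixes A :: "real ^ 4 ^ 4"
  assumes "A $ 0 = axis 0 1"
  shows "det A = A$1$1 * (A$2$2 * A$3$3 - A$2$3 * A$3$2)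
    - A$1$2 * (A$2$1 * A$3$3 - A$2$3 * A$3$1) + A$1$3 * (A$2$1 * A$3$2 - A$2$2 * A$3$1)"
proof -
  have f: "finite {2,3::4}" "1 \<notin> {2,3::4}" "finite {3::4}" "2 \<notin> {3::4}" by auto
  have A0: "A $ 0 $ j = (if j = 0 then 1 else 0)" for j using assms by (simp add: axis_def)
  have "det A = (\<Sum>p | p permutes {1, 2, 3}. of_int (sign p) * (\<Prod>i\<in>UNIV. A $ i $ p i))"
    unfolding det_def
  proof (rule sum.mono_neutral_right)
    show "\<forall>p \<in> {p. p permutes UNIV} - {p. p permutes {1, 2, 3}}. of_int (sign p) * (\<Prod>i\<in>UNIV. A $ i $ p i) = 0"
    proof
      fix p :: "4 \<Rightarrow> 4" assume p: "p \<in> {p. p permutes UNIV} - {p. p permutes {1, 2, 3}}"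
      have "p 0 \<noteq> 0"
      proof
        assume p0: "p 0 = 0"
        have "p permutes {1, 2, 3}"
        proof (rule permutes_superset)
          show "p permutes UNIV" using p by simp
          show "p x = x" if "x \<in> UNIV - {1, 2, 3}" for x
            using that label_cases[of x] p0 by auto
        qed
        then show False using p by simp
      qed
      then have "A $ 0 $ p 0 = 0" by (simp add: A0)
      then have "(\<Prod>i\<in>UNIV. A $ i $ p i) = 0" by (intro prod_zero) auto
      then show "of_int (sign p) * (\<Prod>i\<in>UNIV. A $ i $ p i) = 0" by simp
    qed
  next
    show "{p. p permutes {1, 2, 3 :: 4}} \<subseteq> {p. p permutes UNIV}"
      by (auto intro: permutes_subset)
  qed simp
  also have "\<dots> = (\<Sum>p | p permutes {1, 2, 3}. of_int (sign p) * (A $ 0 $ p 0 * (A $ 1 $ p 1 * (A $ 2 $ p 2 * A $ 3 $ p 3))))"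
    unfolding UNIV_labels by simp
  also have "\<dots> = A$1$1 * (A$2$2 * A$3$3 - A$2$3 * A$3$2)
    - A$1$2 * (A$2$1 * A$3$3 - A$2$3 * A$3$1) + A$1$3 * (A$2$1 * A$3$2 - A$2$2 * A$3$1)"
    unfolding sum_over_permutations_insert[OF f(1,2)] sum_over_permutations_insert[OF f(3,4)] permutes_sing
    by (simp add: A0 sign_swap_id permutation_swap_id sign_compose permutation_compose Transposition.transpose_def)
      (simp add: algebra_simps)
  finally show ?thesis .
qed

text \<open>Permuting the columns by \<open>tuple4 a i j x\<close> makes the row of \<open>a\<close>
  the first unit vector, at the cost of the sign of the permutation.\<close>

lemma orient_frame:
  assumes d: "distinct [a, i, j, x]"
  shows "orient a P Q R = of_int (label_sign a i j x) *
    (P $ i * (Q $ j * R $ x - Q $ x * R $ j) - P $ j * (Q $ i * R $ x - Q $ x * R $ i)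
     + P $ x * (Q $ i * R $ j - Q $ j * R $ i))"
proof -
  define p where "p = tuple4 a i j x"
  define A :: "real ^ 4 ^ 4" where "A = (\<chi> r. tuple4 (axis a 1) P Q R r)"
  define B :: "real ^ 4 ^ 4" where "B = (\<chi> r c. A $ r $ p c)"
  have "bij p" unfolding p_def by (rule bij_tuple4[OF d])
  then have "p permutes UNIV" by (auto intro: bij_imp_permutes)
  then have "det B = of_int (sign p) * det A"
    unfolding B_def by (rule det_permute_columns)
  moreover have "(of_int (sign p) :: real) * of_int (sign p) = 1"
    unfolding p_def by (simp flip: of_int_mult)
  ultimately have det_A: "det A = of_int (sign p) * det B" by algebra
  have "p c = a \<longleftrightarrow> c = 0" for c
    using \<open>bij p\<close> by (metis bij_is_inj inj_eq p_def tuple4_simps(1))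
  then have "B $ 0 = axis 0 1"
    by (simp add: B_def A_def vec_eq_iff axis_def)
  then have "det B = B$1$1 * (B$2$2 * B$3$3 - B$2$3 * B$3$2)
    - B$1$2 * (B$2$1 * B$3$3 - B$2$3 * B$3$1) + B$1$3 * (B$2$1 * B$3$2 - B$2$2 * B$3$1)"
    by (rule det_row_axis)
  then show ?thesis using det_A by (simp add: orient_def A_def B_def p_def)
qed

definition on_side :: "'t \<times> 4 \<times> 4 \<Rightarrow> real ^ 4 \<Rightarrow> bool" where
  "on_side = (\<lambda>(\<sigma>, a, i) P. (\<Sum>b\<in>UNIV. P $ b) = 1 \<and> (\<forall>b. if b \<in> {a, i} then P $ b = 0 else P $ b > 0))"

text \<open>The sign of the displacement from \<open>P\<close> to \<open>R\<close> along the side, directed counterclockwise.\<close>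

definition side_order :: "'t \<times> 4 \<times> 4 \<Rightarrow> real ^ 4 \<Rightarrow> real ^ 4 \<Rightarrow> real" where
  "side_order = (\<lambda>(\<sigma>, a, i) P R.
     sgn (\<Sum>(j, x) | distinct [a, i, j, x]. of_int (label_sign a i j x) * (R $ x - P $ x)))"

lemma side_order_eq:
  assumes "distinct [a, i, j, x]"
  shows "side_order (\<sigma>, a, i) P R =
    of_int (label_sign a i j x) * sgn ((R $ x - P $ x) - (R $ j - P $ j))"
proof -
  have "distinct [a, j, x, i]" "(j, x) \<noteq> (x, j)" using assms by auto
  then have "side_order (\<sigma>, a, i) P R =
      sgn (of_int (label_sign a i j x) * ((R $ x - P $ x) - (R $ j - P $ j)))"
    unfolding side_order_def
    by (simp add: remaining_pairs(2) label_sign_transpose(3)[OF assms] algebra_simps del: distinct.simps)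
  then show ?thesis using label_sign_cases[of a i j x] by (auto simp: sgn_mult)
qed

lemma on_side_coords:
  assumes "on_side (\<sigma>, a, i) P" "distinct [a, i, j, x]"
  shows "P $ a = 0" "P $ i = 0" "P $ j > 0" "P $ x > 0" "P $ x = 1 - P $ j"
proof -
  show 1: "P $ a = 0" "P $ i = 0" "P $ j > 0" "P $ x > 0"
    using assms unfolding on_side_def by (auto split: if_splits)
  show "P $ x = 1 - P $ j"
    using assms sum_labels[OF assms(2), of "\<lambda>b. P $ b"] 1 unfolding on_side_def by simp
qed

lemma on_side_eqI:
  assumes P: "on_side (\<sigma>, a, i) P" and R: "on_side (\<sigma>, a, i) R" and d: "distinct [a, i, j, x]" and eq: "P $ j = R $ j"
  shows "P = R"
proof -
  have "P $ b = R $ b" for b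
    by (rule label_exhaust[OF d, of b]) (use on_side_coords[OF P d] on_side_coords[OF R d] eq in simp_all)
  then show ?thesis by (simp add: vec_eq_iff)
qed

definition side_term :: "'t \<times> 4 \<times> 4 \<Rightarrow> real ^ 4 \<Rightarrow> 't \<times> 4 \<times> 4 \<Rightarrow> real ^ 4 \<Rightarrow> real" where
  "side_term s P t R = (if s = t then side_order s P R else 0)"

text \<open>The segment from \<open>P\<close> to \<open>Q\<close> separates the corner
  \<open>x\<close> from the opposite side. So the sign is constant for \<open>R\<close> on that
  side, and for \<open>R\<close> on the side of \<open>P\<close> or of \<open>Q\<close> it is given
  by the order of the two points there.\<close>

lemma sgn_orient:
  assumes d: "distinct [a, i, j, x]"
    and P: "on_side (\<sigma>, a, i) P" and Q: "on_side (\<sigma>, a, j) Q" and R: "on_side (\<sigma>, a, y) R"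
    and "y \<noteq> a" "R \<noteq> P" "R \<noteq> Q"
  shows "sgn (orient a P Q R) = of_int (label_sign a i j x) * (if y = x then 1 else 0)
    - side_term (\<sigma>, a, i) P (\<sigma>, a, y) R + side_term (\<sigma>, a, j) Q (\<sigma>, a, y) R"
    and "orient a P Q R \<noteq> 0"
proof -
  define e :: real where "e = of_int (label_sign a i j x)"
  have e: "e = 1 \<or> e = -1" using label_sign_cases[of a i j x] by (auto simp: e_def)
  then have sgn_e: "sgn e = e" "e \<noteq> 0" by auto
  have dj: "distinct [a, j, x, i]" and dx: "distinct [a, x, i, j]" using d by auto
  have ne: "i \<noteq> j" "j \<noteq> i" "i \<noteq> x" "x \<noteq> i" "j \<noteq> x" "x \<noteq> j" using d by auto
  note p = on_side_coords[OF P d] and q = on_side_coords[OF Q dj]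
  have o: "orient a P Q R = e *
     (- (P $ j * (Q $ i * R $ x - Q $ x * R $ i)) + P $ x * (Q $ i * R $ j))"
    using orient_frame[OF d, of P Q R] p q by (simp add: e_def)
  consider "y = x" | "y = i" | "y = j"
    using label_exhaust[OF d, of y] assms(5) by blast
  then have "sgn (orient a P Q R) = e * (if y = x then 1 else 0)
    - side_term (\<sigma>, a, i) P (\<sigma>, a, y) R + side_term (\<sigma>, a, j) Q (\<sigma>, a, y) R \<and> orient a P Q R \<noteq> 0"
  proof cases
    case 1
    note r = on_side_coords[OF R[unfolded 1] dx]
    have "P $ j * (Q $ x * R $ i) > 0" "P $ x * (Q $ i * R $ j) > 0"
      using p q r by simp_all
    then have "(- (P $ j * (Q $ i * R $ x - Q $ x * R $ i)) + P $ x * (Q $ i * R $ j)) > 0"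
      using r by simp
    then show ?thesis using 1 ne sgn_e by (simp add: o sgn_mult side_term_def)
  next
    case 2
    note r = on_side_coords[OF R[unfolded 2] d]
    have "orient a P Q R = e * (Q $ i * (R $ j - P $ j))"
      using p q r unfolding o by algebra
    moreover have "side_order (\<sigma>, a, i) P R = e * sgn (2 * (P $ j - R $ j))"
    proof -
      have "(R $ x - P $ x) - (R $ j - P $ j) = 2 * (P $ j - R $ j)" using p(5) r(5) by simp
      then show ?thesis unfolding side_order_eq[OF d] e_def by (simp only:)
    qed
    moreover have "sgn (2 * (P $ j - R $ j)) = - sgn (R $ j - P $ j)"
      by (simp add: sgn_mult sgn_if)
    moreover have "R $ j \<noteq> P $ j"
      using on_side_eqI[OF R[unfolded 2] P d] assms(6) by blast
    ultimately show ?thesis using 2 ne q sgn_e by (simp add: sgn_mult side_term_def)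
  next
    case 3
    note r = on_side_coords[OF R[unfolded 3] dj]
    have "orient a P Q R = e * (P $ j * (R $ i - Q $ i))"
      using p q r unfolding o by algebra
    moreover have "side_order (\<sigma>, a, j) Q R = e * sgn (2 * (R $ i - Q $ i))"
    proof -
      have "(R $ i - Q $ i) - (R $ x - Q $ x) = 2 * (R $ i - Q $ i)" using q(5) r(5) by simp
      then show ?thesis unfolding side_order_eq[OF dj] e_def label_sign_rotate[OF d] by (simp only:)
    qed
    moreover have "sgn (2 * (R $ i - Q $ i)) = sgn (R $ i - Q $ i)"
      by (simp add: sgn_if)
    moreover have "R $ i \<noteq> Q $ i"
    proof
      assume "R $ i = Q $ i"
      then have "R $ x = Q $ x" using q r by simp
      then show False using on_side_eqI[OF R[unfolded 3] Q dj] assms(7) by blast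
    qed
    ultimately show ?thesis using 3 ne p(3) sgn_e
      by (simp add: sgn_mult side_term_def del: right_diff_distrib_numeral)
  qed
  then show "sgn (orient a P Q R) = of_int (label_sign a i j x) * (if y = x then 1 else 0)
    - side_term (\<sigma>, a, i) P (\<sigma>, a, y) R + side_term (\<sigma>, a, j) Q (\<sigma>, a, y) R"
    "orient a P Q R \<noteq> 0"
    unfolding e_def by blast+
qed

text \<open>In general position both signs of \<open>orient\<close> are nonzero, and the crossing
  sign is half their difference.\<close>

lemma crossing_sign_eq:
  assumes d: "distinct [a, i, j, x]"
    and P: "on_side (\<sigma>, a, i) P" and Q: "on_side (\<sigma>, a, j) Q"
    and P': "on_side (\<sigma>, a, i') P'" and Q': "on_side (\<sigma>, a, j') Q'"
    and "i' \<noteq> a" "j' \<noteq> a" "{P, Q} \<inter> {P', Q'} = {}"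
  shows "2 * of_int (crossing_sign a P Q P' Q') =
    of_int (label_sign a i j x) * ((if j' = x then 1 else 0) - (if i' = x then 1 else 0))
    + side_term (\<sigma>, a, i) P (\<sigma>, a, i') P' + side_term (\<sigma>, a, j) Q (\<sigma>, a, j') Q'
    - side_term (\<sigma>, a, i) P (\<sigma>, a, j') Q' - side_term (\<sigma>, a, j) Q (\<sigma>, a, i') P'"
proof -
  have ne: "P' \<noteq> P" "P' \<noteq> Q" "Q' \<noteq> P" "Q' \<noteq> Q" using assms(8) by auto
  note 1 = sgn_orient[OF d P Q P' assms(6) ne(1,2)]
  note 2 = sgn_orient[OF d P Q Q' assms(7) ne(3,4)]
  have "2 * real_of_int (crossing_sign a P Q P' Q') = sgn (orient a P Q Q') - sgn (orient a P Q P')"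
    using 1(2) 2(2) by (auto simp: crossing_sign_def sgn_if)
  also have "\<dots> = of_int (label_sign a i j x) * ((if j' = x then 1 else 0) - (if i' = x then 1 else 0))
    + side_term (\<sigma>, a, i) P (\<sigma>, a, i') P' + side_term (\<sigma>, a, j) Q (\<sigma>, a, j') Q'
    - side_term (\<sigma>, a, i) P (\<sigma>, a, j') Q' - side_term (\<sigma>, a, j) Q (\<sigma>, a, i') P'"
    unfolding 1(1) 2(1) by (simp add: algebra_simps)
  finally show ?thesis .
qed

context triangulation
begin

text \<open>This rewrites a point of the side \<open>across \<Phi> s\<close> in the coordinates of
  the triangle of \<open>s\<close>.\<close>

definition pull :: "'t \<times> 4 \<times> 4 \<Rightarrow> real ^ 4 \<Rightarrow> real ^ 4" where
  "pull = (\<lambda>(\<sigma>, a, i) P. \<chi> b. P $ (snd (\<Phi> \<sigma> i) b))"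

lemma pull_pull: "pull (across \<Phi> s) (pull s P) = P"
proof -
  obtain \<sigma> a i where s: "s = (\<sigma>, a, i)" by (cases s)
  obtain \<tau> \<pi> where p: "\<Phi> \<sigma> i = (\<tau>, \<pi>)" by fastforce
  have "\<pi> (inv \<pi> b) = b" for b using pairing(1)[OF p] by (simp add: bij_is_surj surj_f_inv_f)
  then show ?thesis unfolding s across_eq[OF p] pull_def
    by (simp add: p pairing(3)[OF p] vec_eq_iff)
qed

lemma on_side_pull:
  assumes "on_side (across \<Phi> s) P"
  shows "on_side s (pull s P)"
proof -
  obtain \<sigma> a i where s: "s = (\<sigma>, a, i)" by (cases s)
  obtain \<tau> \<pi> where p: "\<Phi> \<sigma> i = (\<tau>, \<pi>)" by fastforce
  have "(\<Sum>b\<in>UNIV. P $ \<pi> b) = (\<Sum>b\<in>UNIV. P $ b)"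
    by (rule sum.reindex_bij_betw[OF pairing(1)[OF p]])
  then show ?thesis using assms unfolding s across_eq[OF p] on_side_def pull_def
    by (auto simp: p pairing_eq_iff[OF p])
qed

text \<open>Adjacent triangles direct their common side oppositely, because the pairing is
  odd.\<close>

lemma side_term_across:
  assumes "s = (\<sigma>, a, i)" "i \<noteq> a"
  shows "side_term (across \<Phi> s) P (across \<Phi> t) R = - side_term s (pull s P) t (pull t R)"
proof (cases "s = t")
  case True
  obtain \<tau> \<pi> where p: "\<Phi> \<sigma> i = (\<tau>, \<pi>)" by fastforce
  obtain j x where d: "distinct [a, i, j, x]" using obtain_labels2[of a i] assms by auto
  then have d': "distinct [\<pi> a, \<pi> i, \<pi> j, \<pi> x]" by (auto simp: pairing_eq_iff[OF p])
  have "side_order (across \<Phi> s) P R = - side_order s (pull s P) (pull s R)"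
    unfolding assms across_eq[OF p] side_order_eq[OF d] side_order_eq[OF d'] pairing_label_sign[OF p d]
    by (simp add: pull_def p)
  then show ?thesis using True by (simp add: side_term_def)
next
  case False
  then show ?thesis using inj_across by (simp add: side_term_def inj_eq)
qed

lemma realization_curve:
  assumes \<alpha>: "closed_normal_curve \<Phi> v \<alpha>" and x: "realization \<alpha> x" and k: "k < length \<alpha>"
  shows "on_side (in_side (\<alpha> ! k)) (x k)"
    and "endpoint \<Phi> \<alpha> x k = pull (out_side (\<alpha> ! k)) (x (Suc k mod length \<alpha>))"
    and "on_side (out_side (\<alpha> ! k)) (endpoint \<Phi> \<alpha> x k)"
proof -
  have in_side: "on_side (in_side (\<alpha> ! k)) (x k)" if "k < length \<alpha>" for k
    using x that unfolding realization_def on_side_def in_side_def by simp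
  from this[OF k] show "on_side (in_side (\<alpha> ! k)) (x k)" .
  show *: "endpoint \<Phi> \<alpha> x k = pull (out_side (\<alpha> ! k)) (x (Suc k mod length \<alpha>))"
    by (simp add: endpoint_def pull_def out_side_def)
  have "length \<alpha> > 0" using k by linarith
  then have "Suc k mod length \<alpha> < length \<alpha>" by simp
  from in_side[OF this] show "on_side (out_side (\<alpha> ! k)) (endpoint \<Phi> \<alpha> x k)"
    unfolding * closed_normal_curve_across[OF \<alpha> k, symmetric] by (rule on_side_pull)
qed

text \<open>
  The crossings are counted by the positions of the segments up to contributions of pairs of points
  on a common side, which cancel between the two triangles at that side.
\<close>

lemma crossing_count_eq:
  assumes \<alpha>: "closed_normal_curve \<Phi> v \<alpha>" and \<beta>: "closed_normal_curve \<Phi> w \<beta>"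
    and x: "realization \<alpha> x" and y: "realization \<beta> y" and gp: "general_position \<Phi> \<alpha> x \<beta> y"
  shows "2 * crossing_count \<Phi> \<alpha> x \<beta> y =
    (\<Sum>l<length \<beta>. curve_weight \<alpha> (out_side (\<beta> ! l)) - curve_weight \<alpha> (in_side (\<beta> ! l)))"
proof -
  let ?m = "length \<alpha>" and ?n = "length \<beta>"
  let ?is = "\<lambda>k. in_side (\<alpha> ! k)" and ?os = "\<lambda>k. out_side (\<alpha> ! k)"
  let ?is' = "\<lambda>l. in_side (\<beta> ! l)" and ?os' = "\<lambda>l. out_side (\<beta> ! l)"
  let ?E = "endpoint \<Phi> \<alpha> x" and ?E' = "endpoint \<Phi> \<beta> y"
  define S where "S k = Suc k mod ?m" for k
  define S' where "S' l = Suc l mod ?n" for l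
  \<comment> \<open>The letters tell which endpoints are compared, entry or exit, first for
    \<open>\<alpha>\<close> and then for \<open>\<beta>\<close>.\<close>
  define Tii where "Tii k l = side_term (?is k) (x k) (?is' l) (y l)" for k l
  define Too where "Too k l = side_term (?os k) (?E k) (?os' l) (?E' l)" for k l
  define Tio where "Tio k l = side_term (?is k) (x k) (?os' l) (?E' l)" for k l
  define Toi where "Toi k l = side_term (?os k) (?E k) (?is' l) (y l)" for k l
  define W where "W k l = seg_sign (\<alpha> ! k) * ((if far_side (\<alpha> ! k) = ?os' l then 1 else 0)
      - (if far_side (\<alpha> ! k) = ?is' l then 1 else 0))" for k l
  define C where "C k l = (if same_triangle (\<alpha> ! k) (\<beta> ! l)
        then crossing_sign (seg_vertex (\<alpha> ! k)) (x k) (?E k) (y l) (?E' l) else 0)" for k l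
  have seg: "distinct [seg_vertex (\<alpha> ! k), seg_in (\<alpha> ! k), seg_out (\<alpha> ! k), isolated (\<alpha> ! k)]" if "k < ?m" for k
    using closed_normal_curve_segment(1)[OF \<alpha>] that by simp
  have seg': "distinct [seg_vertex (\<beta> ! l), seg_in (\<beta> ! l), seg_out (\<beta> ! l), isolated (\<beta> ! l)]" if "l < ?n" for l
    using closed_normal_curve_segment(1)[OF \<beta>] that by simp
  have pair: "2 * of_int (C k l) = of_int (W k l) + Tii k l + Too k l - Tio k l - Toi k l"
    if k: "k < ?m" and l: "l < ?n" for k l
  proof (cases "same_triangle (\<alpha> ! k) (\<beta> ! l)")
    case True
    then have eq: "seg_tet (\<beta> ! l) = seg_tet (\<alpha> ! k)" "seg_vertex (\<beta> ! l) = seg_vertex (\<alpha> ! k)"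
      by (simp_all add: same_triangle_def)
    have dis: "{x k, ?E k} \<inter> {y l, ?E' l} = {}"
      using gp True k l unfolding general_position_def by blast
    note r = realization_curve[OF \<alpha> x k] realization_curve[OF \<beta> y l]
    have "seg_in (\<beta> ! l) \<noteq> seg_vertex (\<alpha> ! k)" "seg_out (\<beta> ! l) \<noteq> seg_vertex (\<alpha> ! k)"
      using seg'[OF l] eq by auto
    from crossing_sign_eq[OF seg[OF k] r(1,3,4,6)[unfolded in_side_def out_side_def eq] this dis]
    show ?thesis using True
      by (simp add: C_def W_def Tii_def Too_def Tio_def Toi_def far_side_def in_side_def out_side_def
          seg_sign_def eq eq_commute[of "isolated (\<alpha> ! k)"])
  next
    case False
    then show ?thesis
      by (auto simp: C_def W_def Tii_def Too_def Tio_def Toi_def far_side_def in_side_def out_side_def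
          same_triangle_def side_term_def)
  qed
  have out_ne: "seg_out (\<alpha> ! k) \<noteq> seg_vertex (\<alpha> ! k)" if "k < ?m" for k using seg[OF that] by auto
  \<comment> \<open>Exit points are the entry points of the successors, seen from the adjacent
    triangle, where the order along the side is reversed.\<close>
  have "Tii (S k) (S' l) = - Too k l" if k: "k < ?m" and l: "l < ?n" for k l
    using side_term_across[OF out_side_def out_ne[OF k], of _ "?os' l"]
    unfolding Tii_def Too_def S_def S'_def closed_normal_curve_across[OF \<alpha> k, symmetric]
      closed_normal_curve_across[OF \<beta> l, symmetric] realization_curve(2)[OF \<alpha> x k] realization_curve(2)[OF \<beta> y l]
    by simp
  moreover have "Tio (S k) l = - Toi k (S' l)" if k: "k < ?m" and l: "l < ?n" for k l
  proof -
    have "side_term (across \<Phi> (?os k)) (x (S k)) (across \<Phi> (across \<Phi> (?os' l))) (?E' l) =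
        - side_term (?os k) (pull (?os k) (x (S k))) (across \<Phi> (?os' l)) (pull (across \<Phi> (?os' l)) (?E' l))"
      by (rule side_term_across[OF out_side_def out_ne[OF k]])
    then show ?thesis
      unfolding Tio_def Toi_def S_def S'_def closed_normal_curve_across[OF \<alpha> k, symmetric]
        closed_normal_curve_across[OF \<beta> l, symmetric] realization_curve(2)[OF \<alpha> x k] realization_curve(2)[OF \<beta> y l]
        pull_pull across_across .
  qed
  ultimately have shift: "(\<Sum>k<?m. \<Sum>l<?n. Tii (S k) (S' l)) = - (\<Sum>k<?m. \<Sum>l<?n. Too k l)"
    "(\<Sum>k<?m. \<Sum>l<?n. Tio (S k) l) = - (\<Sum>k<?m. \<Sum>l<?n. Toi k (S' l))"
    by (simp_all add: sum_negf)
  have cyc: "(\<Sum>k<?m. f (S k)) = (\<Sum>k<?m. f k)" "(\<Sum>l<?n. f (S' l)) = (\<Sum>l<?n. f l)" for f :: "nat \<Rightarrow> real"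
    unfolding S_def S'_def by (rule sum_cyclic)+
  have cancel: "(\<Sum>k<?m. \<Sum>l<?n. Tii k l) = - (\<Sum>k<?m. \<Sum>l<?n. Too k l)"
    "(\<Sum>k<?m. \<Sum>l<?n. Tio k l) = - (\<Sum>k<?m. \<Sum>l<?n. Toi k l)"
    using shift cyc(1)[of "\<lambda>k. \<Sum>l<?n. Tii k l"] cyc(1)[of "\<lambda>k. \<Sum>l<?n. Tio k l"] by (simp_all add: cyc(2))
  have "2 * (of_int (\<Sum>k<?m. \<Sum>l<?n. C k l) :: real) = (\<Sum>k<?m. \<Sum>l<?n. 2 * of_int (C k l))"
    by (simp add: sum_distrib_left)
  also have "\<dots> = (\<Sum>k<?m. \<Sum>l<?n. of_int (W k l) + Tii k l + Too k l - Tio k l - Toi k l)"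
    by (intro sum.cong refl pair) simp_all
  also have "\<dots> = (\<Sum>k<?m. \<Sum>l<?n. of_int (W k l))"
    using cancel by (simp add: sum.distrib sum_subtractf)
  finally have "(of_int (2 * (\<Sum>k<?m. \<Sum>l<?n. C k l)) :: real) = of_int (\<Sum>k<?m. \<Sum>l<?n. W k l)"
    by simp
  then have "2 * (\<Sum>k<?m. \<Sum>l<?n. C k l) = (\<Sum>k<?m. \<Sum>l<?n. W k l)"
    by (simp only: of_int_eq_iff)
  also have "\<dots> = (\<Sum>l<?n. \<Sum>k<?m. W k l)" by (rule sum.swap)
  also have "\<dots> = (\<Sum>l<?n. curve_weight \<alpha> (?os' l) - curve_weight \<alpha> (?is' l))"
    unfolding W_def curve_weight_def sum_subtractf[symmetric] by (intro sum.cong refl) auto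
  finally show ?thesis unfolding crossing_count_def C_def .
qed

text \<open>The half in \<open>curve_form\<close> removes the factor 2 of
  \<open>crossing_count_eq\<close>; hence the period depends only on the curves, not on the
  realizations.\<close>

lemma sum_curve_form:
  assumes \<alpha>: "closed_normal_curve \<Phi> v \<alpha>" and \<beta>: "closed_normal_curve \<Phi> w \<beta>"
    and "has_intersection_number \<Phi> \<alpha> \<beta> n"
  shows "(\<Sum>t\<leftarrow>curve_path \<beta>. curve_form \<alpha> t) = of_int n"
proof -
  obtain x y where "realization \<alpha> x" "realization \<beta> y" "general_position \<Phi> \<alpha> x \<beta> y"
    and n: "crossing_count \<Phi> \<alpha> x \<beta> y = n"
    using assms(3) unfolding has_intersection_number_def by blast
  then have "2 * n = (\<Sum>l<length \<beta>. curve_weight \<alpha> (out_side (\<beta> ! l)) - curve_weight \<alpha> (in_side (\<beta> ! l)))"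
    using crossing_count_eq[OF \<alpha> \<beta>] by blast
  then have "(of_int (2 * n) :: complex) =
      of_int (\<Sum>l<length \<beta>. curve_weight \<alpha> (out_side (\<beta> ! l)) - curve_weight \<alpha> (in_side (\<beta> ! l)))"
    by simp
  then show ?thesis unfolding curve_form_def sum_curve_jump[OF \<beta>]
    by (simp add: diff_divide_distrib[symmetric] sum_divide_distrib[symmetric] mult.commute)
qed

end

section \<open>Paths in the vertex links\<close>

fun source :: "'t \<times> 4 \<times> 4 \<Rightarrow> 't \<times> 4" where
  "source (\<sigma>, a, i) = (\<sigma>, a)"

context triangulation
begin

abbreviation target :: "'t \<times> 4 \<times> 4 \<Rightarrow> 't \<times> 4" where
  "target s \<equiv> source (across \<Phi> s)"

lemma link_path_Cons:
  "link_path \<Phi> t (s # p) t' \<longleftrightarrow> t = source s \<and> snd (snd s) \<noteq> fst (snd s) \<and> link_path \<Phi> (target s) p t'"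
  by (cases s) (simp split: prod.splits)

lemma link_path_append:
  "link_path \<Phi> t (p @ q) t'' \<longleftrightarrow> (\<exists>t'. link_path \<Phi> t p t' \<and> link_path \<Phi> t' q t'')"
  by (induction p arbitrary: t) (simp_all add: link_path_Cons del: link_path.simps(2))

lemma link_path_reverse: "link_path \<Phi> t p t' \<Longrightarrow> link_path \<Phi> t' (reverse_path \<Phi> p) t"
proof (induction p arbitrary: t)
  case (Cons s p)
  obtain \<sigma> a i where s: "s = (\<sigma>, a, i)" by (cases s)
  obtain \<tau> \<pi> where p: "\<Phi> \<sigma> i = (\<tau>, \<pi>)" by fastforce
  have "link_path \<Phi> (target s) [across \<Phi> s] t"
    using Cons.prems unfolding link_path_Cons across_across
    by (simp add: s across_eq[OF p] pairing_eq_iff[OF p])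
  moreover have "link_path \<Phi> t' (reverse_path \<Phi> p) (target s)"
    using Cons.IH Cons.prems unfolding link_path_Cons by blast
  moreover have "reverse_path \<Phi> (s # p) = reverse_path \<Phi> p @ [across \<Phi> s]"
    by (simp add: reverse_path_def)
  ultimately show ?case by (simp only: link_path_append) blast
qed (simp add: reverse_path_def)

lemma sum_reverse_path: "(\<Sum>s\<leftarrow>reverse_path \<Phi> p. jump q s) = - (\<Sum>s\<leftarrow>p. jump q s)"
  by (induction p) (simp_all add: reverse_path_def jump_across)

text \<open>A gluing of one-vertex simplices is a single step across a side of the link, so chains
  of gluings lift to paths.\<close>

lemma link_connected:
  assumes v: "v \<in> vertices \<Phi>" and t: "t \<in> link_triangles v" and t': "t' \<in> link_triangles v"
  shows "\<exists>p. link_path \<Phi> t p t'"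
proof -
  obtain \<sigma> a where t_eq: "t = (\<sigma>, a)" by (cases t)
  obtain \<tau> b where t'_eq: "t' = (\<tau>, b)" by (cases t')
  have path: "\<exists>b p. snd Y = {b} \<and> link_path \<Phi> (\<sigma>, a) p (fst Y, b)"
    if "((\<sigma>, {a}), Y) \<in> (simplex_glue \<Phi>)\<^sup>*" for Y
    using that
  proof (induction rule: rtrancl_induct)
    case base
    have "link_path \<Phi> (\<sigma>, a) [] (\<sigma>, a)" by simp
    then show ?case by (metis fst_conv snd_conv)
  next
    case (step Y Z)
    then obtain b p where b: "snd Y = {b}" "link_path \<Phi> (\<sigma>, a) p (fst Y, b)" by blast
    from step.hyps(2) b(1) obtain i \<tau> \<pi> where
      i: "i \<noteq> b" and p: "\<Phi> (fst Y) i = (\<tau>, \<pi>)" and Z: "Z = (\<tau>, {\<pi> b})"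
      unfolding simplex_glue_def by auto
    have "link_path \<Phi> (fst Y, b) [(fst Y, b, i)] (\<tau>, \<pi> b)"
      using i by (simp add: across_eq[OF p])
    then have "link_path \<Phi> (\<sigma>, a) (p @ [(fst Y, b, i)]) (fst Z, \<pi> b)"
      using b(2) Z unfolding link_path_append by auto
    then show ?case using Z by (metis snd_conv)
  qed
  have "((\<sigma>, {a}), (\<tau>, {b})) \<in> (simplex_glue \<Phi>)\<^sup>*"
    by (rule in_quotient_imp_in_rel[OF equiv_simplex_glue vertices_quotient[OF v]])
      (use t t' in \<open>simp add: t_eq t'_eq link_triangles_def\<close>)
  from path[OF this] show ?thesis by (auto simp: t_eq t'_eq)
qed

text \<open>Closedness of the dual cochain \<open>jump q\<close> at the vertices of the link, stated
  through differences inside the triangles.\<close>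

definition corner_closed :: "('t \<times> 4 \<times> 4 \<Rightarrow> complex) \<Rightarrow> bool" where
  "corner_closed q \<longleftrightarrow> (\<forall>x\<in>frames. \<forall>n. (turn \<Phi> ^^ n) x = x \<longrightarrow>
     (\<Sum>k<n. q (first_side ((turn \<Phi> ^^ k) x)) - q (second_side ((turn \<Phi> ^^ k) x))) = 0)"

text \<open>The loop enters each triangle through its second side and leaves through the first; a
  cyclic shift turns the jumps into the differences of \<open>corner_closed\<close>.\<close>

lemma sum_vertex_loop:
  assumes q: "corner_closed q" and c: "vertex_loop \<Phi> c"
  shows "(\<Sum>s\<leftarrow>c. jump q s) = 0"
proof -
  obtain \<sigma> a b c' d n where d: "distinct [a, b, c', d]"
    and n: "(turn \<Phi> ^^ n) (\<sigma>, a, b, c', d) = (\<sigma>, a, b, c', d)"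
    and c_eq: "c = map (\<lambda>k. case (turn \<Phi> ^^ k) (\<sigma>, a, b, c', d) of (\<tau>, a', b', c', d') \<Rightarrow> (\<tau>, a', c')) [0..<n]"
    using c unfolding vertex_loop_def by blast
  define x where "x = (\<sigma>, a, b, c', d)"
  have "(case y of (\<tau>, a', b', c', d') \<Rightarrow> (\<tau>, a', c')) = first_side y" for y :: "'t \<times> 4 \<times> 4 \<times> 4 \<times> 4"
    by (cases y) simp
  then have "(\<Sum>s\<leftarrow>c. jump q s) = (\<Sum>k<n. jump q (first_side ((turn \<Phi> ^^ k) x)))"
    unfolding c_eq x_def[symmetric] by (simp add: interv_sum_list_conv_sum_set_nat atLeast0LessThan o_def)
  also have "\<dots> = (\<Sum>k<n. q (first_side ((turn \<Phi> ^^ k) x))) - (\<Sum>k<n. q (second_side ((turn \<Phi> ^^ Suc k) x)))"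
    by (simp add: jump_def across_first_side sum_subtractf)
  also have "(\<Sum>k<n. q (second_side ((turn \<Phi> ^^ Suc k) x))) = (\<Sum>k<n. q (second_side ((turn \<Phi> ^^ k) x)))"
    by (rule sum_funpow_shift[of n "turn \<Phi>" x "\<lambda>y. q (second_side y)"]) (use n in \<open>simp add: x_def\<close>)
  finally show ?thesis
    using q d n unfolding corner_closed_def by (simp add: sum_subtractf x_def)
qed

lemma sum_homotopic_paths:
  assumes q: "corner_closed q" and "homotopic_paths \<Phi> t t' p p'"
  shows "(\<Sum>s\<leftarrow>p. jump q s) = (\<Sum>s\<leftarrow>p'. jump q s)"
proof -
  have elementary: "(\<Sum>s\<leftarrow>p. jump q s) = (\<Sum>s\<leftarrow>p'. jump q s)" if "elementary_homotopy \<Phi> t t' p p'" for p p'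
  proof -
    from that have "\<exists>u c w. ((\<exists>s. c = [s, across \<Phi> s]) \<or> vertex_loop \<Phi> c) \<and> p = u @ c @ w \<and> p' = u @ w"
      unfolding elementary_homotopy_def by (elim conjE)
    then obtain u c w where c: "(\<exists>s. c = [s, across \<Phi> s]) \<or> vertex_loop \<Phi> c"
      and "p = u @ c @ w" "p' = u @ w"
      by (elim exE conjE)
    moreover have "(\<Sum>s\<leftarrow>c. jump q s) = 0"
      using c sum_vertex_loop[OF q] by (auto simp: jump_across)
    ultimately show ?thesis by simp
  qed
  from assms(2) show ?thesis
    unfolding homotopic_paths_def
    by (induction rule: equivclp_induct) (auto dest: elementary)
qed

text \<open>Zero integrals over the generators extend to all loops at the base triangle, since
  connecting paths cancel with their reverses and homotopies preserve the integral. A primitive is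
  then found by integrating along paths.\<close>

lemma exact_form:
  assumes v: "v \<in> vertices \<Phi>" and q: "corner_closed q"
    and gen: "generates_fundamental_group \<Phi> v S"
    and S: "\<And>\<alpha>. \<alpha> \<in> S \<Longrightarrow> (\<Sum>s\<leftarrow>curve_path \<alpha>. jump q s) = 0"
  obtains f where "\<And>s. s \<in> link_flags v \<Longrightarrow> jump q s = jump (\<lambda>(\<sigma>, a, i). f (\<sigma>, a)) s"
proof -
  let ?I = "\<lambda>p. \<Sum>s\<leftarrow>p. jump q s"
  obtain t \<theta> where t: "t \<in> link_triangles v"
    and gen': "\<And>p. link_path \<Phi> t p t \<Longrightarrow> \<exists>ps. set ps \<subseteq> (\<lambda>\<alpha>. \<theta> \<alpha> @ curve_path \<alpha> @ reverse_path \<Phi> (\<theta> \<alpha>)) ` S \<union>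
         reverse_path \<Phi> ` (\<lambda>\<alpha>. \<theta> \<alpha> @ curve_path \<alpha> @ reverse_path \<Phi> (\<theta> \<alpha>)) ` S \<and>
         homotopic_paths \<Phi> t t p (concat ps)"
    using gen unfolding generates_fundamental_group_def Let_def by blast
  have closed: "?I p = 0" if p: "link_path \<Phi> t p t" for p
  proof -
    obtain ps where ps: "set ps \<subseteq> (\<lambda>\<alpha>. \<theta> \<alpha> @ curve_path \<alpha> @ reverse_path \<Phi> (\<theta> \<alpha>)) ` S \<union>
         reverse_path \<Phi> ` (\<lambda>\<alpha>. \<theta> \<alpha> @ curve_path \<alpha> @ reverse_path \<Phi> (\<theta> \<alpha>)) ` S"
      and hom: "homotopic_paths \<Phi> t t p (concat ps)"
      using gen'[OF p] by blast
    have "?I (\<theta> \<alpha> @ curve_path \<alpha> @ reverse_path \<Phi> (\<theta> \<alpha>)) = 0" if "\<alpha> \<in> S" for \<alpha>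
      using S[OF that] by (simp add: sum_reverse_path)
    then have "?I r = 0" if "r \<in> set ps" for r
      using ps that by (auto simp: sum_reverse_path simp del: map_append sum_list_append)
    then have "?I (concat ps) = 0" by (induction ps) auto
    then show ?thesis using sum_homotopic_paths[OF q hom] by simp
  qed
  define P where "P t' = (SOME p. link_path \<Phi> t p t')" for t'
  have P: "link_path \<Phi> t (P t') t'" if "t' \<in> link_triangles v" for t'
    unfolding P_def using someI_ex[OF link_connected[OF v t that]] .
  \<comment> \<open>\<open>jump\<close> subtracts the value at the target, hence the minus sign in
    the primitive.\<close>
  have "jump q s = jump (\<lambda>(\<sigma>, a, i). - ?I (P (\<sigma>, a))) s" if s: "s \<in> link_flags v" for s
  proof -
    have src: "source s' \<in> link_triangles v" if "s' \<in> link_flags v" for s'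
      using that by (cases s') (simp add: link_flags_def)
    have "link_path \<Phi> (source s) [s] (target s)"
      using s by (cases s) (auto simp: link_path_Cons link_flags_def simp del: link_path.simps(2))
    then have "link_path \<Phi> t (P (source s) @ [s] @ reverse_path \<Phi> (P (target s))) t"
      unfolding link_path_append
      using P[OF src[OF s]] link_path_reverse[OF P[OF src[OF across_link_flags[OF v s]]]] by blast
    from closed[OF this] have "jump q s = ?I (P (target s)) - ?I (P (source s))"
      by (simp add: sum_reverse_path algebra_simps)
    moreover have "(case s' of (\<sigma>, a, i) \<Rightarrow> - ?I (P (\<sigma>, a))) = - ?I (P (source s'))" for s'
      by (cases s') simp
    ultimately show ?thesis by (simp add: jump_def)
  qed
  then show ?thesis by (rule that)
qed

section \<open>Isotropy\<close>

lemma corner_closed_tri_potential: "balanced \<Phi> g \<Longrightarrow> corner_closed (tri_potential g)"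
  unfolding corner_closed_def using sum_turn_tri_potential by blast

lemma corner_closed_curve_weight:
  assumes "closed_normal_curve \<Phi> v \<alpha>"
  shows "corner_closed (\<lambda>t. of_int (curve_weight \<alpha> t))"
  unfolding corner_closed_def
proof (intro ballI allI impI)
  fix x :: "'t \<times> 4 \<times> 4 \<times> 4 \<times> 4" and n
  assume x: "x \<in> frames" "(turn \<Phi> ^^ n) x = x"
  have "(\<Sum>k<n. of_int (curve_weight \<alpha> (first_side ((turn \<Phi> ^^ k) x))) - of_int (curve_weight \<alpha> (second_side ((turn \<Phi> ^^ k) x)))) =
     (of_int (\<Sum>k<n. curve_weight \<alpha> (first_side ((turn \<Phi> ^^ k) x)) - curve_weight \<alpha> (second_side ((turn \<Phi> ^^ k) x))) :: complex)"
    by simp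
  then show "(\<Sum>k<n. of_int (curve_weight \<alpha> (first_side ((turn \<Phi> ^^ k) x))) -
      of_int (curve_weight \<alpha> (second_side ((turn \<Phi> ^^ k) x)))) = (0 :: complex)"
    unfolding sum_turn_curve_weight[OF assms x] by simp
qed

lemma corner_closed_diff: "corner_closed p \<Longrightarrow> corner_closed q \<Longrightarrow> corner_closed (\<lambda>t. p t - q t)"
  unfolding corner_closed_def by (simp add: sum_subtractf)

lemma corner_closed_sum:
  assumes "\<And>j. j \<in> J \<Longrightarrow> corner_closed (q j)"
  shows "corner_closed (\<lambda>t. \<Sum>j\<in>J. c j * q j t)"
  unfolding corner_closed_def
proof (intro ballI allI impI)
  fix x :: "'t \<times> 4 \<times> 4 \<times> 4 \<times> 4" and n
  assume x: "x \<in> frames" "(turn \<Phi> ^^ n) x = x"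
  let ?x = "\<lambda>k. (turn \<Phi> ^^ k) x"
  have "(\<Sum>k<n. (\<Sum>j\<in>J. c j * q j (first_side (?x k))) - (\<Sum>j\<in>J. c j * q j (second_side (?x k)))) =
      (\<Sum>k<n. \<Sum>j\<in>J. c j * (q j (first_side (?x k)) - q j (second_side (?x k))))"
    by (simp add: right_diff_distrib sum_subtractf)
  also have "\<dots> = (\<Sum>j\<in>J. c j * (\<Sum>k<n. q j (first_side (?x k)) - q j (second_side (?x k))))"
    by (subst sum.swap) (simp add: sum_distrib_left)
  also have "\<dots> = 0"
    by (intro sum.neutral) (use assms x in \<open>simp add: corner_closed_def\<close>)
  finally show "(\<Sum>k<n. (\<Sum>j\<in>J. c j * q j (first_side (?x k))) - (\<Sum>j\<in>J. c j * q j (second_side (?x k)))) = 0" .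
qed

text \<open>The two vanishing conditions enter differently: for \<open>f\<close> it leaves only
  duals of longitudes in its class, for \<open>g\<close> it makes the pairing with these duals
  zero.\<close>

lemma cup_product_eq_0:
  assumes v: "v \<in> vertices \<Phi>" and can: "canonical_generators \<Phi> v n l m"
    and f: "balanced \<Phi> f" and g: "balanced \<Phi> g"
    and fl: "\<And>j. j < n \<Longrightarrow> (\<Sum>t\<leftarrow>curve_path (l j). jump (tri_potential f) t) = 0"
    and gl: "\<And>j. j < n \<Longrightarrow> (\<Sum>t\<leftarrow>curve_path (l j). jump (tri_potential g) t) = 0"
  shows "(\<Sum>s\<in>link_flags v. jump (tri_potential f) s * side_form g s) = 0"
proof -
  have l: "closed_normal_curve \<Phi> v (l j)" and m: "closed_normal_curve \<Phi> v (m j)" if "j < n" for j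
    using can that unfolding canonical_generators_def by blast+
  have lm: "has_intersection_number \<Phi> (l j) (m k) (if j = k then 1 else 0)"
    and ll: "has_intersection_number \<Phi> (l j) (l k) 0" if "j < n" "k < n" for j k
    using can that unfolding canonical_generators_def by blast+
  have gen: "generates_fundamental_group \<Phi> v (l ` {..<n} \<union> m ` {..<n})"
    using can unfolding canonical_generators_def by blast
  define c where "c j = (\<Sum>t\<leftarrow>curve_path (m j). jump (tri_potential f) t)" for j
  \<comment> \<open>The coefficients are the meridian periods of \<open>f\<close>, halved because
    \<open>curve_form\<close> halves the weights. Since the longitudes are dual to the meridians and
    disjoint from each other homologically, all periods of \<open>q\<close> vanish.\<close>
  define q where "q t = tri_potential f t - (\<Sum>j<n. c j / 2 * of_int (curve_weight (l j) t))" for t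
  have jump_q: "jump q t = jump (tri_potential f) t - (\<Sum>j<n. c j * curve_form (l j) t)" for t
    unfolding q_def jump_def curve_form_def
    by (simp add: sum_subtractf right_diff_distrib sum_divide_distrib)
  have swap: "(\<Sum>t\<leftarrow>ts. \<Sum>j<n. h j t) = (\<Sum>j<n. \<Sum>t\<leftarrow>ts. h j t)" for ts and h :: "nat \<Rightarrow> 't \<times> 4 \<times> 4 \<Rightarrow> complex"
    by (induction ts) (simp_all add: sum.distrib)
  have "corner_closed q"
    unfolding q_def
    by (intro corner_closed_diff corner_closed_tri_potential f corner_closed_sum)
      (use corner_closed_curve_weight l in blast)
  moreover have "(\<Sum>t\<leftarrow>curve_path \<alpha>. jump q t) =
      (\<Sum>t\<leftarrow>curve_path \<alpha>. jump (tri_potential f) t) - (\<Sum>j<n. c j * (\<Sum>t\<leftarrow>curve_path \<alpha>. curve_form (l j) t))" for \<alpha>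
    unfolding jump_q by (simp add: sum_list_subtractf swap sum_list_const_mult)
  moreover have "(\<Sum>j<n. c j * (\<Sum>t\<leftarrow>curve_path (l k). curve_form (l j) t)) = 0" if "k < n" for k
    using that by (intro sum.neutral) (simp add: sum_curve_form[OF l l ll])
  moreover have "(\<Sum>j<n. c j * (\<Sum>t\<leftarrow>curve_path (m k). curve_form (l j) t)) = c k" if "k < n" for k
  proof -
    have "(\<Sum>j<n. c j * (\<Sum>t\<leftarrow>curve_path (m k). curve_form (l j) t)) = (\<Sum>j<n. if j = k then c j else 0)"
      using that by (intro sum.cong refl) (simp add: sum_curve_form[OF l m lm])
    then show ?thesis using that by simp
  qed
  ultimately have "\<And>\<alpha>. \<alpha> \<in> l ` {..<n} \<union> m ` {..<n} \<Longrightarrow> (\<Sum>t\<leftarrow>curve_path \<alpha>. jump q t) = 0"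
    using fl by (auto simp: c_def)
  from exact_form[OF v \<open>corner_closed q\<close> gen this]
  obtain F where F: "\<And>s. s \<in> link_flags v \<Longrightarrow> jump q s = jump (\<lambda>(\<sigma>, a, i). F (\<sigma>, a)) s" by blast
  have "(\<Sum>s\<in>link_flags v. jump (tri_potential f) s * side_form g s) =
      (\<Sum>s\<in>link_flags v. jump (\<lambda>(\<sigma>, a, i). F (\<sigma>, a)) s * side_form g s
        + (\<Sum>j<n. c j * (curve_form (l j) s * side_form g s)))"
  proof (intro sum.cong refl)
    fix s assume "s \<in> link_flags v"
    then have "jump (tri_potential f) s =
        jump (\<lambda>(\<sigma>, a, i). F (\<sigma>, a)) s + (\<Sum>j<n. c j * curve_form (l j) s)"
      using jump_q[of s] F by simp
    then show "jump (tri_potential f) s * side_form g s =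
        jump (\<lambda>(\<sigma>, a, i). F (\<sigma>, a)) s * side_form g s + (\<Sum>j<n. c j * (curve_form (l j) s * side_form g s))"
      by (simp add: distrib_right sum_distrib_right mult.assoc)
  qed
  also have "\<dots> = (\<Sum>j<n. c j * (\<Sum>s\<in>link_flags v. curve_form (l j) s * side_form g s))"
    unfolding sum.distrib sum_coboundary_side_form[OF v g]
    by (subst sum.swap) (simp add: sum_distrib_left)
  also have "\<dots> = 0"
    using sum_curve_form_side_form[OF v l g] gl by (intro sum.neutral) simp
  finally show ?thesis .
qed

lemma isotropy:
  assumes can: "\<And>v. v \<in> vertices \<Phi> \<Longrightarrow> canonical_generators \<Phi> v (n v) (l v) (m v)"
    and f: "balanced \<Phi> f" and g: "balanced \<Phi> g"
    and fl: "\<And>\<alpha>. \<alpha> \<in> longitudes \<Phi> n l \<Longrightarrow> (\<Sum>t\<leftarrow>curve_path \<alpha>. jump (tri_potential f) t) = 0"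
    and gl: "\<And>\<alpha>. \<alpha> \<in> longitudes \<Phi> n l \<Longrightarrow> (\<Sum>t\<leftarrow>curve_path \<alpha>. jump (tri_potential g) t) = 0"
  shows "(\<Sum>\<sigma>\<in>UNIV. f (\<sigma>, {0, 2}) * g (\<sigma>, {0, 1}) - f (\<sigma>, {0, 1}) * g (\<sigma>, {0, 2})) = 0"
proof -
  have "(\<Sum>s\<in>link_flags v. jump (tri_potential f) s * side_form g s) = 0" if v: "v \<in> vertices \<Phi>" for v
    using v by (intro cup_product_eq_0[OF v can[OF v] f g] fl gl) (auto simp: longitudes_def)
  then show ?thesis using sum_cup_product[OF f g] by simp
qed

end

section \<open>The derivative\<close>

definition quad_of :: "'t \<times> 4 set \<Rightarrow> 't quad" where
  "quad_of = (\<lambda>(\<sigma>, X). (\<sigma>, {X, - X}))"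

lemma quad_of_eq_iff: "quad_of (\<sigma>, X) = quad_of (\<sigma>, Y) \<longleftrightarrow> X = Y \<or> X = - Y"
  by (auto simp: quad_of_def doubleton_eq_iff)

lemma quads_in_image:
  fixes a :: 4
  shows "quads_in \<sigma> = (\<lambda>b. quad_of (\<sigma>, {a, b})) ` (- {a})" "inj_on (\<lambda>b. quad_of (\<sigma>, {a, b})) (- {a})"
proof -
  have pair: "\<exists>b\<in>- {a}. X = {a, b}" if "card X = 2" "a \<in> X" for X :: "4 set"
    using that by (auto simp: card_2_iff)
  have card_compl: "card (- X) = 2" if "card X = 2" for X :: "4 set"
    using that by (simp add: Compl_eq_Diff_UNIV card_Diff_subset)
  show "quads_in \<sigma> = (\<lambda>b. quad_of (\<sigma>, {a, b})) ` (- {a})"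
  proof (intro equalityI subsetI)
    fix q assume "q \<in> quads_in \<sigma>"
    then obtain X where q: "q = quad_of (\<sigma>, X)" "card X = 2" by (auto simp: quads_in_def quad_of_def)
    have "\<exists>Y. q = quad_of (\<sigma>, Y) \<and> card Y = 2 \<and> a \<in> Y"
    proof (cases "a \<in> X")
      case False
      have "q = quad_of (\<sigma>, - X)" using q by (simp add: quad_of_def insert_commute)
      then show ?thesis using False card_compl[OF q(2)] by blast
    qed (use q in blast)
    then show "q \<in> (\<lambda>b. quad_of (\<sigma>, {a, b})) ` (- {a})"
      using pair by blast
  next
    fix q assume "q \<in> (\<lambda>b. quad_of (\<sigma>, {a, b})) ` (- {a})"
    then obtain b where "b \<noteq> a" "q = quad_of (\<sigma>, {a, b})" by auto
    then show "q \<in> quads_in \<sigma>" by (auto simp: quads_in_def quad_of_def intro!: exI[of _ "{a, b}"])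
  qed
  show "inj_on (\<lambda>b. quad_of (\<sigma>, {a, b})) (- {a})"
    by (rule inj_onI) (auto simp: quad_of_eq_iff doubleton_eq_iff)
qed

lemma sum_quads_in:
  assumes "distinct [a, b, c, d]"
  shows "(\<Sum>q\<in>quads_in \<sigma>. h q) =
    h (quad_of (\<sigma>, {a, b})) + h (quad_of (\<sigma>, {a, c})) + (h (quad_of (\<sigma>, {a, d})) :: complex)"
  unfolding quads_in_image(1)[of \<sigma> a] sum.reindex[OF quads_in_image(2)]
  by (simp add: sum_complement_label[OF assms])

lemma quads_image: "quads = quad_of ` {(\<sigma>, X). card X = 2}"
  by (auto simp: quads_def quads_in_def quad_of_def)

lemma sum_quads_curve_index:
  fixes \<zeta> :: "'t::finite quad \<Rightarrow> complex"
  assumes "\<And>s. s \<in> set \<alpha> \<Longrightarrow> seg_quad s \<in> quads"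
  shows "(\<Sum>q\<in>quads. of_int (quad_curve_index q \<alpha>) * \<zeta> q) = (\<Sum>s\<leftarrow>\<alpha>. of_int (seg_sign s) * \<zeta> (seg_quad s))"
  using assms
proof (induction \<alpha>)
  case (Cons s \<alpha>)
  have "(\<Sum>q\<in>quads. of_int (quad_curve_index q (s # \<alpha>)) * \<zeta> q) =
      (\<Sum>q\<in>quads. (if q = seg_quad s then of_int (seg_sign s) * \<zeta> q else 0) + of_int (quad_curve_index q \<alpha>) * \<zeta> q)"
    by (intro sum.cong refl) (auto simp: quad_curve_index_def algebra_simps)
  also have "\<dots> = of_int (seg_sign s) * \<zeta> (seg_quad s) + (\<Sum>q\<in>quads. of_int (quad_curve_index q \<alpha>) * \<zeta> q)"
    using Cons.prems by (simp add: sum.distrib)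
  finally show ?case using Cons by simp
qed (simp add: quad_curve_index_def)

lemma seg_quad_eq: "seg_quad s = quad_of (seg_tet s, {seg_vertex s, isolated s})"
  by (simp add: seg_quad_def quad_of_def Let_def)

context triangulation
begin

lemma card_edges:
  assumes "e \<in> edges \<Phi>" "Y \<in> e"
  shows "card (snd Y) = 2"
proof -
  obtain X where "card (snd X) = 2" "e = (simplex_glue \<Phi>)\<^sup>* `` {X}"
    using assms(1) by (auto simp: edges_def elim!: quotientE)
  then show ?thesis using card_simplex_glue[of X Y] assms(2) by simp
qed

text \<open>The index counts the members of the class \<open>e\<close> over each quadrilateral type,
  so this is the sum over \<open>e\<close> grouped by type.\<close>

lemma sum_quads_edge_index:
  fixes \<zeta> :: "'t quad \<Rightarrow> complex"
  assumes e: "e \<in> edges \<Phi>"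
  shows "(\<Sum>q\<in>quads. of_nat (quad_edge_index q e) * \<zeta> q) = (\<Sum>Y\<in>e. \<zeta> (quad_of Y))"
proof -
  have "(\<Sum>Y\<in>e. \<zeta> (quad_of Y)) = (\<Sum>q\<in>quads. \<Sum>Y | Y \<in> e \<and> quad_of Y = q. \<zeta> (quad_of Y))"
    by (rule sum.group[symmetric]) (use card_edges[OF e] in \<open>auto simp: quads_image\<close>)
  also have "\<dots> = (\<Sum>q\<in>quads. of_nat (quad_edge_index q e) * \<zeta> q)"
  proof (intro sum.cong refl)
    fix q :: "'t quad" assume "q \<in> quads"
    then obtain \<sigma> X where q: "q = quad_of (\<sigma>, X)" by (auto simp: quads_image)
    have "{Y. Y \<in> e \<and> quad_of Y = q} = Pair \<sigma> ` {X \<in> snd q. (fst q, X) \<in> e}"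
      unfolding q by (auto simp: quad_of_def doubleton_eq_iff)
    then have "card {Y. Y \<in> e \<and> quad_of Y = q} = quad_edge_index q e"
      by (simp add: quad_edge_index_def card_image inj_on_def)
    then show "(\<Sum>Y | Y \<in> e \<and> quad_of Y = q. \<zeta> (quad_of Y)) = of_nat (quad_edge_index q e) * \<zeta> q"
      by simp
  qed
  finally show ?thesis ..
qed

lemma balanced_quad:
  assumes tet: "\<And>\<sigma>. (\<Sum>q\<in>quads_in \<sigma>. \<zeta> q) = 0"
    and edge: "\<And>e. e \<in> edges \<Phi> \<Longrightarrow> (\<Sum>q\<in>quads. of_nat (quad_edge_index q e) * \<zeta> q) = 0"
  shows "balanced \<Phi> (\<lambda>X. \<zeta> (quad_of X))"
  unfolding balanced_def
proof (intro conjI ballI allI impI)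
  show "(\<Sum>X\<in>e. \<zeta> (quad_of X)) = 0" if "e \<in> edges \<Phi>" for e
    using edge[OF that] sum_quads_edge_index[OF that] by simp
  show "\<zeta> (quad_of (\<sigma>, {a, b})) + \<zeta> (quad_of (\<sigma>, {a, c})) + \<zeta> (quad_of (\<sigma>, {a, d})) = 0"
    if "distinct [a, b, c, d]" for \<sigma> a b c d
    using tet[of \<sigma>] sum_quads_in[OF that, of \<zeta> \<sigma>] by simp
  show "\<zeta> (quad_of (\<sigma>, - X)) = \<zeta> (quad_of (\<sigma>, X))" for \<sigma> X
    by (simp add: quad_of_def insert_commute)
qed

lemma sum_holonomy:
  assumes \<alpha>: "closed_normal_curve \<Phi> v \<alpha>" and "balanced \<Phi> (\<lambda>X. \<zeta> (quad_of X))"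
  shows "(\<Sum>t\<leftarrow>curve_path \<alpha>. jump (tri_potential (\<lambda>X. \<zeta> (quad_of X))) t) =
    (\<Sum>q\<in>quads. of_int (quad_curve_index q \<alpha>) * \<zeta> q)"
proof -
  have "seg_quad s \<in> quads" if "s \<in> set \<alpha>" for s
    using closed_normal_curve_segment(1)[OF \<alpha> that] by (auto simp: seg_quad_eq quads_image)
  then show ?thesis
    by (simp add: sum_curve_tri_potential[OF assms] sum_quads_curve_index seg_quad_eq)
qed

end

text \<open>The derivatives of the logarithms of \<open>u\<close>, \<open>1 / (1 - u)\<close> and
  \<open>(u - 1) / u\<close>, the shapes of the three types in cyclic order.\<close>

definition log_coeff :: "('t \<Rightarrow> 't quad) \<Rightarrow> complex ^ 't::finite \<Rightarrow> 't quad \<Rightarrow> complex" where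
  "log_coeff pref z q = (let u = z $ fst q in
     if q = pref (fst q) then 1 / u
     else if q = next_quad (pref (fst q)) then 1 / (1 - u) else 1 / (u * (u - 1)))"

lemma log_coeff_simps:
  fixes pref :: "'t::finite \<Rightarrow> 't quad"
  assumes "pref \<sigma> \<in> quads_in \<sigma>"
  shows "log_coeff pref z (pref \<sigma>) = 1 / z $ \<sigma>"
    "log_coeff pref z (next_quad (pref \<sigma>)) = 1 / (1 - z $ \<sigma>)"
    "log_coeff pref z (next_quad (next_quad (pref \<sigma>))) = 1 / (z $ \<sigma> * (z $ \<sigma> - 1))"
proof -
  have "fst (next_quad q) = fst q" for q :: "'t quad" by (simp add: next_quad_def)
  then show "log_coeff pref z (pref \<sigma>) = 1 / z $ \<sigma>"
    "log_coeff pref z (next_quad (pref \<sigma>)) = 1 / (1 - z $ \<sigma>)"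
    "log_coeff pref z (next_quad (next_quad (pref \<sigma>))) = 1 / (z $ \<sigma> * (z $ \<sigma> - 1))"
    using fst_quads_in[OF assms] quads_in_pref(3,4,5)[OF assms] by (simp_all add: log_coeff_def Let_def)
qed

lemma open_upper_half_space: "open (upper_half_space :: (complex ^ 't::finite) set)"
proof -
  have "upper_half_space = {w :: complex ^ 't. \<forall>\<sigma>. w $ \<sigma> \<in> {u. Im u > 0}}"
    by (simp add: upper_half_space_def)
  moreover have "open {u. Im u > 0}" by (rule open_halfspace_Im_gt)
  ultimately show ?thesis using open_vector_box[of "\<lambda>_ :: 't. {u. Im u > 0}"] by simp
qed

lemma shape_of_simps:
  fixes pref :: "'t::finite \<Rightarrow> 't quad"
  assumes pref: "\<And>\<sigma>. pref \<sigma> \<in> quads_in \<sigma>" and w: "w \<in> upper_half_space"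
  shows "shape_of pref w (pref \<sigma>) = w $ \<sigma>"
    "shape_of pref w (next_quad (pref \<sigma>)) = 1 / (1 - w $ \<sigma>)"
    "shape_of pref w (next_quad (next_quad (pref \<sigma>))) = 1 / (1 - 1 / (1 - w $ \<sigma>))"
proof -
  have bij: "bij_betw (shape_coords pref) shape_space upper_half_space"
    by (rule bij_betw_shape_coords[OF pref])
  have mem: "shape_of pref w \<in> shape_space"
    using bij_betw_apply[OF bij_betw_inv_into[OF bij] w] by (simp add: shape_of_def)
  have "shape_coords pref (shape_of pref w) $ \<sigma> = w $ \<sigma>"
    unfolding shape_of_def bij_betw_inv_into_right[OF bij w] ..
  then show 1: "shape_of pref w (pref \<sigma>) = w $ \<sigma>" by (simp add: shape_coords_def)
  have "pref \<sigma> \<in> quads" "next_quad (pref \<sigma>) \<in> quads"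
    using pref[of \<sigma>] quads_in_pref(1)[OF pref[of \<sigma>]] by (auto simp: quads_def)
  then show "shape_of pref w (next_quad (pref \<sigma>)) = 1 / (1 - w $ \<sigma>)"
    "shape_of pref w (next_quad (next_quad (pref \<sigma>))) = 1 / (1 - 1 / (1 - w $ \<sigma>))"
    using mem 1 by (simp_all add: shape_space_def)
qed

lemma has_derivative_Ln_shape:
  fixes pref :: "'t::finite \<Rightarrow> 't quad"
  assumes pref: "\<And>\<sigma>. pref \<sigma> \<in> quads_in \<sigma>" and z: "z \<in> upper_half_space" and q: "q \<in> quads"
  shows "((\<lambda>w. Ln (shape_of pref w q)) has_derivative (\<lambda>h. log_coeff pref z q * h $ fst q)) (at z)"
proof -
  define \<sigma> where "\<sigma> = fst q"
  define u where "u = z $ \<sigma>"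
  have u: "Im u > 0" using z by (simp add: u_def upper_half_space_def)
  then have nz: "u \<noteq> 0" "1 - u \<noteq> 0" by auto
  \<comment> \<open>This is \<open>(1 - u) * (1 - u) \<noteq> 0\<close> in expanded form, needed to
    clear denominators.\<close>
  have nz': "1 + u * u \<noteq> u * 2"
  proof
    assume "1 + u * u = u * 2"
    then have "(1 - u) * (1 - u) = 0" by algebra
    then show False using nz by simp
  qed
  have slit: "w \<notin> \<real>\<^sub>\<le>\<^sub>0" if "Im w > 0" for w
    using that by (simp add: complex_nonpos_Reals_iff)
  have nth: "((\<lambda>w :: complex ^ 't. w $ \<sigma>) has_derivative (\<lambda>h. h $ \<sigma>)) (at z)"
    by (rule bounded_linear_imp_has_derivative[OF bounded_linear_vec_nth])
  \<comment> \<open>The rational formulas for \<open>shape_of\<close> are available on the open set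
    \<open>upper_half_space\<close>, from which the derivative is transferred.\<close>
  have chain: "((\<lambda>w. Ln (shape_of pref w q)) has_derivative (\<lambda>h. c * h $ \<sigma>)) (at z)"
    if "(F has_field_derivative c) (at u)" "\<And>w. w \<in> upper_half_space \<Longrightarrow> Ln (shape_of pref w q) = F (w $ \<sigma>)" for F c
  proof (rule has_derivative_transform_within_open[OF _ open_upper_half_space z])
    have "(F has_derivative (\<lambda>h. c * h)) (at (z $ \<sigma>))"
      using that(1) by (simp add: has_field_derivative_def u_def)
    from has_derivative_compose[OF nth this]
    show "((\<lambda>w. F (w $ \<sigma>)) has_derivative (\<lambda>h. c * h $ \<sigma>)) (at z)" .
  qed (use that(2) in simp)
  note shape = shape_of_simps[OF pref, of _ \<sigma>]
  have "q = pref \<sigma> \<or> q = next_quad (pref \<sigma>) \<or> q = next_quad (next_quad (pref \<sigma>))"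
    using q quads_in_pref(1)[OF pref[of \<sigma>]] by (auto simp: quads_iff \<sigma>_def)
  then show ?thesis
    unfolding \<sigma>_def[symmetric]
  proof (elim disjE)
    assume q: "q = pref \<sigma>"
    have "(Ln has_field_derivative 1 / u) (at u)"
      using slit[OF u] by (auto intro!: derivative_eq_intros simp: inverse_eq_divide)
    then show "((\<lambda>w. Ln (shape_of pref w q)) has_derivative (\<lambda>h. log_coeff pref z q * h $ \<sigma>)) (at z)"
      unfolding q log_coeff_simps[of pref, OF pref] u_def[symmetric] by (intro chain[unfolded q]) (simp_all add: shape)
  next
    assume q: "q = next_quad (pref \<sigma>)"
    have s: "1 / (1 - u) \<notin> \<real>\<^sub>\<le>\<^sub>0" by (rule slit[OF Im_shape_step(1)[OF u]])
    have "((\<lambda>w. Ln (1 / (1 - w))) has_field_derivative 1 / (1 - u)) (at u)"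
      by (rule derivative_eq_intros refl s nz)+ (use nz nz' in \<open>simp add: field_simps\<close>)
    then show "((\<lambda>w. Ln (shape_of pref w q)) has_derivative (\<lambda>h. log_coeff pref z q * h $ \<sigma>)) (at z)"
      unfolding q log_coeff_simps[of pref, OF pref] u_def[symmetric] by (intro chain[unfolded q]) (simp_all add: shape)
  next
    assume q: "q = next_quad (next_quad (pref \<sigma>))"
    have s: "1 / (1 - 1 / (1 - u)) \<notin> \<real>\<^sub>\<le>\<^sub>0" by (rule slit[OF Im_shape_step(1)[OF Im_shape_step(1)[OF u]]])
    have nz'': "1 - 1 / (1 - u) \<noteq> 0" using nz by (simp add: field_simps)
    have "((\<lambda>w. Ln (1 / (1 - 1 / (1 - w)))) has_field_derivative 1 / (u * (u - 1))) (at u)"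
      by (rule derivative_eq_intros refl s nz nz'')+ (use nz nz' nz'' in \<open>simp add: divide_simps\<close>)
    then show "((\<lambda>w. Ln (shape_of pref w q)) has_derivative (\<lambda>h. log_coeff pref z q * h $ \<sigma>)) (at z)"
      unfolding q log_coeff_simps[of pref, OF pref] u_def[symmetric] by (intro chain[unfolded q]) (simp_all add: shape)
  qed
qed

text \<open>The product of the three shapes of a tetrahedron is the constant -1, so the derivatives
  of their logarithms sum to zero.\<close>

lemma sum_log_coeff:
  assumes pref: "pref \<sigma> \<in> quads_in \<sigma>" and u: "Im (z $ \<sigma>) > 0"
  shows "(\<Sum>q\<in>quads_in \<sigma>. log_coeff pref z q) = 0"
proof -
  define u where "u = z $ \<sigma>"
  have nz: "u \<noteq> 0" "1 - u \<noteq> 0" "u - 1 \<noteq> 0" using u by (auto simp: u_def)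
  have "(\<Sum>q\<in>quads_in \<sigma>. log_coeff pref z q) = 1 / u + (1 / (1 - u) + 1 / (u * (u - 1)))"
    unfolding quads_in_pref(1)[OF pref]
    using quads_in_pref(3,4,5)[OF pref] log_coeff_simps[of pref \<sigma> z, OF pref]
    by (simp add: u_def eq_commute[of "pref \<sigma>"] eq_commute[of "next_quad (pref \<sigma>)" "next_quad (next_quad (pref \<sigma>))"])
  also have "\<dots> = 0" using nz by (simp add: divide_simps) algebra
  finally show ?thesis .
qed

text \<open>The symplectic form is cyclically invariant, so that it can be evaluated at the preferred quadrilateral type.\<close>

lemma Im_form_term:
  fixes h :: complex
  assumes pref: "pref \<sigma> \<in> quads_in \<sigma>" and u: "Im (z $ \<sigma>) > 0"
    and \<zeta>: "\<And>q. q \<in> quads_in \<sigma> \<Longrightarrow> \<zeta> q = log_coeff pref z q * h"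
  shows "Im (\<zeta> (quad_of (\<sigma>, {0, 2})) * cnj (\<zeta> (quad_of (\<sigma>, {0, 1}))) -
      \<zeta> (quad_of (\<sigma>, {0, 1})) * cnj (\<zeta> (quad_of (\<sigma>, {0, 2})))) =
    2 * Im (z $ \<sigma>) * (cmod h)\<^sup>2 / (cmod (z $ \<sigma> * (1 - z $ \<sigma>)))\<^sup>2"
proof -
  define q where "q = pref \<sigma>"
  define w where "w = z $ \<sigma>"
  have nz: "w \<noteq> 0" "1 - w \<noteq> 0" using u by (auto simp: w_def)
  define B where "B q = \<zeta> (next_quad q) * cnj (\<zeta> q) - \<zeta> q * cnj (\<zeta> (next_quad q))" for q
  have q: "q \<in> quads_in \<sigma>" "next_quad q \<in> quads_in \<sigma>" "next_quad (next_quad q) \<in> quads_in \<sigma>"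
    using pref quads_in_pref(1)[OF pref] by (simp_all add: q_def)
  have "(\<Sum>q\<in>quads_in \<sigma>. \<zeta> q) = 0"
    using sum_log_coeff[of pref \<sigma> z, OF pref u] \<zeta> by (simp flip: sum_distrib_right)
  then have "\<zeta> q + (\<zeta> (next_quad q) + \<zeta> (next_quad (next_quad q))) = 0"
    using quads_in_pref[OF q(1)] by (simp add: eq_commute[of q] eq_commute[of "next_quad q" "next_quad (next_quad q)"])
  then have *: "\<zeta> (next_quad (next_quad q)) = - \<zeta> q - \<zeta> (next_quad q)"
    by (simp add: eq_neg_iff_add_eq_0 algebra_simps)
  \<comment> \<open>\<open>B\<close> is antisymmetric in its two values, and the third value is
    minus the sum of the others.\<close>
  have B: "B (next_quad q) = B q" "B (next_quad (next_quad q)) = B q"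
    unfolding B_def quads_in_pref(2)[OF q(1)] * by (simp_all add: algebra_simps)
  define q1 where "q1 = quad_of (\<sigma>, {0, 1 :: 4})"
  have q1: "q1 = (\<sigma>, {{0, 1}, {2, 3}})" "next_quad q1 = quad_of (\<sigma>, {0, 2})"
    by (simp_all add: q1_def quad_of_def compl_labels next_quad_simps)
  have "q1 \<in> {q, next_quad q, next_quad (next_quad q)}"
    using quads_in_eq[of \<sigma>] quads_in_pref(1)[OF q(1)] q1(1) by auto
  then have "B q1 = B q" using B by auto
  also have "\<dots> = (1 / (1 - w) * h) * cnj (1 / w * h) - (1 / w * h) * cnj (1 / (1 - w) * h)"
    unfolding B_def \<zeta>[OF q(1)] \<zeta>[OF q(2)] by (simp add: q_def log_coeff_simps[of pref, OF pref] w_def)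
  \<comment> \<open>The numerator is \<open>w * (1 - cnj w) - (1 - w) * cnj w\<close>, where the
    products cancel.\<close>
  also have "\<dots> = (h * cnj h) * (w - cnj w) / ((w * (1 - w)) * cnj (w * (1 - w)))"
    using nz by (simp add: divide_simps) algebra
  also have "\<dots> = of_real ((cmod h)\<^sup>2) * (of_real (2 * Im w) * \<i>) / of_real ((cmod (w * (1 - w)))\<^sup>2)"
    by (simp only: complex_norm_square complex_diff_cnj)
  also have "Im \<dots> = 2 * Im w * (cmod h)\<^sup>2 / (cmod (w * (1 - w)))\<^sup>2"
    by (simp flip: of_real_power of_real_mult of_real_divide)
  finally show ?thesis by (simp add: B_def q1(2) w_def q1_def[symmetric])
qed

theorem theorem9:
  fixes \<Phi> :: "'t::finite face_pairing"
    and pref :: "'t \<Rightarrow> 't quad"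
    and g :: "'t simplex_class \<Rightarrow> nat"
    and lon mer :: "'t simplex_class \<Rightarrow> nat \<Rightarrow> 't curve"
    and z :: "complex ^ 't"
  assumes "oriented_triangulation \<Phi>"
    and "\<And>\<sigma>. pref \<sigma> \<in> quads_in \<sigma>"
    and "\<And>v. v \<in> vertices \<Phi> \<Longrightarrow> canonical_generators \<Phi> v (g v) (lon v) (mer v)"
    and "z \<in> upper_half_space"
  shows "\<exists>DG DH.
    has_product_derivative (\<lambda>w. log_curvature \<Phi> (shape_of pref w)) DG (edges \<Phi>) z \<and>
    has_product_derivative (\<lambda>w \<alpha>. log_holonomy \<alpha> (shape_of pref w)) DH (longitudes \<Phi> g lon) z \<and>
    inj (\<lambda>w. (DG w, DH w))"
proof -
  note pref = assms(2) and can = assms(3) and z = assms(4)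
  interpret triangulation \<Phi> by standard (rule assms(1))
  define \<zeta> where "\<zeta> h q = log_coeff pref z q * h $ fst q" for h :: "complex ^ 't" and q
  define DG where "DG h = restrict (\<lambda>e. \<Sum>q\<in>quads. of_nat (quad_edge_index q e) * \<zeta> h q) (edges \<Phi>)" for h
  define DH where "DH h = restrict (\<lambda>\<alpha>. \<Sum>q\<in>quads. of_int (quad_curve_index q \<alpha>) * \<zeta> h q) (longitudes \<Phi> g lon)" for h
  have deriv: "((\<lambda>w. \<Sum>q\<in>quads. c q * Ln (shape_of pref w q)) has_derivative (\<lambda>h. \<Sum>q\<in>quads. c q * \<zeta> h q)) (at z)"
    for c :: "'t quad \<Rightarrow> complex"
    unfolding \<zeta>_def
    by (intro has_derivative_sum has_derivative_mult_right has_derivative_Ln_shape pref z)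
  have "has_product_derivative (\<lambda>w. log_curvature \<Phi> (shape_of pref w)) DG (edges \<Phi>) z"
    unfolding has_product_derivative_def DG_def log_curvature_def by (simp add: deriv)
  moreover have "has_product_derivative (\<lambda>w \<alpha>. log_holonomy \<alpha> (shape_of pref w)) DH (longitudes \<Phi> g lon) z"
    unfolding has_product_derivative_def DH_def log_holonomy_def by (simp add: deriv)
  moreover have "inj (\<lambda>w. (DG w, DH w))"
  proof (rule injI)
    fix u w assume eq: "(DG u, DH u) = (DG w, DH w)"
    define h where "h = u - w"
    have \<zeta>_diff: "\<zeta> h q = \<zeta> u q - \<zeta> w q" for q
      by (simp add: \<zeta>_def h_def right_diff_distrib)
    have edge: "(\<Sum>q\<in>quads. of_nat (quad_edge_index q e) * \<zeta> h q) = 0" if "e \<in> edges \<Phi>" for e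
    proof -
      have "DG u e = DG w e" using eq by simp
      then show ?thesis using that by (simp add: DG_def \<zeta>_diff right_diff_distrib sum_subtractf)
    qed
    have lon: "(\<Sum>q\<in>quads. of_int (quad_curve_index q \<alpha>) * \<zeta> h q) = 0" if "\<alpha> \<in> longitudes \<Phi> g lon" for \<alpha>
    proof -
      have "DH u \<alpha> = DH w \<alpha>" using eq by simp
      then show ?thesis using that by (simp add: DH_def \<zeta>_diff right_diff_distrib sum_subtractf)
    qed
    have Im_z: "Im (z $ \<sigma>) > 0" for \<sigma> using z by (simp add: upper_half_space_def)
    have \<zeta>_eq: "\<zeta> h q = log_coeff pref z q * h $ \<sigma>" if "q \<in> quads_in \<sigma>" for q \<sigma>
      using fst_quads_in[OF that] by (simp add: \<zeta>_def)
    have tet: "(\<Sum>q\<in>quads_in \<sigma>. \<zeta> h q) = 0" for \<sigma>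
    proof -
      have "(\<Sum>q\<in>quads_in \<sigma>. \<zeta> h q) = (\<Sum>q\<in>quads_in \<sigma>. log_coeff pref z q) * h $ \<sigma>"
        unfolding sum_distrib_right by (intro sum.cong refl \<zeta>_eq)
      then show ?thesis using sum_log_coeff[of pref \<sigma> z, OF pref Im_z] by simp
    qed
    \<comment> \<open>The linear equations of the kernel have integer coefficients, so conjugation
      preserves them.\<close>
    have cnj: "(\<Sum>q\<in>A. c q * cnj (\<zeta> h q)) = cnj (\<Sum>q\<in>A. c q * \<zeta> h q)"
      if "\<And>q. cnj (c q) = c q" for A c
      using that by simp
    have bal: "balanced \<Phi> (\<lambda>X. \<zeta> h (quad_of X))"
      by (rule balanced_quad[OF tet edge])
    have bal': "balanced \<Phi> (\<lambda>X. cnj (\<zeta> h (quad_of X)))"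
    proof (rule balanced_quad[of "\<lambda>q. cnj (\<zeta> h q)"])
      show "(\<Sum>q\<in>quads_in \<sigma>. cnj (\<zeta> h q)) = 0" for \<sigma>
        using tet[of \<sigma>] by (simp flip: cnj_sum)
      show "(\<Sum>q\<in>quads. of_nat (quad_edge_index q e) * cnj (\<zeta> h q)) = 0" if "e \<in> edges \<Phi>" for e
        using edge[OF that] cnj[of "\<lambda>q. of_nat (quad_edge_index q e)" quads] by simp
    qed
    have curve: "\<exists>v. closed_normal_curve \<Phi> v \<alpha>" if "\<alpha> \<in> longitudes \<Phi> g lon" for \<alpha>
      using that can unfolding longitudes_def canonical_generators_def by blast
    have "(\<Sum>\<sigma>\<in>UNIV. \<zeta> h (quad_of (\<sigma>, {0, 2})) * cnj (\<zeta> h (quad_of (\<sigma>, {0, 1}))) -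
        \<zeta> h (quad_of (\<sigma>, {0, 1})) * cnj (\<zeta> h (quad_of (\<sigma>, {0, 2})))) = 0"
    proof (rule isotropy[OF can bal bal'])
      fix \<alpha> assume \<alpha>: "\<alpha> \<in> longitudes \<Phi> g lon"
      then obtain v where v: "closed_normal_curve \<Phi> v \<alpha>" using curve by blast
      show "(\<Sum>t\<leftarrow>curve_path \<alpha>. jump (tri_potential (\<lambda>X. \<zeta> h (quad_of X))) t) = 0"
        unfolding sum_holonomy[OF v bal] by (rule lon[OF \<alpha>])
      show "(\<Sum>t\<leftarrow>curve_path \<alpha>. jump (tri_potential (\<lambda>X. cnj (\<zeta> h (quad_of X)))) t) = 0"
        unfolding sum_holonomy[of v \<alpha> "\<lambda>q. cnj (\<zeta> h q)", OF v bal']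
        using lon[OF \<alpha>] cnj[of "\<lambda>q. of_int (quad_curve_index q \<alpha>)" quads] by simp
    qed
    from arg_cong[OF this, of Im]
    have "(\<Sum>\<sigma>\<in>UNIV. 2 * Im (z $ \<sigma>) * (cmod (h $ \<sigma>))\<^sup>2 / (cmod (z $ \<sigma> * (1 - z $ \<sigma>)))\<^sup>2) = 0"
      unfolding Im_sum using Im_form_term[of pref _ z "\<zeta> h" "h $ _", OF pref Im_z \<zeta>_eq] by simp
    moreover have "2 * Im (z $ \<sigma>) * (cmod (h $ \<sigma>))\<^sup>2 / (cmod (z $ \<sigma> * (1 - z $ \<sigma>)))\<^sup>2 \<ge> 0" for \<sigma>
      using Im_z[of \<sigma>] by simp
    ultimately have "2 * Im (z $ \<sigma>) * (cmod (h $ \<sigma>))\<^sup>2 / (cmod (z $ \<sigma> * (1 - z $ \<sigma>)))\<^sup>2 = 0" for \<sigma>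
      by (subst (asm) sum_nonneg_eq_0_iff) simp_all
    moreover have "z $ \<sigma> * (1 - z $ \<sigma>) \<noteq> 0" "Im (z $ \<sigma>) \<noteq> 0" for \<sigma>
      using Im_z[of \<sigma>] by auto
    ultimately have "h $ \<sigma> = 0" for \<sigma> by simp
    then show "u = w" by (simp add: h_def vec_eq_iff)
  qed
  ultimately show ?thesis by blast
qed

end
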